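(* There exists a set $\mathsf{A}$ of four $4\times 4$ real matrices with the following two properties. (1) For every periodic Lebesgue measurable switching law $A\colon[0,\infty)\to \mathrm{conv}(\mathsf{A})$, every solution $x(t)$ of $\dot{x}(t)=A(t)x(t)$ converges exponentially to zero as $t\to\infty$. (2) The linear switched system defined by $\mathsf{A}$ is not globally uniformly asymptotically stable (GUAS).
   Context: Here $\mathrm{conv}(\mathsf{A})$ denotes the convex hull of $\mathsf{A}$ in the space of real $4\times 4$ matrices. Solutions of $\dot{x}(t)=A(t)x(t)$ with $A$ Lebesgue measurable are understood in the Carathéodory sense: $x\colon[0,\infty)\to\mathbb{R}^4$ is absolutely continuous (on compact intervals) and satisfies the equation for Lebesgue a.e. $t\ge 0$; for each initial condition $x(0)$ there is a unique such solution. The linear switched system defined by a finite set $\mathsf{A}$ of real $d\times d$ matrices is called globally uniformly asymptotically stable (GUAS) if there exists a class $\mathcal{KL}$ function $\beta\colon[0,\infty)\times[0,\infty)\to[0,\infty)$ such that $\|x(t)\|\le\beta(\|x(0)\|,t)$ for all $t\ge 0$, for every Lebesgue measurable switching law $A\colon[0,\infty)\to\mathsf{A}$ and every solution $x$ of $\dot{x}(t)=A(t)x(t)$. (Class $\mathcal{KL}$: continuous, strictly increasing in the first argument with $\beta(0,t)=0$, and decreasing to $0$ in the second argument.) *)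

theory Defs
  imports "HOL-Analysis.Analysis"
begin

definition abs_continuous_on :: "real set \<Rightarrow> (real \<Rightarrow> 'a::real_normed_vector) \<Rightarrow> bool" where
  "abs_continuous_on S f \<longleftrightarrow>
     (\<forall>e>0. \<exists>d>0. \<forall>(n::nat) u v.
        (\<forall>k<n. u k \<le> v k \<and> {u k..v k} \<subseteq> S) \<longrightarrow>
        disjoint_family_on (\<lambda>k. {u k<..<v k}) {..<n} \<longrightarrow>
        (\<Sum>k<n. v k - u k) < d \<longrightarrow>
        (\<Sum>k<n. norm (f (v k) - f (u k))) < e)"

text \<open>Functions on \<open>[0,\<infinity>)\<close> are represented by functions on all reals; no condition below
  refers to their values at negative times.\<close>

definition switching_law :: "(real^'n^'n) set \<Rightarrow> (real \<Rightarrow> real^'n^'n) \<Rightarrow> bool" where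
  "switching_law S A \<longleftrightarrow>
     A \<in> borel_measurable (lebesgue_on {0..}) \<and> (\<forall>t\<ge>0. A t \<in> S)"

definition periodic_law :: "(real \<Rightarrow> 'a) \<Rightarrow> bool" where
  "periodic_law A \<longleftrightarrow> (\<exists>T>0. \<forall>t\<ge>0. A (t + T) = A t)"

definition caratheodory_solution ::
    "(real \<Rightarrow> real^'n^'n) \<Rightarrow> (real \<Rightarrow> real^'n) \<Rightarrow> bool" where
  "caratheodory_solution A x \<longleftrightarrow>
     (\<forall>a\<ge>0. \<forall>b. abs_continuous_on {a..b} x) \<and>
     (AE t in lebesgue_on {0..}. (x has_vector_derivative A t *v x t) (at t within {0..}))"

definition converges_exponentially_to_zero :: "(real \<Rightarrow> 'a::real_normed_vector) \<Rightarrow> bool" where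
  "converges_exponentially_to_zero x \<longleftrightarrow>
     (\<exists>C c. c > 0 \<and> (\<forall>t\<ge>0. norm (x t) \<le> C * exp (- c * t)))"

text \<open>Decreasing in the second argument is meant in the weak sense (strictness would be
  impossible at \<open>r = 0\<close>).\<close>

definition class_KL :: "(real \<Rightarrow> real \<Rightarrow> real) \<Rightarrow> bool" where
  "class_KL \<beta> \<longleftrightarrow>
     (\<forall>r\<ge>0. \<forall>t\<ge>0. \<beta> r t \<ge> 0) \<and>
     continuous_on ({0..} \<times> {0..}) (\<lambda>(r, t). \<beta> r t) \<and>
     (\<forall>t\<ge>0. strict_mono_on {0..} (\<lambda>r. \<beta> r t) \<and> \<beta> 0 t = 0) \<and>
     (\<forall>r\<ge>0. antimono_on {0..} (\<beta> r) \<and> (\<beta> r \<longlongrightarrow> 0) at_top)"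

definition GUAS :: "(real^'n^'n) set \<Rightarrow> bool" where
  "GUAS S \<longleftrightarrow>
     (\<exists>\<beta>. class_KL \<beta> \<and>
        (\<forall>A x. switching_law S A \<longrightarrow> caratheodory_solution A x \<longrightarrow>
           (\<forall>t\<ge>0. norm (x t) \<le> \<beta> (norm (x 0)) t)))"

end

(* A planar system with the two Hurwitz matrices -L + N and -L + N', where N is nilpotent and N' is N
   conjugated by the rotation through a right angle, has for L tanh L = 1 a C^1 Barabanov function V:
   V never increases along a trajectory, whatever the switching law, and it is constant exactly along
   the bang-bang trajectories that use one matrix in the first and third quadrant and the other one in
   the remaining quadrants, each for time 1. A periodic law that keeps V constant along some trajectory
   must therefore have an integral period; all other periodic laws are exponentially stable.

   Let two copies of this system run at speeds 1 and c with c irrational and take the tensor product of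
   the solutions: this is a switched system on R^4 with the four matrices A_i (x) I + c I (x) A_j. For
   a T-periodic law, T and c T are not both integers, so one factor decays exponentially while the other
   one stays bounded. The tensor product of the two bang-bang trajectories, however, does not decay. *)

theory Submission
  imports Defs
begin

section \<open>Absolutely continuous functions\<close>

text \<open>The condition \<open>L tanh L = 1\<close> says that on the coordinate axes the two
  fields are parallel. The arc of one matrix through a quadrant then continues into the
  quarter-turned arc of the other one with a common tangent, and this is what makes V continuously
  differentiable. Inside a quadrant, use of the wrong matrix makes \<open>ln V\<close> decrease at a
  rate proportional to \<open>phase * (1 - phase)\<close>. This rate degenerates at the axes, so
  constancy of V controls the law only on compact pieces of open quadrants. Trajectories cross the
  axes transversally under every law, and the results for the open quadrants are glued by continuity
  at these crossings. Laws are merely measurable, so monotonicity always comes from the sign of a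
  derivative almost everywhere combined with absolute continuity. A direct sum of the two planar
  systems would not do, since it decays only if both components decay. The price of the tensor
  product is that a solution in four dimensions need not be a product; by existence and uniqueness
  it is a combination of four products.\<close>

lemma locally_nonincreasing_imp_le:
  fixes g :: "real \<Rightarrow> real"
  assumes "a \<le> b"
    and loc: "\<And>x. a \<le> x \<Longrightarrow> x \<le> b \<Longrightarrow>
      \<exists>d>0. \<forall>u v. a \<le> u \<and> u \<le> x \<and> x \<le> v \<and> v \<le> b \<and> v - u < d \<longrightarrow> g v \<le> g u"
  shows "g b \<le> g a"
proof -
  define P where "P u v \<longleftrightarrow> a \<le> u \<and> v \<le> b \<longrightarrow> g v \<le> g u" for u v
  have "P a b"
    using \<open>a \<le> b\<close>
  proof (induction rule: Bolzano)
    case (trans p q r)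
    then show ?case unfolding P_def by linarith
  next
    case (local x)
    then obtain d where d: "d > 0"
      "\<And>u v. a \<le> u \<and> u \<le> x \<and> x \<le> v \<and> v \<le> b \<and> v - u < d \<Longrightarrow> g v \<le> g u"
      using loc[of x] by auto
    then show ?case unfolding P_def by (intro exI[of _ d]) auto
  qed
  then show ?thesis by (simp add: P_def)
qed

lemma abs_continuous_onD:
  assumes "abs_continuous_on S f" "e > 0"
  obtains d where "d > 0"
    "\<And>(n::nat) u v. (\<And>k. k < n \<Longrightarrow> u k \<le> v k \<and> {u k..v k} \<subseteq> S) \<Longrightarrow>
        disjoint_family_on (\<lambda>k. {u k<..<v k}) {..<n} \<Longrightarrow>
        (\<Sum>k<n. v k - u k) < d \<Longrightarrow> (\<Sum>k<n. norm (f (v k) - f (u k))) < e"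
  using assms unfolding abs_continuous_on_def by meson

lemma sum_disjoint_intervals_le:
  fixes u v :: "nat \<Rightarrow> real"
  assumes uv: "\<And>k. k < n \<Longrightarrow> u k \<le> v k \<and> {u k..v k} \<subseteq> U"
    and disj: "disjoint_family_on (\<lambda>k. {u k<..<v k}) {..<n}"
    and U: "U \<in> lmeasurable"
  shows "(\<Sum>k<n. v k - u k) \<le> measure lebesgue U"
proof -
  have "(\<Sum>k<n. v k - u k) = (\<Sum>k<n. measure lebesgue {u k<..<v k})"
    by (intro sum.cong) (use uv in auto)
  also have "\<dots> = measure lebesgue (\<Union>k<n. {u k<..<v k})"
    by (rule measure_finite_Union[symmetric]) (use disj emeasure_lborel_Ioo uv in auto)
  also have "\<dots> \<le> measure lebesgue U"
  proof (rule measure_mono_fmeasurable)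
    show "(\<Union>k<n. {u k<..<v k}) \<subseteq> U"
    proof
      fix x assume "x \<in> (\<Union>k<n. {u k<..<v k})"
      then obtain k where "k < n" "x \<in> {u k..v k}" by force
      then show "x \<in> U" using uv by blast
    qed
  qed (use U in auto)
  finally show ?thesis .
qed

text \<open>The exceptional null set is absorbed by \<open>w\<close>, the variation of \<open>f\<close> along intervals inside
  a small open neighbourhood of that set.\<close>

lemma abs_continuous_on_nonincreasing:
  fixes f :: "real \<Rightarrow> real"
  assumes "a \<le> b" and ac: "abs_continuous_on {a..b} f" and N: "negligible N"
    and der: "\<And>t. a < t \<Longrightarrow> t < b \<Longrightarrow> t \<notin> N \<Longrightarrow> \<exists>D\<le>0. (f has_real_derivative D) (at t)"
  shows "f b \<le> f a"
proof (rule field_le_epsilon)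
  fix e0 :: real assume "e0 > 0"
  \<comment> \<open>\<open>e\<close> is spent twice: \<open>e * (b - a)\<close> on the error of the
    derivative and \<open>e\<close> on the variation \<open>w\<close>; together they make up
    \<open>e0\<close>.\<close>
  define e where "e = e0 / (b - a + 1)"
  have "e * (b - a + 1) = e0" using \<open>a \<le> b\<close> by (simp add: e_def)
  then have e: "e > 0" "e * (b - a) + e = e0"
    using \<open>e0 > 0\<close> \<open>a \<le> b\<close> by (simp_all add: e_def distrib_left)
  obtain d where d: "d > 0"
    and small: "\<And>(n::nat) u v. (\<And>k. k < n \<Longrightarrow> u k \<le> v k \<and> {u k..v k} \<subseteq> {a..b}) \<Longrightarrow>
        disjoint_family_on (\<lambda>k. {u k<..<v k}) {..<n} \<Longrightarrow>
        (\<Sum>k<n. v k - u k) < d \<Longrightarrow> (\<Sum>k<n. norm (f (v k) - f (u k))) < e"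
    by (rule abs_continuous_onD[OF ac e(1)]) blast
  \<comment> \<open>The endpoints join the exceptional set because the derivative is known only in
    the open interval.\<close>
  define N' where "N' = N \<union> {a, b}"
  have N': "negligible N'" unfolding N'_def using N by auto
  then have "N' \<in> sets lebesgue" by (simp add: negligible_imp_sets)
  from sets_lebesgue_outer_open[OF this d] obtain U where
    U: "open U" "N' \<subseteq> U" "U - N' \<in> lmeasurable" "emeasure lebesgue (U - N') < ennreal d"
    by blast
  have Um: "U \<in> lmeasurable"
    by (metis N' U(2,3) Un_Diff_cancel2 fmeasurable.Un negligible_iff_measure sup.absorb1)
  have Ud: "measure lebesgue U < d"
  proof -
    have "measure lebesgue U = measure lebesgue (U - N')"
      by (metis N' measure_Diff_null_set Um fmeasurableD negligible_iff_null_sets)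
    also have "\<dots> < d"
      using U(3,4) d by (simp add: emeasure_eq_measure2 ennreal_less_iff)
    finally show ?thesis .
  qed
  \<comment> \<open>The families counted up to time \<open>t\<close> lie in \<open>U\<close>, whose
    measure is below \<open>d\<close>, so absolute continuity bounds each of their sums by
    \<open>e\<close>. Hence the supremum \<open>w t\<close> is finite and at most
    \<open>e\<close>.\<close>
  define fam where "fam t = {(n::nat, u, v). (\<forall>k<n. u k \<le> v k \<and> {u k..v k} \<subseteq> U \<inter> {a..t}) \<and>
      disjoint_family_on (\<lambda>k. {u k<..<v k}) {..<n}}" for t
  define var where "var = (\<lambda>(n::nat, u, v). \<Sum>k<n. \<bar>f (v k) - f (u k)\<bar>)"
  define w where "w t = Sup (var ` fam t)" for t
  have bound: "var F < e" if "F \<in> fam t" "t \<le> b" for F t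
  proof -
    obtain n u v where F: "F = (n, u, v)" by (cases F) auto
    have *: "\<And>k. k < n \<Longrightarrow> u k \<le> v k \<and> {u k..v k} \<subseteq> U \<inter> {a..t}"
      and **: "disjoint_family_on (\<lambda>k. {u k<..<v k}) {..<n}"
      using that F unfolding fam_def by auto
    have "(\<Sum>k<n. v k - u k) < d"
      using sum_disjoint_intervals_le[of n u v U] * ** Um Ud by (meson Int_subset_iff le_less_trans)
    moreover have "\<And>k. k < n \<Longrightarrow> u k \<le> v k \<and> {u k..v k} \<subseteq> {a..b}"
      using * \<open>t \<le> b\<close> by (meson Int_subset_iff atLeastatMost_subset_iff order_trans order_refl)
    ultimately show ?thesis
      using small[of n u v] ** by (simp add: F var_def)
  qed
  have bdd: "bdd_above (var ` fam t)" if "t \<le> b" for t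
    using bound[OF _ that] by (intro bdd_aboveI2[of _ _ e]) (auto intro: less_imp_le)
  have emp: "(0, u, v) \<in> fam t" for u v t
    by (auto simp: fam_def disjoint_family_on_def)
  have w_le: "w t \<le> e" if "t \<le> b" for t
    unfolding w_def by (rule cSup_least) (use emp bound[OF _ that] in \<open>force intro: less_imp_le\<close>)+
  have w_ge: "0 \<le> w t" if "t \<le> b" for t
  proof -
    have "var (0, undefined, undefined) \<le> w t"
      unfolding w_def by (rule cSup_upper[OF _ bdd[OF that]]) (use emp in blast)
    then show ?thesis by (simp add: var_def)
  qed
  have w_mono: "w p \<le> w q" if "p \<le> q" "q \<le> b" for p q
    unfolding w_def
  proof (rule cSup_subset_mono)
    show "var ` fam p \<subseteq> var ` fam q"
      using that unfolding fam_def by (intro image_mono) force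
  qed (use emp bdd[OF that(2)] in auto)
  \<comment> \<open>A family that ends before \<open>p\<close> can be extended by the interval from
    \<open>p\<close> to \<open>q\<close>, stored at the next index \<open>n\<close>.\<close>
  have w_step: "\<bar>f q - f p\<bar> \<le> w q - w p" if "a \<le> p" "p \<le> q" "q \<le> b" "{p..q} \<subseteq> U" for p q
  proof -
    have "w p \<le> w q - \<bar>f q - f p\<bar>"
      unfolding w_def[of p]
    proof (rule cSup_least)
      fix x assume "x \<in> var ` fam p"
      then obtain n u v where F: "(n, u, v) \<in> fam p" "x = var (n, u, v)" by auto
      define u' where "u' = u(n := p)"
      define v' where "v' = v(n := q)"
      have sub: "\<And>k. k < n \<Longrightarrow> u k \<le> v k \<and> {u k..v k} \<subseteq> U \<inter> {a..p}"
        and disj: "disjoint_family_on (\<lambda>k. {u k<..<v k}) {..<n}"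
        using F(1) unfolding fam_def by auto
      have vp: "u k \<le> v k" "v k \<le> p" if "k < n" for k
        using sub[OF that] by auto
      have "(Suc n, u', v') \<in> fam q"
        unfolding fam_def
      proof (clarify, intro CollectI case_prodI conjI allI impI Int_greatest)
        fix k assume "k < Suc n"
        show "u' k \<le> v' k" using vp[of k] that \<open>k < Suc n\<close> by (auto simp: u'_def v'_def less_Suc_eq)
        show "{u' k..v' k} \<subseteq> U"
          using sub[of k] that \<open>k < Suc n\<close> by (auto simp: u'_def v'_def less_Suc_eq)
        show "{u' k..v' k} \<subseteq> {a..q}"
        proof (cases "k = n")
          case False
          then have "{u k..v k} \<subseteq> {a..p}" using sub[of k] \<open>k < Suc n\<close> by auto
          then show ?thesis using False \<open>p \<le> q\<close> by (force simp: u'_def v'_def)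
        qed (use that in \<open>auto simp: u'_def v'_def\<close>)
      next
        have "{u k<..<v k} \<inter> {p<..<q} = {}" if "k < n" for k
          using vp[OF that] by (meson disjoint_iff greaterThanLessThan_iff not_less_iff_gr_or_eq
              order_less_le_trans order_less_trans)
        then show "disjoint_family_on (\<lambda>k. {u' k<..<v' k}) {..<Suc n}"
          using disj unfolding disjoint_family_on_def u'_def v'_def
          by (simp add: lessThan_Suc Int_commute del: Int_greaterThanLessThan greaterThanLessThan_empty_iff)
      qed
      then have "var (Suc n, u', v') \<le> w q"
        unfolding w_def by (intro cSup_upper bdd that) auto
      moreover have "var (Suc n, u', v') = x + \<bar>f q - f p\<bar>"
        by (simp add: var_def F u'_def v'_def)
      ultimately show "x \<le> w q - \<bar>f q - f p\<bar>" by simp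
    qed (use emp in auto)
    then show ?thesis by simp
  qed
  \<comment> \<open>Near exceptional points the term \<open>w\<close> pays for an increase of
    \<open>f\<close>, elsewhere \<open>e * t\<close> pays for the error of the linear approximation.
    So \<open>g\<close> does not increase near any point.\<close>
  define g where "g t = f t - e * t - w t" for t
  have "g b \<le> g a"
  proof (rule locally_nonincreasing_imp_le[OF \<open>a \<le> b\<close>])
    fix x assume x: "a \<le> x" "x \<le> b"
    show "\<exists>d>0. \<forall>u v. a \<le> u \<and> u \<le> x \<and> x \<le> v \<and> v \<le> b \<and> v - u < d \<longrightarrow> g v \<le> g u"
    proof (cases "x \<in> N'")
      case True
      then obtain r where r: "r > 0" "ball x r \<subseteq> U" using U openE by blast
      show ?thesis
      proof (intro exI[of _ r] conjI allI impI r)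
        fix u v assume *: "a \<le> u \<and> u \<le> x \<and> x \<le> v \<and> v \<le> b \<and> v - u < r"
        then have "{u..v} \<subseteq> ball x r" by (auto simp: dist_real_def)
        then have "\<bar>f v - f u\<bar> \<le> w v - w u" using * r by (intro w_step) auto
        moreover have "e * u \<le> e * v" using e * by simp
        ultimately show "g v \<le> g u" unfolding g_def by linarith
      qed
    next
      case False
      then have "a < x" "x < b" "x \<notin> N" using x by (auto simp: N'_def)
      then obtain D where D: "D \<le> 0" "(f has_real_derivative D) (at x)" using der by blast
      then have "(f has_derivative (*) D) (at x)"
        by (simp add: has_field_derivative_def)
      then obtain r where r: "r > 0"
        "\<And>y. norm (y - x) < r \<Longrightarrow> norm (f y - f x - D * (y - x)) \<le> e * norm (y - x)"
        using e unfolding has_derivative_at_alt by blast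
      show ?thesis
      proof (intro exI[of _ r] conjI allI impI r)
        fix u v assume *: "a \<le> u \<and> u \<le> x \<and> x \<le> v \<and> v \<le> b \<and> v - u < r"
        have "f v - f x - D * (v - x) \<le> e * (v - x)" using r(2)[of v] * by (auto simp: abs_le_iff)
        moreover have "- (f u - f x - D * (u - x)) \<le> e * (x - u)"
          using r(2)[of u] * by (auto simp: abs_le_iff)
        moreover have "D * (v - x) \<le> 0" "D * (u - x) \<ge> 0"
          using D * by (auto simp: mult_le_0_iff zero_le_mult_iff)
        moreover have "w u \<le> w v" using w_mono[of u v] * by auto
        moreover have "e * (v - x) + e * (x - u) = e * v - e * u" by (simp add: algebra_simps)
        ultimately show "g v \<le> g u" unfolding g_def by linarith
      qed
    qed
  qed
  then have "f b \<le> f a + e * (b - a) + (w b - w a)" by (simp add: g_def algebra_simps)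
  then show "f b \<le> f a + e0" using w_le[of b] w_ge[of a] \<open>a \<le> b\<close> e by linarith
qed

section \<open>Closure properties of absolute continuity\<close>

lemma abs_continuous_on_dominated:
  fixes f :: "real \<Rightarrow> 'a::real_normed_vector" and g :: "real \<Rightarrow> 'b::real_normed_vector"
    and h :: "real \<Rightarrow> 'c::real_normed_vector"
  assumes f: "abs_continuous_on S f" and g: "abs_continuous_on S g"
    and le: "\<And>u v. u \<in> S \<Longrightarrow> v \<in> S \<Longrightarrow> norm (h v - h u) \<le> C * (norm (f v - f u) + norm (g v - g u))"
  shows "abs_continuous_on S h"
  unfolding abs_continuous_on_def
proof (intro allI impI)
  fix e :: real assume "e > 0"
  \<comment> \<open>\<open>\<bar>C\<bar> + 1\<close> replaces \<open>C\<close>, which may be zero or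
    negative; the factor 2 divides the budget between \<open>f\<close> and \<open>g\<close>.\<close>
  define e' where "e' = e / (2 * (\<bar>C\<bar> + 1))"
  have e': "e' > 0" using \<open>e > 0\<close> by (simp add: e'_def)
  obtain d1 where d1: "d1 > 0"
    "\<And>(n::nat) u v. (\<And>k. k < n \<Longrightarrow> u k \<le> v k \<and> {u k..v k} \<subseteq> S) \<Longrightarrow>
        disjoint_family_on (\<lambda>k. {u k<..<v k}) {..<n} \<Longrightarrow>
        (\<Sum>k<n. v k - u k) < d1 \<Longrightarrow> (\<Sum>k<n. norm (f (v k) - f (u k))) < e'"
    by (rule abs_continuous_onD[OF f e']) blast
  obtain d2 where d2: "d2 > 0"
    "\<And>(n::nat) u v. (\<And>k. k < n \<Longrightarrow> u k \<le> v k \<and> {u k..v k} \<subseteq> S) \<Longrightarrow>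
        disjoint_family_on (\<lambda>k. {u k<..<v k}) {..<n} \<Longrightarrow>
        (\<Sum>k<n. v k - u k) < d2 \<Longrightarrow> (\<Sum>k<n. norm (g (v k) - g (u k))) < e'"
    by (rule abs_continuous_onD[OF g e']) blast
  show "\<exists>d>0. \<forall>(n::nat) u v.
        (\<forall>k<n. u k \<le> v k \<and> {u k..v k} \<subseteq> S) \<longrightarrow>
        disjoint_family_on (\<lambda>k. {u k<..<v k}) {..<n} \<longrightarrow>
        (\<Sum>k<n. v k - u k) < d \<longrightarrow>
        (\<Sum>k<n. norm (h (v k) - h (u k))) < e"
  proof (intro exI[of _ "min d1 d2"] conjI allI impI)
    fix n :: nat and u v :: "nat \<Rightarrow> real"
    assume *: "\<forall>k<n. u k \<le> v k \<and> {u k..v k} \<subseteq> S"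
      "disjoint_family_on (\<lambda>k. {u k<..<v k}) {..<n}" "(\<Sum>k<n. v k - u k) < min d1 d2"
    have "(\<Sum>k<n. norm (h (v k) - h (u k))) \<le>
        (\<Sum>k<n. C * (norm (f (v k) - f (u k)) + norm (g (v k) - g (u k))))"
      by (rule sum_mono, rule le) (use * in force)+
    also have "\<dots> \<le> (\<Sum>k<n. (\<bar>C\<bar> + 1) * (norm (f (v k) - f (u k)) + norm (g (v k) - g (u k))))"
      by (intro sum_mono mult_right_mono) auto
    also have "\<dots> = (\<bar>C\<bar> + 1) * ((\<Sum>k<n. norm (f (v k) - f (u k))) + (\<Sum>k<n. norm (g (v k) - g (u k))))"
      by (simp add: sum_distrib_left sum.distrib algebra_simps)
    also have "\<dots> < (\<bar>C\<bar> + 1) * (e' + e')"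
      using d1(2)[of n u v] d2(2)[of n u v] * by (intro mult_strict_left_mono add_strict_mono) auto
    also have "\<dots> = e"
    proof -
      have "e' * (\<bar>C\<bar> + 1) = e / 2"
        unfolding e'_def by (subst nonzero_eq_divide_eq[symmetric]) (auto simp: add_nonneg_eq_0_iff)
      then show ?thesis by (simp add: algebra_simps)
    qed
    finally show "(\<Sum>k<n. norm (h (v k) - h (u k))) < e" .
  qed (use d1 d2 in auto)
qed

lemma abs_continuous_on_lipschitz:
  fixes f :: "real \<Rightarrow> 'a::real_normed_vector"
  assumes "\<And>u v. u \<in> S \<Longrightarrow> v \<in> S \<Longrightarrow> u \<le> v \<Longrightarrow> norm (f v - f u) \<le> C * (v - u)"
  shows "abs_continuous_on S f"
  unfolding abs_continuous_on_def
proof (intro allI impI)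
  fix e :: real assume "e > 0"
  show "\<exists>d>0. \<forall>(n::nat) u v.
        (\<forall>k<n. u k \<le> v k \<and> {u k..v k} \<subseteq> S) \<longrightarrow>
        disjoint_family_on (\<lambda>k. {u k<..<v k}) {..<n} \<longrightarrow>
        (\<Sum>k<n. v k - u k) < d \<longrightarrow>
        (\<Sum>k<n. norm (f (v k) - f (u k))) < e"
  proof (intro exI[of _ "e / (\<bar>C\<bar> + 1)"] conjI allI impI)
    fix n :: nat and u v :: "nat \<Rightarrow> real"
    assume *: "\<forall>k<n. u k \<le> v k \<and> {u k..v k} \<subseteq> S" "(\<Sum>k<n. v k - u k) < e / (\<bar>C\<bar> + 1)"
    have "(\<Sum>k<n. norm (f (v k) - f (u k))) \<le> (\<Sum>k<n. (\<bar>C\<bar> + 1) * (v k - u k))"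
    proof (rule sum_mono)
      fix k assume "k \<in> {..<n}"
      then have k: "u k \<le> v k" "u k \<in> S" "v k \<in> S" using * by force+
      then have "norm (f (v k) - f (u k)) \<le> C * (v k - u k)" using assms by blast
      also have "\<dots> \<le> (\<bar>C\<bar> + 1) * (v k - u k)" using k by (intro mult_right_mono) auto
      finally show "norm (f (v k) - f (u k)) \<le> (\<bar>C\<bar> + 1) * (v k - u k)" .
    qed
    also have "\<dots> = (\<bar>C\<bar> + 1) * (\<Sum>k<n. v k - u k)" by (simp add: sum_distrib_left)
    also have "\<dots> < e" using * by (simp add: field_simps)
    finally show "(\<Sum>k<n. norm (f (v k) - f (u k))) < e" .
  qed (use \<open>e > 0\<close> in auto)
qed

lemma abs_continuous_on_ident: "abs_continuous_on S (\<lambda>t :: real. t)"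
  by (rule abs_continuous_on_lipschitz[where C = 1]) simp

lemma abs_continuous_on_subset:
  assumes "abs_continuous_on S f" "T \<subseteq> S" shows "abs_continuous_on T f"
  using assms unfolding abs_continuous_on_def by (meson order_trans)

lemma abs_continuous_on_imp_continuous_on:
  fixes f :: "real \<Rightarrow> 'a::real_normed_vector"
  assumes f: "abs_continuous_on {a..b} f"
  shows "continuous_on {a..b} f"
  unfolding continuous_on_iff
proof (intro ballI allI impI)
  fix x e :: real assume x: "x \<in> {a..b}" and "e > 0"
  from abs_continuous_onD[OF f \<open>e > 0\<close>] obtain d where d: "d > 0"
    "\<And>(n::nat) u v. (\<And>k. k < n \<Longrightarrow> u k \<le> v k \<and> {u k..v k} \<subseteq> {a..b}) \<Longrightarrow>
        disjoint_family_on (\<lambda>k. {u k<..<v k}) {..<n} \<Longrightarrow>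
        (\<Sum>k<n. v k - u k) < d \<Longrightarrow> (\<Sum>k<n. norm (f (v k) - f (u k))) < e" by blast
  have *: "norm (f q - f p) < e" if "p \<le> q" "p \<in> {a..b}" "q \<in> {a..b}" "q - p < d" for p q
    using d(2)[of 1 "\<lambda>_. p" "\<lambda>_. q"] that by (auto simp: disjoint_family_on_def)
  show "\<exists>d>0. \<forall>x'\<in>{a..b}. dist x' x < d \<longrightarrow> dist (f x') (f x) < e"
  proof (intro exI[of _ d] conjI ballI impI)
    fix y assume "y \<in> {a..b}" "dist y x < d"
    then show "dist (f y) (f x) < e"
      using *[of x y] *[of y x] x
      by (cases "x \<le> y") (auto simp: dist_norm dist_real_def norm_minus_commute abs_if)
  qed (use d in auto)
qed

lemma abs_continuous_on_bounded:
  fixes f :: "real \<Rightarrow> 'a::real_normed_vector"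
  assumes "abs_continuous_on {a..b} f"
  obtains B where "B > 0" "\<And>t. t \<in> {a..b} \<Longrightarrow> norm (f t) \<le> B"
proof -
  have "bounded (f ` {a..b})"
    using compact_continuous_image[OF abs_continuous_on_imp_continuous_on[OF assms]]
    by (simp add: compact_imp_bounded)
  then show ?thesis using that unfolding bounded_pos by auto
qed

text \<open>Both factors are bounded on the compact interval, and the increment of the product
  splits as in the Leibniz rule.\<close>

lemma abs_continuous_on_bounded_bilinear:
  assumes "bounded_bilinear pr" "abs_continuous_on {a..b} f" "abs_continuous_on {a..b} g"
  shows "abs_continuous_on {a..b} (\<lambda>t. pr (f t) (g t))"
proof -
  interpret bounded_bilinear pr by fact
  obtain B1 where B1: "B1 > 0" "\<And>t. t \<in> {a..b} \<Longrightarrow> norm (f t) \<le> B1"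
    using abs_continuous_on_bounded[OF assms(2)] by blast
  obtain B2 where B2: "B2 > 0" "\<And>t. t \<in> {a..b} \<Longrightarrow> norm (g t) \<le> B2"
    using abs_continuous_on_bounded[OF assms(3)] by blast
  obtain K where K: "K > 0" "\<And>x y. norm (pr x y) \<le> norm x * norm y * K"
    using pos_bounded by blast
  show ?thesis
  proof (rule abs_continuous_on_dominated[OF assms(2,3), where C = "(B1 + B2) * K"])
    fix u v assume uv: "u \<in> {a..b}" "v \<in> {a..b}"
    have "pr (f v) (g v) - pr (f u) (g u) = pr (f v) (g v - g u) + pr (f v - f u) (g u)"
      by (simp add: diff_left diff_right)
    then have "norm (pr (f v) (g v) - pr (f u) (g u))
        \<le> norm (f v) * norm (g v - g u) * K + norm (f v - f u) * norm (g u) * K"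
      by (metis K(2) norm_triangle_mono)
    also have "\<dots> \<le> B1 * norm (g v - g u) * K + norm (f v - f u) * B2 * K"
      using B1 B2 K uv by (intro add_mono mult_right_mono mult_left_mono) auto
    also have "\<dots> \<le> (B1 + B2) * K * (norm (f v - f u) + norm (g v - g u))"
      using B1 B2 K by (simp add: algebra_simps)
    finally show "norm (pr (f v) (g v) - pr (f u) (g u)) \<le>
        (B1 + B2) * K * (norm (f v - f u) + norm (g v - g u))" .
  qed
qed

lemma abs_continuous_on_bounded_linear:
  assumes "bounded_linear h" "abs_continuous_on S f"
  shows "abs_continuous_on S (\<lambda>t. h (f t))"
proof -
  interpret bounded_linear h by fact
  obtain K where K: "\<And>x. norm (h x) \<le> norm x * K" using bounded by blast
  show ?thesis
  proof (rule abs_continuous_on_dominated[OF assms(2,2), where C = "\<bar>K\<bar>"])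
    fix u v
    have "norm (h (f v) - h (f u)) \<le> norm (f v - f u) * K" by (metis K diff)
    also have "\<dots> \<le> norm (f v - f u) * \<bar>K\<bar>" by (intro mult_left_mono) auto
    also have "\<dots> \<le> \<bar>K\<bar> * (norm (f v - f u) + norm (f v - f u))" by (simp add: algebra_simps)
    finally show "norm (h (f v) - h (f u)) \<le> \<bar>K\<bar> * (norm (f v - f u) + norm (f v - f u))" .
  qed
qed

lemma abs_continuous_on_add:
  assumes "abs_continuous_on S f" "abs_continuous_on S g"
  shows "abs_continuous_on S (\<lambda>t. f t + g t)"
proof (rule abs_continuous_on_dominated[OF assms, where C = 1])
  fix u v show "norm (f v + g v - (f u + g u)) \<le> 1 * (norm (f v - f u) + norm (g v - g u))"
    by (simp add: add_diff_add norm_triangle_ineq)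
qed

lemma C1_imp_lipschitz:
  fixes g :: "real \<Rightarrow> 'a::real_normed_vector"
  assumes "\<And>t. t \<in> {a..b} \<Longrightarrow> (g has_vector_derivative g' t) (at t)"
    and "continuous_on {a..b} g'"
  obtains C where "\<And>u v. a \<le> u \<Longrightarrow> u \<le> v \<Longrightarrow> v \<le> b \<Longrightarrow> norm (g v - g u) \<le> C * (v - u)"
proof -
  obtain B where B: "\<And>t. t \<in> {a..b} \<Longrightarrow> norm (g' t) \<le> B"
    using compact_imp_bounded[OF compact_continuous_image[OF assms(2)]] unfolding bounded_iff by fastforce
  show thesis
  proof (rule that)
    fix u v assume uv: "a \<le> u" "u \<le> v" "v \<le> b"
    have "norm (g v - g u) \<le> B * norm (v - u)"
    proof (rule differentiable_bound[of "{a..b}" g "\<lambda>t h. h *\<^sub>R g' t"])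
      fix t assume t: "t \<in> {a..b}"
      then show "(g has_derivative (\<lambda>h. h *\<^sub>R g' t)) (at t within {a..b})"
        using assms(1) has_derivative_at_withinI has_vector_derivative_def by blast
      show "onorm (\<lambda>h. h *\<^sub>R g' t) \<le> B"
      proof (rule onorm_le)
        fix h show "norm (h *\<^sub>R g' t) \<le> B * norm h"
          using mult_left_mono[OF B[OF t], of "\<bar>h\<bar>"] by (simp add: mult.commute)
      qed
    qed (use uv in auto)
    then show "norm (g v - g u) \<le> B * (v - u)" using uv by simp
  qed
qed

lemma abs_continuous_on_C1:
  fixes g :: "real \<Rightarrow> 'a::real_normed_vector"
  assumes "\<And>t. t \<in> {a..b} \<Longrightarrow> (g has_vector_derivative g' t) (at t)"
    and "continuous_on {a..b} g'"
  shows "abs_continuous_on {a..b} g"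
proof -
  obtain C where "\<And>u v. a \<le> u \<Longrightarrow> u \<le> v \<Longrightarrow> v \<le> b \<Longrightarrow> norm (g v - g u) \<le> C * (v - u)"
    using C1_imp_lipschitz[OF assms] by blast
  then show ?thesis by (intro abs_continuous_on_lipschitz[where C = C]) auto
qed

lemma abs_continuous_on_inverse:
  fixes f :: "real \<Rightarrow> real"
  assumes f: "abs_continuous_on {a..b} f" and d: "d > 0" "\<And>t. t \<in> {a..b} \<Longrightarrow> d \<le> f t"
  shows "abs_continuous_on {a..b} (\<lambda>t. inverse (f t))"
proof (rule abs_continuous_on_dominated[OF f f, where C = "1 / d\<^sup>2"])
  fix u v assume uv: "u \<in> {a..b}" "v \<in> {a..b}"
  have pos: "f u > 0" "f v > 0" using d uv by force+
  have "d\<^sup>2 \<le> f v * f u" using d uv pos by (auto simp: power2_eq_square intro!: mult_mono)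
  then have "\<bar>f v - f u\<bar> / (f v * f u) \<le> \<bar>f v - f u\<bar> / d\<^sup>2"
    using d pos by (intro divide_left_mono) auto
  moreover have "inverse (f v) - inverse (f u) = - ((f v - f u) / (f v * f u))"
    using pos by (simp add: field_simps)
  moreover have "\<bar>f v - f u\<bar> / d\<^sup>2 \<le> 2 * \<bar>f v - f u\<bar> / d\<^sup>2"
    by (intro divide_right_mono) auto
  ultimately show "norm (inverse (f v) - inverse (f u)) \<le> 1 / d\<^sup>2 * (norm (f v - f u) + norm (f v - f u))"
    using pos by (simp add: abs_mult)
qed

lemma abs_continuous_on_ln:
  fixes f :: "real \<Rightarrow> real"
  assumes f: "abs_continuous_on {a..b} f" and d: "d > 0" "\<And>t. t \<in> {a..b} \<Longrightarrow> d \<le> f t"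
  shows "abs_continuous_on {a..b} (\<lambda>t. ln (f t))"
proof (rule abs_continuous_on_dominated[OF f f, where C = "1 / d"])
  have *: "ln p - ln q \<le> \<bar>p - q\<bar> / d" if "p \<ge> d" "q \<ge> d" for p q
  proof -
    have "ln p - ln q \<le> (p - q) / q" using ln_diff_le[of p q] that d by simp
    also have "\<dots> \<le> \<bar>p - q\<bar> / q" using that d by (intro divide_right_mono) auto
    also have "\<dots> \<le> \<bar>p - q\<bar> / d" using that d by (intro divide_left_mono) auto
    finally show ?thesis .
  qed
  fix u v assume uv: "u \<in> {a..b}" "v \<in> {a..b}"
  have "\<bar>ln (f v) - ln (f u)\<bar> \<le> \<bar>f v - f u\<bar> / d"
    using *[of "f v" "f u"] *[of "f u" "f v"] d uv by (simp add: abs_le_iff abs_minus_commute)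
  then show "norm (ln (f v) - ln (f u)) \<le> 1 / d * (norm (f v - f u) + norm (f v - f u))"
    using divide_right_mono[of "\<bar>f v - f u\<bar>" "2 * \<bar>f v - f u\<bar>" d] d(1) by simp
qed

section \<open>Caratheodory solutions\<close>

text \<open>The right-hand side is an arbitrary function of time and state, so that differences of
  solutions and Wronskians are covered as well. The exceptional set is explicit, which allows the
  sets of several solutions to be united, and derivatives are two-sided because only
  \<open>t > 0\<close> is considered.\<close>

definition ode_solution :: "(real \<Rightarrow> 'a \<Rightarrow> 'a) \<Rightarrow> (real \<Rightarrow> 'a::real_normed_vector) \<Rightarrow> bool" where
  "ode_solution F y \<longleftrightarrow> (\<forall>b. abs_continuous_on {0..b} y) \<and>
     (\<exists>N. negligible N \<and> (\<forall>t>0. t \<notin> N \<longrightarrow> (y has_vector_derivative F t (y t)) (at t)))"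

lemma ode_solutionE:
  assumes "ode_solution F y"
  obtains N where "negligible N" "\<And>t. t > 0 \<Longrightarrow> t \<notin> N \<Longrightarrow> (y has_vector_derivative F t (y t)) (at t)"
  using assms unfolding ode_solution_def by blast

lemma ode_solution_abs_continuous:
  "ode_solution F y \<Longrightarrow> 0 \<le> a \<Longrightarrow> abs_continuous_on {a..b} y"
  unfolding ode_solution_def by (meson abs_continuous_on_subset atLeastatMost_subset_iff order_refl)

lemma ode_solution_continuous_on:
  fixes y :: "real \<Rightarrow> 'a::real_normed_vector"
  assumes "ode_solution F y" shows "continuous_on {0..} y"
proof -
  have "isCont y t" if "t > 0" for t
  proof -
    have "continuous_on {0..t+1} y"
      by (rule abs_continuous_on_imp_continuous_on[OF ode_solution_abs_continuous[OF assms]]) simp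
    then show ?thesis using that by (intro continuous_on_interior[of "{0..t+1}"]) auto
  qed
  moreover have "continuous (at 0 within {0..}) y"
  proof -
    have "continuous_on {0..1} y"
      by (rule abs_continuous_on_imp_continuous_on[OF ode_solution_abs_continuous[OF assms]]) simp
    then have "continuous (at 0 within {0..1}) y" by (simp add: continuous_on_eq_continuous_within)
    moreover have "at 0 within {0..1} = at (0::real) within {0..}"
      by (rule at_within_nhd[of _ "{-1<..<1}"]) auto
    ultimately show ?thesis by simp
  qed
  ultimately show ?thesis
    unfolding continuous_on_eq_continuous_within
    by (metis atLeast_iff continuous_at_imp_continuous_at_within order_le_less)
qed

text \<open>Gronwall's estimate in both directions of time: for \<open>r = 1\<close> and
  \<open>r = -1\<close> the function
  \<open>r * ((y t \<bullet> y t) * exp (- 2 * r * K * t))\<close> does not increase. By the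
  backward estimate a solution that is nonzero at one time does not vanish later.\<close>

lemma ode_solution_norm_le:
  fixes y :: "real \<Rightarrow> 'a::real_inner"
  assumes y: "ode_solution F y" and K: "\<And>t. t > 0 \<Longrightarrow> norm (F t (y t)) \<le> K * norm (y t)"
    and ab: "0 \<le> a" "a \<le> b"
  shows "norm (y b) \<le> exp (K * (b - a)) * norm (y a)"
    and "norm (y a) \<le> exp (K * (b - a)) * norm (y b)"
proof -
  obtain N where N: "negligible N"
    "\<And>t. t > 0 \<Longrightarrow> t \<notin> N \<Longrightarrow> (y has_vector_derivative F t (y t)) (at t)"
    using ode_solutionE[OF y] by blast
  have acy: "abs_continuous_on {a..b} y" using y ab ode_solution_abs_continuous by blast
  have key: "r * ((y b \<bullet> y b) * exp (- 2 * r * K * b)) \<le> r * ((y a \<bullet> y a) * exp (- 2 * r * K * a))"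
    if r: "r = 1 \<or> r = -1" for r
  proof (rule abs_continuous_on_nonincreasing[OF ab(2) _ N(1)])
    have "abs_continuous_on {a..b} (\<lambda>t. exp (- 2 * r * K * t))"
      by (rule abs_continuous_on_C1[where g' = "\<lambda>t. exp (- 2 * r * K * t) * (- 2 * r * K)"])
        (auto intro!: derivative_eq_intros continuous_intros
          simp: has_real_derivative_iff_has_vector_derivative[symmetric])
    then show "abs_continuous_on {a..b} (\<lambda>t. r * ((y t \<bullet> y t) * exp (- 2 * r * K * t)))"
      by (intro abs_continuous_on_bounded_linear[OF bounded_linear_mult_right]
          abs_continuous_on_bounded_bilinear[OF bounded_bilinear_mult]
          abs_continuous_on_bounded_bilinear[OF bounded_bilinear_inner] acy)
  next
    fix t assume t: "a < t" "t < b" "t \<notin> N"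
    let ?y' = "F t (y t)" and ?E = "exp (- 2 * r * K * t)"
    have dy: "(y has_vector_derivative ?y') (at t)" using N(2) t ab by auto
    have "((\<lambda>t. y t \<bullet> y t) has_vector_derivative (y t \<bullet> ?y' + ?y' \<bullet> y t)) (at t)"
      by (rule bounded_bilinear.has_vector_derivative[OF bounded_bilinear_inner dy dy])
    then have "((\<lambda>t. y t \<bullet> y t) has_real_derivative 2 * (y t \<bullet> ?y')) (at t)"
      by (simp add: has_real_derivative_iff_has_vector_derivative inner_commute)
    then have D: "((\<lambda>t. r * ((y t \<bullet> y t) * exp (- 2 * r * K * t))) has_real_derivative
        r * ((2 * (y t \<bullet> ?y')) * ?E + (?E * (- 2 * r * K)) * (y t \<bullet> y t))) (at t)"
      by (auto intro!: derivative_eq_intros)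
    have eq: "r * ((2 * (y t \<bullet> ?y')) * ?E + (?E * (- 2 * r * K)) * (y t \<bullet> y t)) =
        2 * ?E * (r * (y t \<bullet> ?y') - K * (y t \<bullet> y t))"
      using r by (auto simp: algebra_simps)
    have "\<bar>y t \<bullet> ?y'\<bar> \<le> K * (y t \<bullet> y t)"
    proof -
      have "\<bar>y t \<bullet> ?y'\<bar> \<le> norm (y t) * norm ?y'" by (rule Cauchy_Schwarz_ineq2)
      also have "\<dots> \<le> norm (y t) * (K * norm (y t))" using K[of t] t ab by (intro mult_left_mono) auto
      finally show ?thesis by (simp add: dot_square_norm power2_eq_square algebra_simps)
    qed
    then have "2 * ?E * (r * (y t \<bullet> ?y') - K * (y t \<bullet> y t)) \<le> 0"
      using r by (intro mult_nonneg_nonpos) auto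
    then show "\<exists>D\<le>0. ((\<lambda>t. r * ((y t \<bullet> y t) * exp (- 2 * r * K * t))) has_real_derivative D) (at t)"
      using D unfolding eq by blast
  qed
  have "(norm (y b))\<^sup>2 * exp (- 2 * K * b) \<le> (norm (y a))\<^sup>2 * exp (- 2 * K * a)"
    using key[of 1] by (simp add: dot_square_norm)
  then have "(norm (y b))\<^sup>2 * exp (- 2 * K * b) * exp (2 * K * b)
      \<le> (norm (y a))\<^sup>2 * exp (- 2 * K * a) * exp (2 * K * b)"
    by (rule mult_right_mono) simp
  then have "(norm (y b))\<^sup>2 \<le> (exp (K * (b - a)) * norm (y a))\<^sup>2"
    by (simp add: mult.assoc exp_add[symmetric] power_mult_distrib power2_eq_square[of "exp _"] algebra_simps)
  then show "norm (y b) \<le> exp (K * (b - a)) * norm (y a)"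
    by (rule power2_le_imp_le) simp
  have "(norm (y a))\<^sup>2 * exp (2 * K * a) \<le> (norm (y b))\<^sup>2 * exp (2 * K * b)"
    using key[of "-1"] by (simp add: dot_square_norm)
  then have "(norm (y a))\<^sup>2 * exp (2 * K * a) * exp (- 2 * K * a)
      \<le> (norm (y b))\<^sup>2 * exp (2 * K * b) * exp (- 2 * K * a)"
    by (rule mult_right_mono) simp
  then have "(norm (y a))\<^sup>2 \<le> (exp (K * (b - a)) * norm (y b))\<^sup>2"
    by (simp add: mult.assoc exp_add[symmetric] power_mult_distrib power2_eq_square[of "exp _"] algebra_simps)
  then show "norm (y a) \<le> exp (K * (b - a)) * norm (y b)"
    by (rule power2_le_imp_le) simp
qed

text \<open>\<open>H\<close> is constrained only along the two given trajectories. The right-hand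
  side of a difference may thus be a function of time alone, as in the uniqueness proof.\<close>

lemma ode_solution_add_scaled:
  fixes y z :: "real \<Rightarrow> 'a::real_normed_vector"
  assumes y: "ode_solution F y" and z: "ode_solution G z"
    and H: "\<And>t. t > 0 \<Longrightarrow> H t (c *\<^sub>R y t + d *\<^sub>R z t) = c *\<^sub>R F t (y t) + d *\<^sub>R G t (z t)"
  shows "ode_solution H (\<lambda>t. c *\<^sub>R y t + d *\<^sub>R z t)"
proof -
  obtain N1 where N1: "negligible N1"
    "\<And>t. t > 0 \<Longrightarrow> t \<notin> N1 \<Longrightarrow> (y has_vector_derivative F t (y t)) (at t)"
    using ode_solutionE[OF y] by blast
  obtain N2 where N2: "negligible N2"
    "\<And>t. t > 0 \<Longrightarrow> t \<notin> N2 \<Longrightarrow> (z has_vector_derivative G t (z t)) (at t)"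
    using ode_solutionE[OF z] by blast
  show ?thesis
    unfolding ode_solution_def
  proof (intro conjI allI exI[of _ "N1 \<union> N2"] impI)
    show "abs_continuous_on {0..b} (\<lambda>t. c *\<^sub>R y t + d *\<^sub>R z t)" for b
      using ode_solution_abs_continuous[OF y, of 0] ode_solution_abs_continuous[OF z, of 0]
      by (intro abs_continuous_on_add abs_continuous_on_bounded_linear[OF bounded_linear_scaleR_right]) auto
    show "((\<lambda>t. c *\<^sub>R y t + d *\<^sub>R z t) has_vector_derivative H t (c *\<^sub>R y t + d *\<^sub>R z t)) (at t)"
      if "0 < t" "t \<notin> N1 \<union> N2" for t
      using N1(2)[of t] N2(2)[of t] that
      by (auto intro!: derivative_eq_intros simp: H)
  qed (use N1 N2 in auto)
qed

lemma ode_solution_unique: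
  fixes y z :: "real \<Rightarrow> 'a::real_inner"
  assumes y: "ode_solution F y" and z: "ode_solution F z" and "y 0 = z 0"
    and lip: "\<And>t v w. t > 0 \<Longrightarrow> norm (F t v - F t w) \<le> K * norm (v - w)"
    and "t \<ge> 0"
  shows "y t = z t"
proof -
  have "ode_solution (\<lambda>t _. F t (y t) - F t (z t)) (\<lambda>t. 1 *\<^sub>R y t + (-1) *\<^sub>R z t)"
    by (rule ode_solution_add_scaled[OF y z]) simp
  from ode_solution_norm_le(1)[OF this, of K 0 t] lip \<open>y 0 = z 0\<close> \<open>t \<ge> 0\<close>
  show ?thesis by simp
qed

section \<open>Lebesgue differentiation and existence of solutions\<close>

lemma integral_has_vector_derivative_AE:
  fixes f :: "real \<Rightarrow> 'b::euclidean_space"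
  assumes int: "\<And>a b. f integrable_on {a..b}"
  obtains N where "negligible N"
    "\<And>a x. a < x \<Longrightarrow> x \<notin> N \<Longrightarrow> ((\<lambda>t. integral {a..t} f) has_vector_derivative f x) (at x)"
proof -
  obtain N1 where N1: "negligible N1" and R: "\<And>x e. \<lbrakk>x \<notin> N1; 0 < e\<rbrakk> \<Longrightarrow>
      \<exists>d>0. \<forall>h. 0 < h \<and> h < d \<longrightarrow> norm (integral (cbox x (x + h *\<^sub>R One)) f /\<^sub>R h ^ DIM(real) - f x) < e"
    using integrable_ccontinuous_explicit[of f] int by (metis box_real(2))
  \<comment> \<open>The averages above are taken to the right of the point. Reflecting
    \<open>f\<close> turns left averages into right ones, so the derivative becomes two-sided
    outside the union of two null sets.\<close>
  have int': "(\<lambda>s. f (- s)) integrable_on {a..b}" for a b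
    using int[of "-b" "-a"] Henstock_Kurzweil_Integration.integrable_reflect_real[of f "-a" "-b"] by simp
  obtain N2 where N2: "negligible N2" and Lf: "\<And>x e. \<lbrakk>x \<notin> N2; 0 < e\<rbrakk> \<Longrightarrow>
      \<exists>d>0. \<forall>h. 0 < h \<and> h < d \<longrightarrow>
        norm (integral (cbox x (x + h *\<^sub>R One)) (\<lambda>s. f (- s)) /\<^sub>R h ^ DIM(real) - f (- x)) < e"
    using integrable_ccontinuous_explicit[of "\<lambda>s. f (- s)"] int' by (metis box_real(2))
  have neg: "negligible (uminus ` N2)"
    by (rule negligible_differentiable_image_negligible[OF _ N2]) (auto intro!: derivative_intros simp: differentiable_on_def)
  have scale: "norm (I - h *\<^sub>R v) \<le> e * h" if "norm (I /\<^sub>R h - v) < e" "h > 0" for I v :: 'b and h e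
  proof -
    have "I - h *\<^sub>R v = h *\<^sub>R (I /\<^sub>R h - v)" using that by (simp add: scaleR_diff_right)
    then have "norm (I - h *\<^sub>R v) = h * norm (I /\<^sub>R h - v)" using that by simp
    also have "\<dots> \<le> h * e" using that by (intro mult_left_mono) auto
    finally show ?thesis by (simp add: mult.commute)
  qed
  show thesis
  proof (rule that)
    show "negligible (N1 \<union> uminus ` N2)" using N1 neg by simp
    fix a x assume x: "a < x" "x \<notin> N1 \<union> uminus ` N2"
    have x2: "- x \<notin> N2" using x by (metis UnI2 image_eqI minus_minus)
    show "((\<lambda>t. integral {a..t} f) has_vector_derivative f x) (at x)"
      unfolding has_vector_derivative_def has_derivative_at_alt
    proof (intro conjI allI impI)
      fix e :: real assume "e > 0"
      obtain d1 where d1: "d1 > 0"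
        "\<And>h. 0 < h \<Longrightarrow> h < d1 \<Longrightarrow> norm (integral {x..x + h} f /\<^sub>R h - f x) < e"
        using R[of x e] x \<open>e > 0\<close> by auto
      obtain d2 where d2: "d2 > 0"
        "\<And>h. 0 < h \<Longrightarrow> h < d2 \<Longrightarrow> norm (integral {-x..-x + h} (\<lambda>s. f (- s)) /\<^sub>R h - f x) < e"
        using Lf[of "-x" e] x2 \<open>e > 0\<close> by auto
      show "\<exists>d>0. \<forall>t. norm (t - x) < d \<longrightarrow>
        norm (integral {a..t} f - integral {a..x} f - (t - x) *\<^sub>R f x) \<le> e * norm (t - x)"
      proof (intro exI[of _ "min (x - a) (min d1 d2)"] conjI allI impI)
        fix t assume t: "norm (t - x) < min (x - a) (min d1 d2)"
        consider "t = x" | "t > x" | "t < x" by linarith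
        then show "norm (integral {a..t} f - integral {a..x} f - (t - x) *\<^sub>R f x) \<le> e * norm (t - x)"
        proof cases
          case 2
          have "integral {a..x} f + integral {x..t} f = integral {a..t} f"
            by (rule Henstock_Kurzweil_Integration.integral_combine) (use 2 x int in auto)
          moreover have "norm (integral {x..t} f - (t - x) *\<^sub>R f x) \<le> e * (t - x)"
            using d1(2)[of "t - x"] 2 t by (intro scale) auto
          ultimately show ?thesis using 2 by (metis add_diff_cancel_left' abs_of_pos diff_gt_0_iff_gt real_norm_def)
        next
          case 3
          have "integral {a..t} f + integral {t..x} f = integral {a..x} f"
            by (rule Henstock_Kurzweil_Integration.integral_combine) (use 3 x t int in auto)
          then have eq: "integral {a..t} f - integral {a..x} f - (t - x) *\<^sub>R f x =
              - (integral {t..x} f - (x - t) *\<^sub>R f x)" by (simp add: algebra_simps)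
          have "integral {-x..-x + (x - t)} (\<lambda>s. f (- s)) = integral {t..x} f"
            using Henstock_Kurzweil_Integration.integral_reflect_real[of x t f] by simp
          then have "norm (integral {t..x} f - (x - t) *\<^sub>R f x) \<le> e * (x - t)"
            using d2(2)[of "x - t"] 3 t by (intro scale) auto
          then show ?thesis unfolding eq norm_minus_cancel using 3 by simp
        qed simp
      qed (use d1 d2 x in auto)
    qed (rule bounded_linear_scaleR_left)
  qed
qed

lemma negligible_vimage_translation:
  assumes "negligible (N :: real set)" shows "negligible {t. t + c \<in> N}"
proof -
  have "{t. t + c \<in> N} = (\<lambda>s. -c + s) ` N" by (force simp: image_iff)
  then show ?thesis using negligible_translation[OF assms, of "-c"] by simp
qed

lemma ode_solution_shift:
  assumes y: "ode_solution F y" and "T \<ge> 0"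
  shows "ode_solution (\<lambda>t. F (t + T)) (\<lambda>t. y (t + T))"
proof -
  obtain N where N: "negligible N"
    "\<And>t. t > 0 \<Longrightarrow> t \<notin> N \<Longrightarrow> (y has_vector_derivative F t (y t)) (at t)"
    using ode_solutionE[OF y] by blast
  show ?thesis
    unfolding ode_solution_def
  proof (intro conjI allI exI[of _ "{t. t + T \<in> N}"] impI)
    fix b
    have ac: "abs_continuous_on {0..b+T} y" using y ode_solution_def by blast
    show "abs_continuous_on {0..b} (\<lambda>t. y (t + T))"
      unfolding abs_continuous_on_def
    proof (intro allI impI)
      fix e :: real assume "e > 0"
      from abs_continuous_onD[OF ac this] obtain d where d: "d > 0"
        "\<And>(n::nat) u v. (\<And>k. k < n \<Longrightarrow> u k \<le> v k \<and> {u k..v k} \<subseteq> {0..b+T}) \<Longrightarrow>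
        disjoint_family_on (\<lambda>k. {u k<..<v k}) {..<n} \<Longrightarrow>
        (\<Sum>k<n. v k - u k) < d \<Longrightarrow> (\<Sum>k<n. norm (y (v k) - y (u k))) < e" by blast
      show "\<exists>d>0. \<forall>(n::nat) u v.
        (\<forall>k<n. u k \<le> v k \<and> {u k..v k} \<subseteq> {0..b}) \<longrightarrow>
        disjoint_family_on (\<lambda>k. {u k<..<v k}) {..<n} \<longrightarrow>
        (\<Sum>k<n. v k - u k) < d \<longrightarrow> (\<Sum>k<n. norm (y (v k + T) - y (u k + T))) < e"
      proof (intro exI[of _ d] conjI allI impI d(1))
        fix n :: nat and u v :: "nat \<Rightarrow> real"
        assume *: "\<forall>k<n. u k \<le> v k \<and> {u k..v k} \<subseteq> {0..b}"
          "disjoint_family_on (\<lambda>k. {u k<..<v k}) {..<n}" "(\<Sum>k<n. v k - u k) < d"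
        show "(\<Sum>k<n. norm (y (v k + T) - y (u k + T))) < e"
        proof (rule d(2))
          show "u k + T \<le> v k + T \<and> {u k + T..v k + T} \<subseteq> {0..b + T}" if "k < n" for k
            using *(1) that \<open>T \<ge> 0\<close> by (auto simp: atLeastatMost_subset_iff)
          show "disjoint_family_on (\<lambda>k. {u k + T<..<v k + T}) {..<n}"
            unfolding disjoint_family_on_def
          proof (intro ballI impI equals0I)
            fix i j x assume ij: "i \<in> {..<n}" "j \<in> {..<n}" "i \<noteq> j"
              and x: "x \<in> {u i + T<..<v i + T} \<inter> {u j + T<..<v j + T}"
            have "x - T \<in> {u i<..<v i} \<inter> {u j<..<v j}" using x by auto
            then show False using *(2) ij unfolding disjoint_family_on_def by blast
          qed
          show "(\<Sum>k<n. v k + T - (u k + T)) < d" using *(3) by simp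
        qed
      qed
    qed
  next
    fix t :: real assume t: "0 < t" "t \<notin> {t. t + T \<in> N}"
    then have "(y has_vector_derivative F (t + T) (y (t + T))) (at (t + T))"
      using N(2)[of "t + T"] \<open>T \<ge> 0\<close> by simp
    then have "(y \<circ> (\<lambda>t. t + T) has_vector_derivative 1 *\<^sub>R F (t + T) (y (t + T))) (at t)"
      by (intro vector_diff_chain_at) (auto intro!: derivative_eq_intros)
    then show "((\<lambda>t. y (t + T)) has_vector_derivative F (t + T) (y (t + T))) (at t)"
      by (simp add: o_def)
  qed (use N negligible_vimage_translation in auto)
qed

text \<open>The unknown of the contraction is \<open>exp (- 2 K t) * y t\<close>: with this weight the Picard
  operator contracts by the factor \<open>1/2\<close> on the whole half line.\<close>

lemma ode_solution_exists:
  fixes F :: "real \<Rightarrow> 'a \<Rightarrow> 'a::euclidean_space"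
  assumes "K > 0" and lip: "\<And>t v w. t \<ge> 0 \<Longrightarrow> norm (F t v - F t w) \<le> K * norm (v - w)"
    and F0: "\<And>t. t \<ge> 0 \<Longrightarrow> F t 0 = 0"
    and meas: "\<And>y. continuous_on UNIV y \<Longrightarrow> (\<lambda>t. F t (y t)) \<in> borel_measurable (lebesgue_on {0..})"
  obtains y where "ode_solution F y" "y 0 = y0"
proof -
  have Fbd: "norm (F t v) \<le> K * norm v" if "t \<ge> 0" for t v
    using lip[of t v 0] F0 that by simp
  have exp_int: "((\<lambda>s. K * (exp (2 * K * s) * D)) has_integral (D / 2 * (exp (2 * K * t) - 1))) {0..t}"
    if "t \<ge> 0" for t D
  proof -
    have "((\<lambda>s. K * (exp (2 * K * s) * D)) has_integral
        D / 2 * exp (2 * K * t) - D / 2 * exp (2 * K * 0)) {0..t}"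
      by (rule fundamental_theorem_of_calculus[OF that])
        (auto intro!: derivative_eq_intros simp: has_real_derivative_iff_has_vector_derivative[symmetric])
    then show ?thesis by (simp add: algebra_simps)
  qed
  have int: "(\<lambda>s. F s (y s)) absolutely_integrable_on {0..t}"
    if y: "continuous_on UNIV y" for y t
  proof (rule measurable_bounded_by_integrable_imp_absolutely_integrable[where g = "\<lambda>s. K * norm (y s)"])
    show "(\<lambda>s. F s (y s)) \<in> borel_measurable (lebesgue_on {0..t})"
      by (rule measurable_restrict_mono[OF meas[OF y]]) auto
    show "(\<lambda>s. K * norm (y s)) integrable_on {0..t}"
      by (intro integrable_continuous_real continuous_intros continuous_on_subset[OF y]) auto
  qed (use Fbd in auto)
  have cz: "continuous_on UNIV (\<lambda>s. exp (2 * K * s) *\<^sub>R apply_bcontfun z s)" for z :: "real \<Rightarrow>\<^sub>C 'a"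
    by (intro continuous_on_scaleR continuous_on_apply_bcontfun continuous_intros)
  note intz = set_lebesgue_integral_eq_integral(1)[OF int[OF cz]]
  define I where "I z t = integral {0..t} (\<lambda>s. F s (exp (2 * K * s) *\<^sub>R apply_bcontfun z s))" for z t
  have I_cont: "continuous_on UNIV (\<lambda>t. I z (max 0 t))" for z
  proof -
    have "isCont (\<lambda>t. I z (max 0 t)) x" for x
    proof -
      have "continuous_on {0..x+1} (I z)"
        unfolding I_def by (rule indefinite_integral_continuous_1) (rule intz)
      then have "continuous_on {..<x+1} (\<lambda>t. I z (max 0 t))" if "x + 1 > 0"
        using that by (intro continuous_on_compose2[where g = "I z" and f = "max 0"] continuous_intros) auto
      moreover have "continuous_on {..<0} (\<lambda>t. I z (max 0 t))"
        by (rule continuous_on_eq[of _ "\<lambda>_. I z 0"]) auto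
      ultimately show ?thesis
        by (cases "x + 1 > 0") (auto simp: continuous_on_eq_continuous_at)
    qed
    then show ?thesis by (simp add: continuous_on_eq_continuous_at)
  qed
  \<comment> \<open>The factor \<open>1/2\<close> originates here: the integral of
    \<open>K * exp (2 * K * s)\<close> from 0 to \<open>t\<close> is half of
    \<open>exp (2 * K * t) - 1\<close>.\<close>
  have I_lip: "norm (I z t - I w t) \<le> dist z w / 2 * (exp (2 * K * t) - 1)" if "t \<ge> 0" for z w t
  proof -
    have "I z t - I w t = integral {0..t} (\<lambda>s. F s (exp (2 * K * s) *\<^sub>R apply_bcontfun z s)
        - F s (exp (2 * K * s) *\<^sub>R apply_bcontfun w s))"
      unfolding I_def by (rule Henstock_Kurzweil_Integration.integral_diff[symmetric]) (rule intz)+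
    also have "norm \<dots> \<le> integral {0..t} (\<lambda>s. K * (exp (2 * K * s) * dist z w))"
    proof (rule integral_norm_bound_integral)
      fix s assume "s \<in> {0..t}"
      then have "norm (F s (exp (2 * K * s) *\<^sub>R apply_bcontfun z s) - F s (exp (2 * K * s) *\<^sub>R apply_bcontfun w s))
          \<le> K * norm (exp (2 * K * s) *\<^sub>R apply_bcontfun z s - exp (2 * K * s) *\<^sub>R apply_bcontfun w s)"
        by (intro lip) auto
      also have "\<dots> = K * (exp (2 * K * s) * dist (apply_bcontfun z s) (apply_bcontfun w s))"
        by (simp add: scaleR_diff_right[symmetric] dist_norm)
      also have "\<dots> \<le> K * (exp (2 * K * s) * dist z w)"
        using \<open>K > 0\<close> dist_bounded[of z s w] by (intro mult_left_mono) auto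
      finally show "norm (F s (exp (2 * K * s) *\<^sub>R apply_bcontfun z s)
          - F s (exp (2 * K * s) *\<^sub>R apply_bcontfun w s)) \<le> K * (exp (2 * K * s) * dist z w)" .
    qed (use exp_int[OF that] in \<open>auto intro!: Henstock_Kurzweil_Integration.integrable_diff intz\<close>)
    also have "\<dots> = dist z w / 2 * (exp (2 * K * t) - 1)"
      using exp_int[OF that, of "dist z w"] by (rule integral_unique)
    finally show ?thesis .
  qed
  have I_zero: "I 0 t = 0" if "t \<ge> 0" for t
  proof -
    have "I 0 t = integral {0..t} (\<lambda>_. 0)"
      unfolding I_def by (rule integral_cong) (use F0 in auto)
    then show ?thesis by simp
  qed
  \<comment> \<open>The elements of the Banach space are functions on the whole line;
    \<open>max 0 t\<close> continues the Picard operator to negative times by a constant.\<close>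
  define P where "P z t = exp (- 2 * K * max 0 t) *\<^sub>R (y0 + I z (max 0 t))" for z t
  have P_bcont: "P z \<in> bcontfun" for z
  proof (rule bcontfun_normI)
    show "continuous_on UNIV (P z)"
      unfolding P_def by (intro continuous_intros I_cont)
    fix t :: real
    let ?m = "max 0 t"
    have "norm (I z ?m) \<le> norm z / 2 * (exp (2 * K * ?m) - 1)"
      using I_lip[of ?m z 0] I_zero[of ?m] by simp
    also have "\<dots> \<le> norm z / 2 * exp (2 * K * ?m)" by (intro mult_left_mono) auto
    finally have "norm (y0 + I z ?m) \<le> norm y0 + norm z / 2 * exp (2 * K * ?m)"
      by (meson add_left_mono norm_triangle_le)
    then have "norm (P z t) \<le> exp (- 2 * K * ?m) * (norm y0 + norm z / 2 * exp (2 * K * ?m))"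
      unfolding P_def norm_scaleR by (simp only: abs_exp_cancel mult_left_mono exp_ge_zero)
    also have "\<dots> = exp (- 2 * K * ?m) * norm y0 + norm z / 2"
      by (simp add: distrib_left exp_minus field_simps)
    also have "\<dots> \<le> 1 * norm y0 + norm z / 2"
      using \<open>K > 0\<close> by (intro add_right_mono mult_right_mono) auto
    finally show "norm (P z t) \<le> norm y0 + norm z / 2" by simp
  qed
  have "\<exists>!z. Bcontfun (P z) = z"
  proof (rule banach_fix_type[of "1/2"], simp, simp, intro allI)
    fix z w
    show "dist (Bcontfun (P z)) (Bcontfun (P w)) \<le> 1 / 2 * dist z w"
    proof (rule dist_bound)
      fix t :: real
      let ?m = "max 0 t"
      have "dist (P z t) (P w t) = exp (- 2 * K * ?m) * norm (I z ?m - I w ?m)"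
        unfolding P_def by (simp add: dist_norm scaleR_diff_right[symmetric] del: max.absorb1 max.absorb2)
      also have "\<dots> \<le> exp (- 2 * K * ?m) * (dist z w / 2 * exp (2 * K * ?m))"
      proof (rule mult_left_mono)
        have "dist z w / 2 * (exp (2 * K * ?m) - 1) \<le> dist z w / 2 * exp (2 * K * ?m)"
          by (intro mult_left_mono) auto
        then show "norm (I z ?m - I w ?m) \<le> dist z w / 2 * exp (2 * K * ?m)"
          using I_lip[of ?m z w] by linarith
      qed simp
      also have "\<dots> = 1 / 2 * dist z w" by (simp add: exp_minus field_simps)
      finally show "dist (apply_bcontfun (Bcontfun (P z)) t) (apply_bcontfun (Bcontfun (P w)) t) \<le> 1 / 2 * dist z w"
        by (simp add: Bcontfun_inverse[OF P_bcont])
    qed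
  qed
  then obtain z where "Bcontfun (P z) = z" by blast
  then have z: "apply_bcontfun z t = P z t" for t
    using Bcontfun_inverse[OF P_bcont, of z] by metis
  define y where "y t = exp (2 * K * t) *\<^sub>R apply_bcontfun z t" for t
  have contF: "continuous_on UNIV y" unfolding y_def by (rule cz)
  have y_eq: "y t = y0 + integral {0..t} (\<lambda>s. F s (y s))" if "t \<ge> 0" for t
  proof -
    have "y t = exp (2 * K * t) *\<^sub>R exp (- 2 * K * t) *\<^sub>R (y0 + I z t)"
      using that by (simp add: y_def z P_def)
    also have "\<dots> = y0 + I z t" by (simp add: exp_add[symmetric])
    finally show ?thesis by (simp add: I_def y_def)
  qed
  \<comment> \<open>The extension by zero supplies integrability on every interval, as the
    differentiation theorem demands.\<close>
  define f where "f s = (if s \<ge> 0 then F s (y s) else 0)" for s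
  have int_pos: "f integrable_on {0..t}" for t
    by (rule integrable_eq[OF set_lebesgue_integral_eq_integral(1)[OF int[OF contF]]]) (auto simp: f_def)
  have f_int: "f integrable_on {a..b}" for a b
  proof -
    have "f integrable_on {-1 + min 0 a..0}"
      by (rule integrable_spike_finite[of "{0}" _ _ "\<lambda>_. 0"]) (auto simp: f_def)
    then have "f integrable_on {-1 + min 0 a..max 0 b}"
      by (rule Henstock_Kurzweil_Integration.integrable_combine[rotated 2]) (use int_pos in auto)
    then show ?thesis by (rule integrable_on_subinterval) auto
  qed
  obtain N where N: "negligible N"
    "\<And>a x. a < x \<Longrightarrow> x \<notin> N \<Longrightarrow> ((\<lambda>t. integral {a..t} f) has_vector_derivative f x) (at x)"
    using integral_has_vector_derivative_AE[OF f_int] by blast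
  have y_f: "y t = y0 + integral {0..t} f" if "t \<ge> 0" for t
  proof -
    have "integral {0..t} (\<lambda>s. F s (y s)) = integral {0..t} f"
      by (rule integral_cong) (auto simp: f_def)
    then show ?thesis using y_eq[OF that] by simp
  qed
  have "ode_solution F y"
    unfolding ode_solution_def
  proof (intro conjI allI exI[of _ N] impI)
    fix b
    have "bounded (y ` {0..b})"
      by (intro compact_imp_bounded compact_continuous_image continuous_on_subset[OF contF]) auto
    then obtain B where B: "\<And>t. t \<in> {0..b} \<Longrightarrow> norm (y t) \<le> B" unfolding bounded_iff by blast
    show "abs_continuous_on {0..b} y"
    proof (rule abs_continuous_on_lipschitz[where C = "K * B"])
      fix u v assume uv: "u \<in> {0..b}" "v \<in> {0..b}" "u \<le> v"
      have "integral {0..u} f + integral {u..v} f = integral {0..v} f"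
        by (rule Henstock_Kurzweil_Integration.integral_combine) (use uv f_int in auto)
      then have "y v - y u = integral {u..v} f" using y_f[of u] y_f[of v] uv by (simp add: algebra_simps)
      also have "norm \<dots> \<le> integral {u..v} (\<lambda>_. K * B)"
      proof (rule integral_norm_bound_integral)
        fix s assume s: "s \<in> {u..v}"
        then have "norm (f s) \<le> K * norm (y s)" using Fbd[of s "y s"] uv by (auto simp: f_def)
        also have "\<dots> \<le> K * B" using B[of s] s uv \<open>K > 0\<close> by (intro mult_left_mono) auto
        finally show "norm (f s) \<le> K * B" .
      qed (use f_int in auto)
      also have "\<dots> = K * B * (v - u)" using uv by simp
      finally show "norm (y v - y u) \<le> K * B * (v - u)" .
    qed
  next
    fix t :: real assume t: "0 < t" "t \<notin> N"
    have "((\<lambda>t. y0 + integral {0..t} f) has_vector_derivative f t) (at t)"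
      using N(2)[of 0 t] t by (auto intro!: derivative_eq_intros)
    then have "(y has_vector_derivative f t) (at t)"
      by (rule has_vector_derivative_transform_within_open[of _ _ _ "{0<..}"]) (use t y_f in auto)
    then show "(y has_vector_derivative F t (y t)) (at t)" using t by (simp add: f_def)
  qed (use N in auto)
  moreover have "y 0 = y0" using y_eq[of 0] by simp
  ultimately show thesis by (rule that)
qed

text \<open>\<open>H\<close> has to fit only along the image trajectory. With the identity for
  \<open>h\<close> the lemma exchanges a right-hand side for one that agrees with it along the
  solution; with multiplication by \<open>\<i>\<close> it rotates planar solutions.\<close>

lemma ode_solution_linear_image:
  assumes y: "ode_solution F y" and h: "bounded_linear h"
    and H: "\<And>t. t > 0 \<Longrightarrow> H t (h (y t)) = h (F t (y t))"
  shows "ode_solution H (\<lambda>t. h (y t))"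
proof -
  obtain N where N: "negligible N"
    "\<And>t. t > 0 \<Longrightarrow> t \<notin> N \<Longrightarrow> (y has_vector_derivative F t (y t)) (at t)"
    using ode_solutionE[OF y] by blast
  show ?thesis
    unfolding ode_solution_def
    using N ode_solution_abs_continuous[OF y] H
    by (auto intro!: abs_continuous_on_bounded_linear[OF h] bounded_linear.has_vector_derivative[OF h] exI[of _ N])
qed

section \<open>The planar system\<close>

text \<open>The value of \<open>s\<close> makes the arc of the matrix \<open>- L + N\<close> that
  starts at \<open>1\<close> arrive exactly at \<open>\<i>\<close> after time 1. The equation
  \<open>balance\<close> is \<open>L tanh L = 1\<close> expressed through \<open>s\<close>.\<close>

locale extremal_spiral =
  fixes L s :: real
  assumes L_pos: "L > 0" and s_eq: "s = exp (- L)" and balance: "L * (1 - s\<^sup>2) = 1 + s\<^sup>2"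
begin

lemma s_pos: "s > 0" and s_less_1: "s < 1" and s_exp_L: "s * exp L = 1"
  using L_pos by (auto simp: s_eq exp_minus inverse_eq_divide)

text \<open>\<open>field u\<close> is \<open>- L + u N + (1 - u) N'\<close> with \<open>N\<close> sending \<open>z\<close> to
  \<open>(Re z + s Im z) (\<i> - s) / s\<close>.\<close>

definition field :: "real \<Rightarrow> complex \<Rightarrow> complex" where
  "field u z = Complex
     (- L * Re z - u * (Re z + s * Im z) + (1 - u) * (Re z - Im z / s))
     (- L * Im z + u * (Re z / s + Im z) + (1 - u) * (s * Re z - Im z))"

text \<open>The quarter turn conjugates \<open>N\<close> into \<open>N'\<close>, and
  \<open>N'\<close> back into \<open>N\<close> because the half turn is multiplication by
  \<open>-1\<close>. So the weights of the two matrices are exchanged.\<close>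

lemma field_rotate: "field (1 - u) (\<i> * z) = \<i> * field u z"
  by (simp add: field_def complex_eq_iff algebra_simps)

lemma field_add: "field u (v + w) = field u v + field u w"
  by (simp add: field_def complex_eq_iff algebra_simps add_divide_distrib)

lemma field_diff: "field u (v - w) = field u v - field u w"
  by (simp add: field_def complex_eq_iff algebra_simps diff_divide_distrib)

lemma field_scaleR: "field u (r *\<^sub>R v) = r *\<^sub>R field u v"
  by (simp add: field_def complex_eq_iff algebra_simps)

text \<open>In the first quadrant, \<open>phase a b\<close> is the time after which the extremal trajectory issuing
  from the positive real axis has the direction of \<open>a + \<i> b\<close>, and \<open>level\<close> is the multiple
  of the trajectory starting at \<open>1\<close> that passes through this point. \<open>V\<close> and \<open>E\<close> are
  the extensions invariant under rotation by a right angle.\<close>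

definition phase :: "real \<Rightarrow> real \<Rightarrow> real" where
  "phase a b = s * b / (a + s * b)"

definition level :: "real \<Rightarrow> real \<Rightarrow> real" where
  "level a b = (a + s * b) * exp (L * phase a b)"

definition V :: "complex \<Rightarrow> real" where
  "V z = (if Re z * Im z \<ge> 0 then level \<bar>Re z\<bar> \<bar>Im z\<bar> else level \<bar>Im z\<bar> \<bar>Re z\<bar>)"

definition E :: "complex \<Rightarrow> complex" where
  "E z = cis (2 * pi * (if Re z * Im z \<ge> 0 then phase \<bar>Re z\<bar> \<bar>Im z\<bar> else phase \<bar>Im z\<bar> \<bar>Re z\<bar>))"

text \<open>The values on the axes glue the quadrants together: the branches of \<open>V\<close>
  agree there because \<open>s * exp L = 1\<close>, those of \<open>E\<close> because the phases 0
  and 1 are the same point of the circle.\<close>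

lemma phase_zero [simp]: "phase a 0 = 0" "b \<noteq> 0 \<Longrightarrow> phase 0 b = 1"
  using s_pos by (auto simp: phase_def)

lemma level_zero [simp]: "level a 0 = a" "level 0 b = b"
  using s_exp_L by (cases "b = 0"; simp add: level_def algebra_simps)+

lemma phase_bounds:
  assumes "a \<ge> 0" "b \<ge> 0" shows "0 \<le> phase a b \<and> phase a b \<le> 1"
proof -
  have "0 \<le> s * b" using assms s_pos by simp
  then show ?thesis
    unfolding phase_def using assms by (simp add: divide_le_eq_1) linarith
qed

lemma V_rotate [simp]: "V (\<i> * z) = V z"
proof -
  consider "Re z * Im z > 0" | "Re z * Im z < 0" | "Re z = 0" | "Im z = 0"
    by (metis linorder_neqE_linordered_idom mult_eq_0_iff)
  then show ?thesis
    by cases (auto simp: V_def mult.commute)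
qed

lemma E_rotate [simp]: "E (\<i> * z) = E z"
proof -
  consider "Re z * Im z > 0" | "Re z * Im z < 0" | "Re z = 0" "Im z = 0" | "Re z = 0" "Im z \<noteq> 0"
    | "Re z \<noteq> 0" "Im z = 0"
    by (metis linorder_neqE_linordered_idom mult_eq_0_iff)
  then show ?thesis
    by cases (auto simp: E_def mult.commute complex_eq_iff)
qed

lemma V_rotate_power [simp]: "V (\<i> ^ j * z) = V z" and E_rotate_power [simp]: "E (\<i> ^ j * z) = E z"
  by (induction j) (auto simp: mult.assoc)

lemma phase_scale: "r \<noteq> 0 \<Longrightarrow> phase (r * a) (r * b) = phase a b"
  by (simp add: phase_def mult.left_commute[of s] distrib_left[symmetric])

lemma sgn_scale: "r \<noteq> 0 \<Longrightarrow> 0 \<le> r * a * (r * b) \<longleftrightarrow> 0 \<le> a * (b :: real)"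
proof -
  assume "r \<noteq> 0"
  moreover have "r * a * (r * b) = r\<^sup>2 * (a * b)" by (simp add: power2_eq_square)
  ultimately show ?thesis by (simp only: zero_le_mult_iff[of "r\<^sup>2"]) auto
qed

lemma E_scale: "r \<noteq> 0 \<Longrightarrow> E (r *\<^sub>R z) = E z"
  by (simp add: E_def abs_mult phase_scale sgn_scale)

lemma norm_E [simp]: "norm (E z) = 1"
  by (simp add: E_def)

lemma level_bounds:
  assumes "a \<ge> 0" "b \<ge> 0"
  shows "s * (a + b) \<le> level a b" and "level a b \<le> (a + b) * exp L"
proof -
  have "s * (a + b) \<le> a + s * b"
    using s_less_1 assms by (simp add: distrib_left mult_left_le_one_le s_pos less_imp_le)
  also have "\<dots> \<le> (a + s * b) * exp (L * phase a b)"
  proof -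
    have "0 \<le> a + s * b" using assms s_pos by simp
    moreover have "1 \<le> exp (L * phase a b)" using L_pos phase_bounds[OF assms] by simp
    ultimately show ?thesis using mult_left_mono[of 1 "exp (L * phase a b)" "a + s * b"] by simp
  qed
  finally show "s * (a + b) \<le> level a b" by (simp add: level_def)
  have "a + s * b \<le> a + b" using s_less_1 assms by (simp add: mult_left_le_one_le s_pos less_imp_le)
  moreover have "exp (L * phase a b) \<le> exp L"
    using assms L_pos phase_bounds[of a b] by simp
  ultimately show "level a b \<le> (a + b) * exp L"
    unfolding level_def using assms by (intro mult_mono) auto
qed

text \<open>With \<open>V_le\<close> this makes \<open>V\<close> comparable to the norm; the factors
  \<open>s\<close> and \<open>2 * exp L\<close> are the source of the constants in the later bounds
  on trajectories.\<close>

lemma V_ge: "s * norm z \<le> V z"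
proof -
  have "s * norm z \<le> s * (\<bar>Re z\<bar> + \<bar>Im z\<bar>)"
    using s_pos cmod_le by (intro mult_left_mono) auto
  then show ?thesis
    using level_bounds(1)[of "\<bar>Re z\<bar>" "\<bar>Im z\<bar>"] level_bounds(1)[of "\<bar>Im z\<bar>" "\<bar>Re z\<bar>"]
    unfolding V_def by (auto simp: add.commute)
qed

lemma V_le: "V z \<le> 2 * exp L * norm z"
proof -
  have "(\<bar>Re z\<bar> + \<bar>Im z\<bar>) * exp L \<le> (norm z + norm z) * exp L"
    by (intro mult_right_mono add_mono abs_Re_le_cmod abs_Im_le_cmod) auto
  then show ?thesis
    using level_bounds(2)[of "\<bar>Re z\<bar>" "\<bar>Im z\<bar>"] level_bounds(2)[of "\<bar>Im z\<bar>" "\<bar>Re z\<bar>"]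
    unfolding V_def by (auto simp: algebra_simps)
qed

lemma V_pos: "z \<noteq> 0 \<Longrightarrow> V z > 0"
  using V_ge[of z] s_pos by (meson mult_pos_pos order_less_le_trans zero_less_norm_iff)

lemma V_nonneg: "V z \<ge> 0"
  using V_ge[of z] s_pos by (meson less_imp_le mult_nonneg_nonneg norm_ge_zero order_trans)

lemma denominator_pos: "z \<noteq> 0 \<Longrightarrow> \<bar>Re z\<bar> + s * \<bar>Im z\<bar> > 0" "z \<noteq> 0 \<Longrightarrow> \<bar>Im z\<bar> + s * \<bar>Re z\<bar> > 0"
  using s_pos by (auto simp: complex_eq_iff intro: add_pos_nonneg add_nonneg_pos)

lemma continuous_on_V: "continuous_on (- {0}) V"
proof -
  have "continuous_on (- {0}) (\<lambda>z. if - (Re z * Im z) \<le> 0 then level \<bar>Re z\<bar> \<bar>Im z\<bar> else level \<bar>Im z\<bar> \<bar>Re z\<bar>)"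
    unfolding level_def phase_def
    by (rule continuous_on_cases_le; (intro continuous_intros)?)
      (use denominator_pos in \<open>force simp: level_def[symmetric] phase_def[symmetric]\<close>)+
  then show ?thesis by (simp add: V_def[abs_def])
qed

lemma continuous_on_E: "continuous_on (- {0}) E"
proof -
  have "continuous_on (- {0}) (\<lambda>z. if - (Re z * Im z) \<le> 0 then cis (2 * pi * phase \<bar>Re z\<bar> \<bar>Im z\<bar>)
      else cis (2 * pi * phase \<bar>Im z\<bar> \<bar>Re z\<bar>))"
    unfolding phase_def
    by (rule continuous_on_cases_le; (intro continuous_intros)?)
      (use denominator_pos in \<open>force simp: complex_eq_iff phase_def[symmetric]\<close>)+
  then show ?thesis by (simp add: E_def[abs_def] if_distrib[of "\<lambda>x. cis (2 * pi * x)"] cong: if_cong)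
qed

section \<open>Trajectories inside one open quadrant\<close>

definition solution :: "real \<Rightarrow> (real \<Rightarrow> real) \<Rightarrow> (real \<Rightarrow> complex) \<Rightarrow> bool" where
  "solution c u y \<longleftrightarrow> ode_solution (\<lambda>t z. c *\<^sub>R field (u t) z) y"

lemma solution_rotate: "solution c u y \<Longrightarrow> solution c (\<lambda>t. 1 - u t) (\<lambda>t. \<i> * y t)"
  unfolding solution_def
  by (rule ode_solution_linear_image) (auto simp: field_rotate bounded_linear_mult_right)

lemma Re_field: "Re (field u z) = - L * Re z - u * (Re z + s * Im z) + (1 - u) * (Re z - Im z / s)"
  and Im_field: "Im (field u z) = - L * Im z + u * (Re z / s + Im z) + (1 - u) * (s * Re z - Im z)"
  by (simp_all add: field_def)

text \<open>In terms of the phase \<open>\<tau>\<close> and of \<open>\<phi>\<close>, the logarithm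
  of \<open>V\<close>, the weight \<open>1 - u\<close> of the wrong matrix is the only influence of
  the law: it makes \<open>\<phi>\<close> fall, and in its absence the phase runs at speed
  \<open>c\<close>. The equality case follows because the deviation of the phase from this speed is
  bounded by the loss of \<open>\<phi>\<close>.\<close>

lemma quadrant:
  assumes y: "solution c u y" and c: "c > 0"
    and u: "\<And>t. t > 0 \<Longrightarrow> 0 \<le> u t \<and> u t \<le> 1"
    and ab: "0 \<le> a" "a \<le> b"
    and Q: "\<And>t. t \<in> {a..b} \<Longrightarrow> Re (y t) > 0 \<and> Im (y t) > 0"
  shows "V (y b) \<le> V (y a)"
    and "V (y b) = V (y a) \<Longrightarrow> E (y b) = E (y a) * cis (2 * pi * (c * (b - a)))"
proof -
  obtain N where N: "negligible N"
    "\<And>t. t > 0 \<Longrightarrow> t \<notin> N \<Longrightarrow> (y has_vector_derivative c *\<^sub>R field (u t) (y t)) (at t)"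
    using ode_solutionE y unfolding solution_def by blast
  have acy: "abs_continuous_on {a..b} y"
    using y ab ode_solution_abs_continuous unfolding solution_def by blast
  \<comment> \<open>\<open>m\<close> is the linear form whose multiple of a fixed vector is
    \<open>N\<close>. It is positive in the quadrant, so the division and the logarithm below make
    sense.\<close>
  define m where "m t = Re (y t) + s * Im (y t)" for t
  define \<tau> where "\<tau> t = s * Im (y t) * inverse (m t)" for t
  define \<phi> where "\<phi> t = ln (m t) + L * \<tau> t" for t
  have m_fun: "m = (\<lambda>t. Re (y t) + s * Im (y t))"
    and \<tau>_fun: "\<tau> = (\<lambda>t. s * Im (y t) * inverse (m t))"
    and \<phi>_fun: "\<phi> = (\<lambda>t. ln (m t) + L * \<tau> t)"
    by (simp_all add: fun_eq_iff m_def \<tau>_def \<phi>_def)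
  have m_pos: "m t > 0" if "t \<in> {a..b}" for t
    using Q[OF that] s_pos by (simp add: m_def add_pos_pos)
  have \<tau>01: "0 < \<tau> t" "\<tau> t < 1" if "t \<in> {a..b}" for t
    using Q[OF that] s_pos m_pos[OF that] by (auto simp: \<tau>_def m_def field_simps)
  have ac_re: "abs_continuous_on {a..b} (\<lambda>t. Re (y t))" and ac_im: "abs_continuous_on {a..b} (\<lambda>t. Im (y t))"
    by (rule abs_continuous_on_bounded_linear[OF _ acy], simp add: bounded_linear_Re bounded_linear_Im)+
  have ac_m: "abs_continuous_on {a..b} m"
    unfolding m_def by (intro abs_continuous_on_add ac_re
        abs_continuous_on_bounded_linear[OF bounded_linear_mult_right] ac_im)
  obtain d where d: "d > 0" "\<And>t. t \<in> {a..b} \<Longrightarrow> d \<le> m t"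
  proof -
    obtain x where "x \<in> {a..b}" "\<And>t. t \<in> {a..b} \<Longrightarrow> m x \<le> m t"
      using continuous_attains_inf[of "{a..b}" m] abs_continuous_on_imp_continuous_on[OF ac_m] ab by auto
    then show ?thesis using that m_pos by blast
  qed
  have ac_\<tau>: "abs_continuous_on {a..b} \<tau>"
    unfolding \<tau>_def by (intro abs_continuous_on_bounded_bilinear[OF bounded_bilinear_mult]
        abs_continuous_on_bounded_linear[OF bounded_linear_mult_right] ac_im abs_continuous_on_inverse[OF ac_m d])
  have ac_\<phi>: "abs_continuous_on {a..b} \<phi>"
    unfolding \<phi>_def by (intro abs_continuous_on_add abs_continuous_on_ln[OF ac_m d]
        abs_continuous_on_bounded_linear[OF bounded_linear_mult_right] ac_\<tau>)
  define S where "S = 1 / s"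
  have sS: "s * S = 1" using s_pos by (simp add: S_def)
  \<comment> \<open>\<open>B x\<close> is the phase speed, for \<open>c = 1\<close>, that the other
    matrix produces at phase \<open>x\<close>. Under a mixture the phase speed is the corresponding
    average of 1 and \<open>B\<close>.\<close>
  define B where "B x = (s - (1 + s\<^sup>2) * x * S)\<^sup>2" for x
  define \<kappa> where "\<kappa> = L * (1 + s\<^sup>2)\<^sup>2 * S\<^sup>2"
  have \<kappa>_pos: "\<kappa> > 0" 
    unfolding \<kappa>_def S_def using L_pos s_pos
    by (intro mult_pos_pos zero_less_power) (auto intro: add_pos_nonneg)
  have der: "(\<tau> has_real_derivative c * (1 - (1 - u t) * (1 - B (\<tau> t)))) (at t)"
      "(\<phi> has_real_derivative - c * (1 - u t) * \<kappa> * \<tau> t * (1 - \<tau> t)) (at t)"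
    if t: "a < t" "t < b" "t \<notin> N" for t
  proof -
    let ?q = "Re (y t)" and ?p = "Im (y t)" and ?v = "1 - u t"
    define M where "M = - L + ?v * (1 + s\<^sup>2) * (1 - \<tau> t - \<tau> t * S\<^sup>2)"
    have mt: "m t > 0" using m_pos t by auto
    have p: "?p = m t * (\<tau> t * S)" and q: "?q = m t * (1 - \<tau> t)"
      using mt s_pos by (simp_all add: \<tau>_def S_def m_def field_simps)
    have dy: "(y has_vector_derivative c *\<^sub>R field (u t) (y t)) (at t)" using N(2) t ab by auto
    from bounded_linear.has_vector_derivative[OF bounded_linear_Re dy]
    have "((\<lambda>t. Re (y t)) has_real_derivative c * Re (field (u t) (y t))) (at t)"
      by (simp add: has_real_derivative_iff_has_vector_derivative)
    moreover have "Re (field (u t) (y t)) = m t * (- L * (1 - \<tau> t) - u t + ?v * ((1 - \<tau> t) - \<tau> t * S * S))"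
    proof -
      have "?q + s * ?p = m t" by (simp add: m_def)
      then have "Re (field (u t) (y t)) = - L * ?q - u t * m t + ?v * (?q - ?p * S)"
        by (simp add: Re_field S_def)
      then show ?thesis by (simp add: p q algebra_simps)
    qed
    ultimately have dq: "((\<lambda>t. Re (y t)) has_real_derivative
        c * (m t * (- L * (1 - \<tau> t) - u t + ?v * ((1 - \<tau> t) - \<tau> t * S * S)))) (at t)" by simp
    from bounded_linear.has_vector_derivative[OF bounded_linear_Im dy]
    have "((\<lambda>t. Im (y t)) has_real_derivative c * Im (field (u t) (y t))) (at t)"
      by (simp add: has_real_derivative_iff_has_vector_derivative)
    moreover have "Im (field (u t) (y t)) = m t * (- L * \<tau> t * S + u t * S + ?v * (s * (1 - \<tau> t) - \<tau> t * S))"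
    proof -
      have "Im (field (u t) (y t)) = - L * ?p + u t * (?q * S + ?p) + ?v * (s * ?q - ?p)"
        by (simp add: Im_field S_def)
      then show ?thesis by (simp add: p q algebra_simps)
    qed
    ultimately have dp: "((\<lambda>t. Im (y t)) has_real_derivative
        c * (m t * (- L * \<tau> t * S + u t * S + ?v * (s * (1 - \<tau> t) - \<tau> t * S)))) (at t)" by simp
    have "(m has_real_derivative
        c * (m t * (- L * (1 - \<tau> t) - u t + ?v * ((1 - \<tau> t) - \<tau> t * S * S)))
        + s * (c * (m t * (- L * \<tau> t * S + u t * S + ?v * (s * (1 - \<tau> t) - \<tau> t * S))))) (at t)"
      using DERIV_add[OF dq DERIV_cmult[OF dp, of s]] unfolding m_fun .
    moreover have "c * (m t * (- L * (1 - \<tau> t) - u t + ?v * ((1 - \<tau> t) - \<tau> t * S * S)))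
        + s * (c * (m t * (- L * \<tau> t * S + u t * S + ?v * (s * (1 - \<tau> t) - \<tau> t * S)))) = c * m t * M"
      unfolding M_def using sS by algebra
    ultimately have dm: "(m has_real_derivative c * m t * M) (at t)" by simp
    have "(\<tau> has_real_derivative
        s * (c * (m t * (- L * \<tau> t * S + u t * S + ?v * (s * (1 - \<tau> t) - \<tau> t * S)))) * inverse (m t)
        + - (inverse (m t) * (c * m t * M) * inverse (m t)) * (s * ?p)) (at t)"
      using DERIV_mult[OF DERIV_cmult[OF dp, of s] DERIV_inverse'[OF dm]] mt
      unfolding \<tau>_fun by simp
    moreover have "s * (c * (m t * (- L * \<tau> t * S + u t * S + ?v * (s * (1 - \<tau> t) - \<tau> t * S)))) * inverse (m t)
        + - (inverse (m t) * (c * m t * M) * inverse (m t)) * (s * ?p) = c * (1 - ?v * (1 - B (\<tau> t)))"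
    proof -
      have "m t * inverse (m t) = 1" using mt by simp
      then show ?thesis
        unfolding M_def B_def p using sS by algebra
    qed
    ultimately show d\<tau>: "(\<tau> has_real_derivative c * (1 - ?v * (1 - B (\<tau> t)))) (at t)" by simp
    have "(\<phi> has_real_derivative inverse (m t) * (c * m t * M) + L * (c * (1 - ?v * (1 - B (\<tau> t))))) (at t)"
      using DERIV_add[OF DERIV_chain2[OF DERIV_ln[OF mt] dm] DERIV_cmult[OF d\<tau>, of L]]
      unfolding \<phi>_fun .
    \<comment> \<open>Up to the factor \<open>c * ?v\<close> the left side is a quadratic polynomial
      in the phase with leading coefficient \<open>\<kappa>\<close>. \<open>balance\<close> is
      precisely the condition that it vanishes at the phases 0 and 1, that is, on both axes.\<close>
    moreover have "inverse (m t) * (c * m t * M) + L * (c * (1 - ?v * (1 - B (\<tau> t))))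
        = - c * ?v * \<kappa> * \<tau> t * (1 - \<tau> t)"
    proof -
      have "m t * inverse (m t) = 1" using mt by simp
      then show ?thesis
        unfolding M_def B_def \<kappa>_def using sS balance by algebra
    qed
    ultimately show "(\<phi> has_real_derivative - c * ?v * \<kappa> * \<tau> t * (1 - \<tau> t)) (at t)" by simp
  qed
  have level_eq: "level (Re (y t)) (Im (y t)) = exp (\<phi> t)"
    and phase_eq: "phase (Re (y t)) (Im (y t)) = \<tau> t" if "t \<in> {a..b}" for t
  proof -
    show *: "phase (Re (y t)) (Im (y t)) = \<tau> t"
      by (simp add: phase_def \<tau>_def m_def divide_inverse)
    show "level (Re (y t)) (Im (y t)) = exp (\<phi> t)"
      using m_pos[OF that] unfolding level_def * \<phi>_def exp_add by (simp add: m_def)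
  qed
  have V_exp: "V (y t) = exp (\<phi> t)" and E_cis: "E (y t) = cis (2 * pi * \<tau> t)" if "t \<in> {a..b}" for t
    using Q[OF that] level_eq[OF that] phase_eq[OF that] by (simp_all add: V_def E_def)
  have "\<phi> b \<le> \<phi> a"
  proof (rule abs_continuous_on_nonincreasing[OF ab(2) ac_\<phi> N(1)])
    fix t assume t: "a < t" "t < b" "t \<notin> N"
    have "- c * (1 - u t) * \<kappa> * \<tau> t * (1 - \<tau> t) \<le> 0"
      using \<tau>01[of t] u[of t] c \<kappa>_pos t ab by (simp add: mult_nonneg_nonneg)
    then show "\<exists>D\<le>0. (\<phi> has_real_derivative D) (at t)" using der(2)[OF t] by blast
  qed
  then show "V (y b) \<le> V (y a)" using V_exp ab by simp
  assume "V (y b) = V (y a)"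
  then have \<phi>_eq: "\<phi> b = \<phi> a" using V_exp ab by simp
  \<comment> \<open>The path stays in the open quadrant during a compact time interval, so the
    degenerate factor of the decay rate is bounded below along it.\<close>
  obtain \<eta> where \<eta>: "\<eta> > 0" "\<And>t. t \<in> {a..b} \<Longrightarrow> \<eta> \<le> \<tau> t * (1 - \<tau> t)"
  proof -
    have "continuous_on {a..b} (\<lambda>t. \<tau> t * (1 - \<tau> t))"
      by (intro continuous_intros abs_continuous_on_imp_continuous_on[OF ac_\<tau>])
    then obtain x where "x \<in> {a..b}" "\<And>t. t \<in> {a..b} \<Longrightarrow> \<tau> x * (1 - \<tau> x) \<le> \<tau> t * (1 - \<tau> t)"
      using continuous_attains_inf[of "{a..b}" "\<lambda>t. \<tau> t * (1 - \<tau> t)"] ab by auto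
    then show ?thesis using that[of "\<tau> x * (1 - \<tau> x)"] \<tau>01[of x] by simp
  qed
  define C where "C = 1 + (s + (1 + s\<^sup>2) * S)\<^sup>2"
  have C_bd: "\<bar>1 - B x\<bar> \<le> C" if "0 < x" "x < 1" for x
  proof -
    have "\<bar>s - (1 + s\<^sup>2) * x * S\<bar> \<le> \<bar>s\<bar> + (1 + s\<^sup>2) * x * S"
      using that s_pos by (intro order_trans[OF abs_triangle_ineq4]) (simp add: S_def add_pos_nonneg abs_mult)
    also have "\<dots> \<le> s + (1 + s\<^sup>2) * S"
      using that s_pos by (auto simp: S_def intro!: mult_right_mono mult_left_le divide_right_mono)
    finally have "B x \<le> (s + (1 + s\<^sup>2) * S)\<^sup>2"
      unfolding B_def by (metis abs_ge_zero power2_abs power_mono)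
    moreover have "B x \<ge> 0" by (simp add: B_def)
    ultimately show ?thesis unfolding C_def by auto
  qed
  \<comment> \<open>The phase drifts from speed \<open>c\<close> at a rate of at most
    \<open>c * (1 - u) * C\<close>, while \<open>\<phi>\<close> falls at a rate of at least
    \<open>c * (1 - u) * \<kappa> * \<eta>\<close>. The multiple
    \<open>C / (\<kappa> * \<eta>)\<close> of \<open>\<phi>\<close> therefore absorbs a drift in
    either direction \<open>r\<close>, and without loss of \<open>\<phi>\<close> there is no
    drift.\<close>
  have step: "r * (\<tau> b - c * b) + C / (\<kappa> * \<eta>) * \<phi> b \<le> r * (\<tau> a - c * a) + C / (\<kappa> * \<eta>) * \<phi> a"
    if r: "r = 1 \<or> r = -1" for r
  proof (rule abs_continuous_on_nonincreasing[OF ab(2) _ N(1)])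
    have "abs_continuous_on {a..b} (\<lambda>t. \<tau> t + (- c) * t)"
      by (intro abs_continuous_on_add ac_\<tau> abs_continuous_on_bounded_linear[OF bounded_linear_mult_right]
          abs_continuous_on_ident)
    then show "abs_continuous_on {a..b} (\<lambda>t. r * (\<tau> t - c * t) + C / (\<kappa> * \<eta>) * \<phi> t)"
      by (intro abs_continuous_on_add abs_continuous_on_bounded_linear[OF bounded_linear_mult_right] ac_\<phi>) simp
    fix t assume t: "a < t" "t < b" "t \<notin> N"
    let ?v = "1 - u t"
    have v: "?v \<ge> 0" using u[of t] t ab by auto
    have "((\<lambda>t. r * (\<tau> t - c * t) + C / (\<kappa> * \<eta>) * \<phi> t) has_real_derivative
      r * (c * (1 - ?v * (1 - B (\<tau> t))) - c) + C / (\<kappa> * \<eta>) * (- c * ?v * \<kappa> * \<tau> t * (1 - \<tau> t))) (at t)"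
      by (intro DERIV_add DERIV_cmult DERIV_diff der t DERIV_cmult_Id)
    moreover have "r * (c * (1 - ?v * (1 - B (\<tau> t))) - c) + C / (\<kappa> * \<eta>) * (- c * ?v * \<kappa> * \<tau> t * (1 - \<tau> t)) \<le> 0"
    proof -
      have "C * 1 \<le> C * (\<tau> t * (1 - \<tau> t) / \<eta>)"
        using \<eta> t by (intro mult_left_mono) (auto simp: C_def add_nonneg_nonneg)
      moreover have "- r * (1 - B (\<tau> t)) \<le> C" using C_bd[of "\<tau> t"] \<tau>01[of t] t r by auto
      ultimately have "- r * (1 - B (\<tau> t)) - C * (\<tau> t * (1 - \<tau> t) / \<eta>) \<le> 0" by linarith
      then have "c * ?v * (- r * (1 - B (\<tau> t)) - C * (\<tau> t * (1 - \<tau> t) / \<eta>)) \<le> 0"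
        using c v by (intro mult_nonneg_nonpos) auto
      also have "c * ?v * (- r * (1 - B (\<tau> t)) - C * (\<tau> t * (1 - \<tau> t) / \<eta>))
        = r * (c * (1 - ?v * (1 - B (\<tau> t))) - c) + C / (\<kappa> * \<eta>) * (- c * ?v * \<kappa> * \<tau> t * (1 - \<tau> t))"
        using \<kappa>_pos \<eta>(1) by (simp add: field_simps)
      finally show ?thesis .
    qed
    ultimately show "\<exists>D\<le>0. ((\<lambda>t. r * (\<tau> t - c * t) + C / (\<kappa> * \<eta>) * \<phi> t) has_real_derivative D) (at t)"
      by blast
  qed
  have "\<tau> b = \<tau> a + c * (b - a)"
    using step[of 1] step[of "-1"] \<phi>_eq by (simp add: algebra_simps)
  then show "E (y b) = E (y a) * cis (2 * pi * (c * (b - a)))"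
    using E_cis ab by (simp add: cis_mult distrib_left)
qed

section \<open>Growth bounds and existence for planar laws\<close>

definition law :: "(real \<Rightarrow> real) \<Rightarrow> bool" where
  "law u \<longleftrightarrow> (\<forall>t\<ge>0. 0 \<le> u t \<and> u t \<le> 1)"

lemma lawD: "law u \<Longrightarrow> t \<ge> 0 \<Longrightarrow> 0 \<le> u t \<and> u t \<le> 1"
  by (simp add: law_def)

text \<open>The bracket bounds the field by a multiple of
  \<open>\<bar>Re z\<bar> + \<bar>Im z\<bar>\<close>; the factor 2 passes to the norm.\<close>

definition K where "K = 2 * (L + 2 + s + 1 / s)"

lemma K_pos: "K > 0"
  using L_pos s_pos by (auto simp: K_def intro!: add_pos_pos mult_pos_pos)

lemma norm_field_le:
  assumes "0 \<le> u" "u \<le> 1" shows "norm (field u z) \<le> K * norm z"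
proof -
  let ?q = "\<bar>Re z\<bar>" and ?p = "\<bar>Im z\<bar>"
  have 1: "\<bar>w * x\<bar> \<le> \<bar>x\<bar>" if "0 \<le> w" "w \<le> 1" for w x :: real
    using that by (simp add: abs_mult mult_left_le_one_le)
  have abs3: "\<bar>- x + y + w\<bar> \<le> \<bar>x\<bar> + \<bar>y\<bar> + \<bar>w\<bar>" "\<bar>- x - y + w\<bar> \<le> \<bar>x\<bar> + \<bar>y\<bar> + \<bar>w\<bar>" for x y w :: real
    by arith+
  have "\<bar>Re (field u z)\<bar> \<le> \<bar>L * Re z\<bar> + \<bar>u * (Re z + s * Im z)\<bar> + \<bar>(1 - u) * (Re z - Im z / s)\<bar>"
    unfolding Re_field mult_minus_left by (rule abs3)
  also have "\<dots> \<le> L * ?q + (?q + s * ?p) + (?q + ?p / s)"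
  proof (intro add_mono)
    show "\<bar>u * (Re z + s * Im z)\<bar> \<le> ?q + s * ?p"
      using 1[of u "Re z + s * Im z"] abs_triangle_ineq[of "Re z" "s * Im z"] assms s_pos
      by (simp add: abs_mult)
    show "\<bar>(1 - u) * (Re z - Im z / s)\<bar> \<le> ?q + ?p / s"
      using 1[of "1 - u" "Re z - Im z / s"] abs_triangle_ineq4[of "Re z" "Im z / s"] assms s_pos
      by (simp add: abs_mult)
  qed (use L_pos in \<open>simp add: abs_mult\<close>)
  finally have re: "\<bar>Re (field u z)\<bar> \<le> L * ?q + (?q + s * ?p) + (?q + ?p / s)" .
  have "\<bar>Im (field u z)\<bar> \<le> \<bar>L * Im z\<bar> + \<bar>u * (Re z / s + Im z)\<bar> + \<bar>(1 - u) * (s * Re z - Im z)\<bar>"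
    unfolding Im_field mult_minus_left by (rule abs3)
  also have "\<dots> \<le> L * ?p + (?q / s + ?p) + (s * ?q + ?p)"
  proof (intro add_mono)
    show "\<bar>u * (Re z / s + Im z)\<bar> \<le> ?q / s + ?p"
      using 1[of u "Re z / s + Im z"] abs_triangle_ineq[of "Re z / s" "Im z"] assms s_pos
      by (simp add: abs_mult)
    show "\<bar>(1 - u) * (s * Re z - Im z)\<bar> \<le> s * ?q + ?p"
      using 1[of "1 - u" "s * Re z - Im z"] abs_triangle_ineq4[of "s * Re z" "Im z"] assms s_pos
      by (simp add: abs_mult)
  qed (use L_pos in \<open>simp add: abs_mult\<close>)
  finally have im: "\<bar>Im (field u z)\<bar> \<le> L * ?p + (?q / s + ?p) + (s * ?q + ?p)" .
  have "norm (field u z) \<le> (L + 2 + s + 1 / s) * (?q + ?p)"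
    using order_trans[OF cmod_le add_mono[OF re im]] by (simp add: algebra_simps add_divide_distrib)
  also have "\<dots> \<le> (L + 2 + s + 1 / s) * (norm z + norm z)"
    using L_pos s_pos by (intro mult_left_mono add_mono abs_Re_le_cmod abs_Im_le_cmod) auto
  also have "\<dots> = K * norm z"
    unfolding K_def by (simp only: mult_2 distrib_left distrib_right ac_simps)
  finally show ?thesis .
qed

lemma solution_exists:
  assumes u: "law u" "u \<in> borel_measurable (lebesgue_on {0..})" and "c > 0"
  obtains y where "solution c u y" "y 0 = y0"
proof -
  have "norm (c *\<^sub>R field (u t) v - c *\<^sub>R field (u t) w) \<le> c * K * norm (v - w)" if "t \<ge> 0" for t v w
    using norm_field_le[of "u t" "v - w"] lawD[OF u(1) that] \<open>c > 0\<close>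
    by (simp add: scaleR_diff_right[symmetric] field_diff[symmetric])
  note lip = this
  have meas: "(\<lambda>t. c *\<^sub>R field (u t) (y t)) \<in> borel_measurable (lebesgue_on {0..})"
    if "continuous_on UNIV y" for y
  proof -
    have [measurable]: "y \<in> borel_measurable (lebesgue_on {0..})"
      by (rule continuous_imp_measurable_on_sets_lebesgue) (use that continuous_on_subset in auto)
    note u(2)[measurable]
    show ?thesis
      unfolding borel_measurable_complex_iff by (simp add: Re_field Im_field)
  qed
  have zero: "c *\<^sub>R field w 0 = 0" for w by (simp add: field_def complex_eq_iff)
  have "c * K > 0" using K_pos \<open>c > 0\<close> by simp
  from ode_solution_exists[OF this lip zero meas, of y0]
  show ?thesis using that unfolding solution_def by blast
qed

lemma solution_unique:
  assumes "law u" "c > 0" "solution c u y" "solution c u z" "y 0 = z 0" "t \<ge> 0"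
  shows "y t = z t"
proof (rule ode_solution_unique[OF assms(3,4)[unfolded solution_def] assms(5)])
  fix t :: real and v w assume "t > 0"
  then show "norm (c *\<^sub>R field (u t) v - c *\<^sub>R field (u t) w) \<le> c * K * norm (v - w)"
    using norm_field_le[of "u t" "v - w"] lawD[OF assms(1), of t] \<open>c > 0\<close>
    by (simp add: scaleR_diff_right[symmetric] field_diff[symmetric])
qed fact

lemma solution_norm_le:
  assumes "law u" "c > 0" "solution c u y" "0 \<le> a" "a \<le> b"
  shows "norm (y b) \<le> exp (c * K * (b - a)) * norm (y a)"
    and "norm (y a) \<le> exp (c * K * (b - a)) * norm (y b)"
proof -
  have "norm (c *\<^sub>R field (u t) (y t)) \<le> c * K * norm (y t)" if "t > 0" for t
    using norm_field_le[of "u t" "y t"] lawD[OF assms(1), of t] \<open>c > 0\<close> that by simp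
  from ode_solution_norm_le[OF assms(3)[unfolded solution_def] this assms(4,5)]
  show "norm (y b) \<le> exp (c * K * (b - a)) * norm (y a)"
    "norm (y a) \<le> exp (c * K * (b - a)) * norm (y b)" by auto
qed

lemma solution_combination:
  assumes "solution c u y" "solution c u z"
  shows "solution c u (\<lambda>t. p *\<^sub>R y t + q *\<^sub>R z t)"
  using assms unfolding solution_def
  by (rule ode_solution_add_scaled) (simp add: field_add field_scaleR scaleR_add_right mult.commute)

text \<open>The rotated trajectory obeys \<open>u\<close> or \<open>1 - u\<close>, according to the
  parity of \<open>j\<close>. This reduces every quadrant to the first one.\<close>

lemma solution_rotate_power:
  assumes "law u" "solution c u y"
  obtains u' where "law u'" "solution c u' (\<lambda>t. \<i> ^ j * y t)"
proof -
  have "\<exists>u'. law u' \<and> solution c u' (\<lambda>t. \<i> ^ j * y t)"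
  proof (induction j)
    case (Suc j)
    then obtain u' where "law u'" "solution c u' (\<lambda>t. \<i> ^ j * y t)" by blast
    then have "law (\<lambda>t. 1 - u' t)" "solution c (\<lambda>t. 1 - u' t) (\<lambda>t. \<i> ^ Suc j * y t)"
      using solution_rotate by (auto simp: law_def mult.assoc)
    then show ?case by blast
  qed (use assms in auto)
  then show ?thesis using that by blast
qed

section \<open>Crossing the axes\<close>

definition Q1 :: "complex \<Rightarrow> bool" where "Q1 z \<longleftrightarrow> Re z > 0 \<and> Im z > 0"

lemma rotated_quadrant:
  assumes y: "solution c u y" and c: "c > 0" and u: "law u" and ab: "0 \<le> a" "a \<le> b"
    and Q: "\<And>t. t \<in> {a..b} \<Longrightarrow> Q1 (\<i> ^ j * y t)"
  shows "V (y b) \<le> V (y a)"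
    and "V (y b) = V (y a) \<Longrightarrow> E (y b) = E (y a) * cis (2 * pi * (c * (b - a)))"
proof -
  obtain u' where "law u'" "solution c u' (\<lambda>t. \<i> ^ j * y t)"
    using solution_rotate_power[OF u y] by blast
  note u' = this
  have "0 \<le> u' t \<and> u' t \<le> 1" if "t > 0" for t
    using lawD[OF u'(1)] that by simp
  from quadrant[OF u'(2) c this ab] Q
  show "V (y b) \<le> V (y a)"
    and "V (y b) = V (y a) \<Longrightarrow> E (y b) = E (y a) * cis (2 * pi * (c * (b - a)))"
    by (simp_all add: Q1_def)
qed

lemma rotate_to_quadrant:
  assumes "z \<noteq> 0" obtains j where "Re (\<i> ^ j * z) > 0" "Im (\<i> ^ j * z) \<ge> 0"
proof -
  consider "Re z > 0" "Im z \<ge> 0" | "Im z < 0" "Re z \<ge> 0" | "Re z < 0" "Im z \<le> 0" | "Im z > 0" "Re z \<le> 0"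
    using assms by (fastforce simp: complex_eq_iff)
  then show ?thesis
  proof cases
    case 1 then show ?thesis using that[of 0] by simp
  next
    case 2 then show ?thesis using that[of 1] by simp
  next
    case 3 then show ?thesis using that[of 2] by (simp add: power2_eq_square)
  next
    case 4 then show ?thesis using that[of 3] by (simp add: power3_eq_cube)
  qed
qed

text \<open>On the positive real axis the imaginary part increases at a definite rate for every law, so
  trajectories cross the axes transversally.\<close>

lemma eventually_quadrant:
  assumes y: "solution c u y" and c: "c > 0" and u: "law u" and x: "x \<ge> 0" "y x \<noteq> 0"
  obtains d j k where "d > 0" "\<And>t. x < t \<Longrightarrow> t < x + d \<Longrightarrow> Q1 (\<i> ^ j * y t)"
    "\<And>t. 0 \<le> t \<Longrightarrow> x - d < t \<Longrightarrow> t < x \<Longrightarrow> Q1 (\<i> ^ k * y t)"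
proof -
  obtain j where j: "Re (\<i> ^ j * y x) > 0" "Im (\<i> ^ j * y x) \<ge> 0"
    using rotate_to_quadrant[OF x(2)] by blast
  define z where "z t = \<i> ^ j * y t" for t
  obtain u' where u': "law u'" and z: "solution c u' z"
    using solution_rotate_power[OF u y] unfolding z_def by blast
  have contz: "continuous_on {0..} z"
    using z ode_solution_continuous_on unfolding solution_def by blast
  have near: "\<exists>d>0. \<forall>t\<ge>0. \<bar>t - x\<bar> < d \<longrightarrow> P (z t)" if "open (Collect P)" "P (z x)" for P
  proof -
    have "\<exists>e>0. \<forall>w. dist w (z x) < e \<longrightarrow> P w"
      using that unfolding open_dist by simp
    then obtain e where e: "e > 0" "\<And>w. dist w (z x) < e \<Longrightarrow> P w" by blast
    obtain d where "d > 0" "\<forall>t\<in>{0..}. dist t x < d \<longrightarrow> dist (z t) (z x) < e"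
      using contz x e(1) unfolding continuous_on_iff by force
    then show ?thesis using e(2) by (intro exI[of _ d]) (simp add: dist_real_def)
  qed
  show thesis
  proof (cases "Im (z x) > 0")
    case True
    have "open {w. Re w > 0 \<and> Im w > 0}"
      by (intro open_Collect_conj open_Collect_less continuous_intros)
    from near[OF this] True j obtain d where "d > 0" "\<And>t. t \<ge> 0 \<Longrightarrow> \<bar>t - x\<bar> < d \<Longrightarrow> Q1 (z t)"
      unfolding Q1_def z_def by blast
    then show thesis
      using that[of d j j] x unfolding z_def by auto
  next
    case False
    then have im0: "Im (z x) = 0" using j unfolding z_def by simp
    define r where "r = Re (z x)"
    have r: "r > 0" using j by (simp add: r_def z_def)
    \<comment> \<open>The vertical speed is at least
      \<open>s * Re z - (L + 1) * \<bar>Im z\<bar>\<close> for every law. In this neighbourhood the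
      first term exceeds \<open>s * r / 2\<close> and the second costs less than half of that, so at
      least \<open>s * r / 4\<close> remains.\<close>
    have "open {w. Re w > r / 2 \<and> (L + 1) * \<bar>Im w\<bar> < s * r / 4}"
      by (intro open_Collect_conj open_Collect_less continuous_intros)
    from near[OF this] im0 r s_pos obtain d where d: "d > 0"
      "\<And>t. t \<ge> 0 \<Longrightarrow> \<bar>t - x\<bar> < d \<Longrightarrow> Re (z t) > r / 2 \<and> (L + 1) * \<bar>Im (z t)\<bar> < s * r / 4"
      unfolding r_def by (auto simp del: abs_less_iff)
    obtain N where N: "negligible N"
      "\<And>t. t > 0 \<Longrightarrow> t \<notin> N \<Longrightarrow> (z has_vector_derivative c *\<^sub>R field (u' t) (z t)) (at t)"
      using ode_solutionE z unfolding solution_def by blast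
    define k where "k = c * (s * r / 4)"
    have k: "k > 0" using c s_pos r by (simp add: k_def)
    have grow: "Im (z w) + k * (v - w) \<le> Im (z v)" if "0 \<le> w" "x - d < w" "w \<le> v" "v < x + d" for v w
    proof -
      have "k * v + (-1) * Im (z v) \<le> k * w + (-1) * Im (z w)"
      proof (rule abs_continuous_on_nonincreasing[OF \<open>w \<le> v\<close> _ N(1)])
        have "abs_continuous_on {w..v} z"
          using ode_solution_abs_continuous z \<open>0 \<le> w\<close> unfolding solution_def by blast
        then show "abs_continuous_on {w..v} (\<lambda>t. k * t + (-1) * Im (z t))"
          by (intro abs_continuous_on_add abs_continuous_on_bounded_linear[OF bounded_linear_mult_right]
              abs_continuous_on_bounded_linear[OF bounded_linear_Im] abs_continuous_on_ident)
        fix t assume t: "w < t" "t < v" "t \<notin> N"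
        let ?q = "Re (z t)" and ?p = "Im (z t)" and ?u = "u' t"
        have near_t: "?q > r / 2" "(L + 1) * \<bar>?p\<bar> < s * r / 4" using d(2)[of t] t that by auto
        have ut: "0 \<le> ?u" "?u \<le> 1" using lawD[OF u', of t] t that by auto
        have "?u * (s * ?q) \<le> ?u * (?q / s)"
        proof (rule mult_left_mono)
          have "s * ?q \<le> 1 * ?q" using near_t r s_less_1 by (intro mult_right_mono) auto
          also have "\<dots> \<le> ?q / s" using near_t r s_less_1 s_pos by (simp add: pos_le_divide_eq mult_left_le)
          finally show "s * ?q \<le> ?q / s" .
        qed (use ut in auto)
        moreover have "L * ?p \<le> L * \<bar>?p\<bar>" using L_pos by (intro mult_left_mono) auto
        moreover have "\<bar>(2 * ?u - 1) * ?p\<bar> \<le> \<bar>?p\<bar>"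
          using ut by (simp add: abs_mult mult_left_le_one_le)
        moreover have "s * (r / 2) \<le> s * ?q" using near_t s_pos by (intro mult_left_mono) auto
        moreover have "Im (field ?u (z t)) = ?u * (?q / s) - ?u * (s * ?q) + s * ?q - L * ?p + (2 * ?u - 1) * ?p"
          by (simp add: Im_field algebra_simps)
        ultimately have "Im (field ?u (z t)) \<ge> s * r / 4"
          using near_t(2) by (simp add: algebra_simps)
        then have "k \<le> c * Im (field ?u (z t))" unfolding k_def using c by (intro mult_left_mono) auto
        moreover have "((\<lambda>t. Im (z t)) has_real_derivative c * Im (field ?u (z t))) (at t)"
          using bounded_linear.has_vector_derivative[OF bounded_linear_Im N(2)[of t]] t that
          by (simp add: has_real_derivative_iff_has_vector_derivative)
        then have "((\<lambda>t. k * t + (-1) * Im (z t)) has_real_derivative k + (-1) * (c * Im (field ?u (z t)))) (at t)"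
          by (intro DERIV_add DERIV_cmult DERIV_cmult_Id)
        ultimately show "\<exists>D\<le>0. ((\<lambda>t. k * t + (-1) * Im (z t)) has_real_derivative D) (at t)"
          by (intro exI conjI) auto
      qed
      then show ?thesis by (simp add: algebra_simps)
    qed
    show thesis
    \<comment> \<open>Before time \<open>x\<close> the trajectory is below the axis, in the fourth
      quadrant, and needs one more quarter turn.\<close>
    proof (rule that[of d j "Suc j"])
      fix t assume t: "x < t" "t < x + d"
      have "0 < k * (t - x)" using k t by simp
      then have "Im (z t) > 0" using grow[of x t] x t d im0 by simp
      then show "Q1 (\<i> ^ j * y t)" using d(2)[of t] t x r unfolding Q1_def z_def[symmetric] by simp
    next
      fix t assume t: "0 \<le> t" "x - d < t" "t < x"
      have "0 < k * (x - t)" using k t by simp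
      then have "Im (z t) < 0" using grow[of t x] x t d im0 by simp
      moreover have "Re (z t) > 0" using d(2)[of t] t r by simp
      ultimately have "Q1 (\<i> * z t)" by (simp add: Q1_def)
      then show "Q1 (\<i> ^ Suc j * y t)" by (simp add: z_def mult.assoc)
    qed (use d in auto)
  qed
qed

definition step :: "real \<Rightarrow> (real \<Rightarrow> complex) \<Rightarrow> real \<Rightarrow> real \<Rightarrow> bool" where
  "step c y a b \<longleftrightarrow> V (y b) \<le> V (y a) \<and>
    (V (y b) = V (y a) \<longrightarrow> E (y b) = E (y a) * cis (2 * pi * (c * (b - a))))"

lemma step_refl: "step c y a a"
  by (simp add: step_def)

text \<open>Equality of \<open>V\<close> at \<open>p\<close> and \<open>r\<close> forces equality at
  \<open>q\<close>, since neither part increases \<open>V\<close>; the two phase factors then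
  multiply.\<close>

lemma step_trans:
  assumes "step c y p q" "step c y q r" shows "step c y p r"
proof -
  have "cis (2 * pi * (c * (q - p))) * cis (2 * pi * (c * (r - q))) = cis (2 * pi * (c * (r - p)))"
    by (simp add: cis_mult algebra_simps)
  then show ?thesis using assms unfolding step_def by (auto simp: mult.assoc)
qed

text \<open>On either side of \<open>x\<close> the trajectory lies in a single open quadrant. The
  point \<open>y x\<close> may lie on an axis and is reached by letting one endpoint tend to
  \<open>x\<close>, where \<open>V\<close> and \<open>E\<close> are continuous.\<close>

lemma local_step:
  assumes y: "solution c u y" and c: "c > 0" and u: "law u" and x: "x \<ge> 0" "y x \<noteq> 0"
  obtains d where "d > 0" "\<And>t. x \<le> t \<Longrightarrow> t < x + d \<Longrightarrow> step c y x t"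
    "\<And>t. 0 \<le> t \<Longrightarrow> x - d < t \<Longrightarrow> t \<le> x \<Longrightarrow> step c y t x"
proof -
  obtain d j k where d: "d > 0" and right: "\<And>t. x < t \<Longrightarrow> t < x + d \<Longrightarrow> Q1 (\<i> ^ j * y t)"
    and left: "\<And>t. 0 \<le> t \<Longrightarrow> x - d < t \<Longrightarrow> t < x \<Longrightarrow> Q1 (\<i> ^ k * y t)"
    using eventually_quadrant[OF y c u x] by blast
  have conty: "continuous_on {0..} y"
    using y ode_solution_continuous_on unfolding solution_def by blast
  have VE: "((\<lambda>t. V (y t)) \<longlongrightarrow> V (y x)) F" "((\<lambda>t. E (y t)) \<longlongrightarrow> E (y x)) F"
    if "(y \<longlongrightarrow> y x) F" for F
  proof -
    have "isCont V (y x)" "isCont E (y x)"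
      using continuous_on_V continuous_on_E x(2) by (simp_all add: continuous_on_eq_continuous_at open_Compl)
    then show "((\<lambda>t. V (y t)) \<longlongrightarrow> V (y x)) F" "((\<lambda>t. E (y t)) \<longlongrightarrow> E (y x)) F"
      using that by (auto intro: isCont_tendsto_compose)
  qed
  show thesis
  proof (rule that[OF d])
    fix t assume t: "x \<le> t" "t < x + d"
    show "step c y x t"
    proof (cases "t = x")
      case False
      then have t: "x < t" "t < x + d" using t by auto
      have inner: "step c y w v" if "x < w" "w \<le> v" "v < x + d" for w v
        using rotated_quadrant[OF y c u _ that(2), of j] right that x unfolding step_def by auto
      have lim: "(y \<longlongrightarrow> y x) (at_right x)"
        using conty x unfolding continuous_on_def by (auto intro: tendsto_within_subset)
      have V_le: "V (y v) \<le> V (y x)" if v: "x < v" "v < x + d" for v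
      proof (rule tendsto_lowerbound[OF VE(1)[OF lim]])
        show "\<forall>\<^sub>F w in at_right x. V (y v) \<le> V (y w)"
          using eventually_at_right_real[OF v(1)] by eventually_elim (use inner v in \<open>auto simp: step_def\<close>)
      qed simp
      have "E (y t) = E (y x) * cis (2 * pi * (c * (t - x)))" if eq: "V (y t) = V (y x)"
      proof (rule tendsto_unique)
        show "((\<lambda>w. E (y w) * cis (2 * pi * (c * (t - w)))) \<longlongrightarrow> E (y x) * cis (2 * pi * (c * (t - x)))) (at_right x)"
          by (intro tendsto_intros VE(2) lim)
        \<comment> \<open>\<open>V\<close> is monotone on the way, so equality at \<open>x\<close>
          and \<open>t\<close> yields equality at each \<open>w\<close> in between and the phase law
          holds from \<open>w\<close> to \<open>t\<close>.\<close>
        have "\<forall>\<^sub>F w in at_right x. E (y w) * cis (2 * pi * (c * (t - w))) = E (y t)"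
          using eventually_at_right_real[OF t(1)]
        proof eventually_elim
          case (elim w)
          then have "V (y w) \<le> V (y x)" "step c y w t" using V_le[of w] inner[of w t] t by auto
          then show ?case using eq unfolding step_def by auto
        qed
        then show "((\<lambda>w. E (y w) * cis (2 * pi * (c * (t - w)))) \<longlongrightarrow> E (y t)) (at_right x)"
          by (rule tendsto_eventually)
      qed simp
      then show ?thesis using V_le[OF t] by (simp add: step_def)
    qed (simp add: step_refl)
  next
    fix t assume t: "0 \<le> t" "x - d < t" "t \<le> x"
    show "step c y t x"
    proof (cases "t = x")
      case False
      then have t: "0 \<le> t" "x - d < t" "t < x" using t by auto
      have inner: "step c y w v" if "0 \<le> w" "x - d < w" "w \<le> v" "v < x" for w v
        using rotated_quadrant[OF y c u _ that(3), of k] left that x unfolding step_def by auto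
      have lim: "(y \<longlongrightarrow> y x) (at_left x)"
        using continuous_on_interior[OF conty, of x] t
        by (auto simp: isCont_def intro: tendsto_within_subset)
      have V_ge: "V (y x) \<le> V (y v)" if v: "0 \<le> v" "x - d < v" "v < x" for v
      proof (rule tendsto_upperbound[OF VE(1)[OF lim]])
        show "\<forall>\<^sub>F w in at_left x. V (y w) \<le> V (y v)"
          using eventually_at_left_real[OF v(3)] by eventually_elim (use inner v in \<open>auto simp: step_def\<close>)
      qed simp
      have "E (y x) = E (y t) * cis (2 * pi * (c * (x - t)))" if eq: "V (y x) = V (y t)"
      proof (rule tendsto_unique)
        show "((\<lambda>w. E (y w)) \<longlongrightarrow> E (y x)) (at_left x)" by (intro VE(2) lim)
        have ev: "\<forall>\<^sub>F w in at_left x. E (y t) * cis (2 * pi * (c * (w - t))) = E (y w)"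
          using eventually_at_left_real[OF t(3)]
        proof eventually_elim
          case (elim w)
          then have "V (y x) \<le> V (y w)" "step c y t w" using V_ge[of w] inner[of t w] t by auto
          then show ?case using eq unfolding step_def by auto
        qed
        show "((\<lambda>w. E (y w)) \<longlongrightarrow> E (y t) * cis (2 * pi * (c * (x - t)))) (at_left x)"
          by (rule Lim_transform_eventually[OF _ ev]) (intro tendsto_intros)
      qed simp
      then show ?thesis using V_ge[OF t] by (simp add: step_def)
    qed (simp add: step_refl)
  qed
qed

text \<open>Bisection glues the local steps. The backward norm estimate keeps the trajectory away
  from the origin, where the phase has no limit.\<close>

lemma solution_step:
  assumes y: "solution c u y" and c: "c > 0" and u: "law u" and ab: "0 \<le> a" "a \<le> b"
    and "y a \<noteq> 0"
  shows "step c y a b"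
proof -
  define P where "P p q \<longleftrightarrow> a \<le> p \<and> q \<le> b \<longrightarrow> step c y p q" for p q
  have "P a b"
    using ab(2)
  proof (induction rule: Bolzano)
    case (trans p q r)
    then show ?case using step_trans unfolding P_def by fastforce
  next
    case (local x)
    then have "y x \<noteq> 0"
      using solution_norm_le(2)[OF u c y, of a x] ab \<open>y a \<noteq> 0\<close> by auto
    then obtain d where d: "d > 0" "\<And>t. x \<le> t \<Longrightarrow> t < x + d \<Longrightarrow> step c y x t"
      "\<And>t. 0 \<le> t \<Longrightarrow> x - d < t \<Longrightarrow> t \<le> x \<Longrightarrow> step c y t x"
      using local_step[OF y c u, of x] local ab by auto
    show ?case
    proof (intro exI[of _ d] conjI allI impI d(1))
      fix p q assume *: "p \<le> x \<and> x \<le> q \<and> q - p < d"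
      show "P p q"
        unfolding P_def using step_trans[of c y p x q] d(2)[of q] d(3)[of p] * ab by auto
    qed
  qed
  then show ?thesis by (simp add: P_def)
qed

lemma V_nonincreasing:
  assumes "solution c u y" "c > 0" "law u" "0 \<le> a" "a \<le> b"
  shows "V (y b) \<le> V (y a)"
proof (cases "y a = 0")
  case True
  then show ?thesis using solution_norm_le(1)[OF assms(3,2,1,4,5)] by simp
next
  case False
  then show ?thesis using solution_step[OF assms False] by (simp add: step_def)
qed

section \<open>Periodic laws\<close>

lemma solution_shift:
  assumes y: "solution c u y" and T: "T \<ge> 0" and per: "\<And>t. t \<ge> 0 \<Longrightarrow> u (t + T) = u t"
  shows "solution c u (\<lambda>t. y (t + T))"
proof -
  have "ode_solution (\<lambda>t z. c *\<^sub>R field (u (t + T)) z) (\<lambda>t. y (t + T))"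
    using ode_solution_shift[OF y[unfolded solution_def] T] .
  from ode_solution_linear_image[OF this bounded_linear_ident, of "\<lambda>t z. c *\<^sub>R field (u t) z"]
  show ?thesis unfolding solution_def using per by simp
qed

lemma periodic_multiple:
  fixes u :: "real \<Rightarrow> real"
  assumes T: "T \<ge> 0" and per: "\<And>t. t \<ge> 0 \<Longrightarrow> u (t + T) = u t" and "t \<ge> 0"
  shows "u (t + real n * T) = u t"
proof (induction n)
  case (Suc n)
  have "u (t + real n * T + T) = u (t + real n * T)" using assms by (intro per) simp
  then show ?case using Suc by (simp add: algebra_simps)
qed simp

text \<open>Liouville's formula: \<open>Im (cnj y * z)\<close> is the determinant of the pair, and
  every \<open>field u\<close> has trace \<open>- 2 * L\<close> because both nilpotent parts have
  trace zero.\<close>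

lemma wronskian:
  assumes y: "solution c u y" and z: "solution c u z" and "t \<ge> 0"
  shows "Im (cnj (y t) * z t) = Im (cnj (y 0) * z 0) * exp (- 2 * c * L * t)"
proof -
  obtain N1 where N1: "negligible N1"
    "\<And>t. t > 0 \<Longrightarrow> t \<notin> N1 \<Longrightarrow> (y has_vector_derivative c *\<^sub>R field (u t) (y t)) (at t)"
    using ode_solutionE y unfolding solution_def by blast
  obtain N2 where N2: "negligible N2"
    "\<And>t. t > 0 \<Longrightarrow> t \<notin> N2 \<Longrightarrow> (z has_vector_derivative c *\<^sub>R field (u t) (z t)) (at t)"
    using ode_solutionE z unfolding solution_def by blast
  have trace: "Im (cnj (y t) * (c *\<^sub>R field (u t) (z t)) + cnj (c *\<^sub>R field (u t) (y t)) * z t)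
      = (- 2 * c * L) * Im (cnj (y t) * z t)" for t
    by (simp add: Re_field Im_field algebra_simps add_divide_distrib diff_divide_distrib)
  have "ode_solution (\<lambda>t w. (- 2 * c * L) * w) (\<lambda>t. Im (cnj (y t) * z t))"
    unfolding ode_solution_def
  proof (intro conjI allI exI[of _ "N1 \<union> N2"] impI)
    show "abs_continuous_on {0..b} (\<lambda>t. Im (cnj (y t) * z t))" for b
      using y z ode_solution_abs_continuous unfolding solution_def
      by (intro abs_continuous_on_bounded_linear[OF bounded_linear_Im]
          abs_continuous_on_bounded_bilinear[OF bounded_bilinear_mult]
          abs_continuous_on_bounded_linear[OF bounded_linear_cnj]) auto
    fix t :: real assume t: "0 < t" "t \<notin> N1 \<union> N2"
    have "((\<lambda>t. cnj (y t)) has_vector_derivative cnj (c *\<^sub>R field (u t) (y t))) (at t)"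
      by (rule bounded_linear.has_vector_derivative[OF bounded_linear_cnj]) (use N1(2) t in auto)
    moreover have "(z has_vector_derivative c *\<^sub>R field (u t) (z t)) (at t)" using N2(2) t by auto
    ultimately have "((\<lambda>t. cnj (y t) * z t) has_vector_derivative
        cnj (y t) * (c *\<^sub>R field (u t) (z t)) + cnj (c *\<^sub>R field (u t) (y t)) * z t) (at t)"
      by (rule bounded_bilinear.has_vector_derivative[OF bounded_bilinear_mult])
    from bounded_linear.has_vector_derivative[OF bounded_linear_Im this]
    show "((\<lambda>t. Im (cnj (y t) * z t)) has_vector_derivative (- 2 * c * L) * Im (cnj (y t) * z t)) (at t)"
      unfolding trace .
  qed (use N1 N2 in auto)
  moreover have "ode_solution (\<lambda>t w. (- 2 * c * L) * w)
      (\<lambda>t. Im (cnj (y 0) * z 0) * exp (- 2 * c * L * t))"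
    unfolding ode_solution_def
  proof (intro conjI allI exI[of _ "{}"] impI)
    have der: "((\<lambda>t. Im (cnj (y 0) * z 0) * exp (- 2 * c * L * t)) has_vector_derivative
        - 2 * c * L * (Im (cnj (y 0) * z 0) * exp (- 2 * c * L * t))) (at t)" for t
      by (auto intro!: derivative_eq_intros simp: has_real_derivative_iff_has_vector_derivative[symmetric])
    then show "abs_continuous_on {0..b} (\<lambda>t. Im (cnj (y 0) * z 0) * exp (- 2 * c * L * t))" for b
      by (rule abs_continuous_on_C1) (intro continuous_intros)
    show "((\<lambda>t. Im (cnj (y 0) * z 0) * exp (- 2 * c * L * t)) has_vector_derivative
        - 2 * c * L * (Im (cnj (y 0) * z 0) * exp (- 2 * c * L * t))) (at t)" for t
      by (rule der)
  qed auto
  ultimately show ?thesis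
  proof (rule ode_solution_unique[where K = "\<bar>- 2 * c * L\<bar>"])
    show "norm (- 2 * c * L * v - - 2 * c * L * w) \<le> \<bar>- 2 * c * L\<bar> * norm (v - w)" for v w :: real
      by (simp only: right_diff_distrib[symmetric] real_norm_def abs_mult order_refl)
  qed (use \<open>t \<ge> 0\<close> in auto)
qed

text \<open>An extremal trajectory is tracked by its phase \<open>E\<close>, which advances at constant speed. Under
  a \<open>T\<close>-periodic law its translate by \<open>T\<close> is extremal too, and the two become parallel because
  the Wronskian decays; hence their constant phase difference is trivial.\<close>

lemma extremal_period:
  assumes y: "solution c u y" and c: "c > 0" and u: "law u"
    and T: "T > 0" and per: "\<And>t. t \<ge> 0 \<Longrightarrow> u (t + T) = u t"
    and "y 0 \<noteq> 0" and const: "\<And>t. t \<ge> 0 \<Longrightarrow> V (y t) = V (y 0)"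
  shows "c * T \<in> \<int>"
proof -
  define z where "z t = y (t + T)" for t
  have z: "solution c u z" unfolding z_def using solution_shift[OF y _ per] T by simp
  define l where "l = V (y 0)"
  have l: "l > 0" using V_pos \<open>y 0 \<noteq> 0\<close> by (simp add: l_def)
  have E_y: "E (y t) = E (y 0) * cis (2 * pi * (c * t))" if "t \<ge> 0" for t
    using solution_step[OF y c u _ that \<open>y 0 \<noteq> 0\<close>] const[OF that] by (simp add: step_def)
  have E_z: "E (z t) = E (y t) * cis (2 * pi * (c * T))" if "t \<ge> 0" for t
    using E_y[of t] E_y[of "t + T"] that T by (simp add: z_def cis_mult mult.assoc distrib_left)
  have bd: "norm (y t) \<le> l / s" if "t \<ge> 0" for t
    using V_ge[of "y t"] const[OF that] s_pos by (simp add: l_def pos_le_divide_eq mult.commute)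
  \<comment> \<open>Pairs are formed so that one subsequence serves both trajectories.\<close>
  have "bounded (range (\<lambda>n. (y (real n), z (real n))))"
  proof (rule boundedI)
    fix x assume "x \<in> range (\<lambda>n. (y (real n), z (real n)))"
    then obtain n where "x = (y (real n), z (real n))" by blast
    then show "norm x \<le> l / s + l / s"
      using norm_Pair_le[of "y (real n)" "z (real n)"] bd[of "real n"] bd[of "real n + T"] T
      by (simp add: z_def)
  qed
  then obtain \<eta>\<zeta> r where r: "strict_mono r" "((\<lambda>n. (y (real n), z (real n))) \<circ> r) \<longlonglongrightarrow> \<eta>\<zeta>"
    using bounded_imp_convergent_subsequence[of "\<lambda>n. (y (real n), z (real n))"] by blast
  define \<eta> \<zeta> where "\<eta> = fst \<eta>\<zeta>" and "\<zeta> = snd \<eta>\<zeta>"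
  have lim_y: "(\<lambda>n. y (real (r n))) \<longlonglongrightarrow> \<eta>" and lim_z: "(\<lambda>n. z (real (r n))) \<longlonglongrightarrow> \<zeta>"
    using tendsto_fst[OF r(2)] tendsto_snd[OF r(2)] by (simp_all add: \<eta>_def \<zeta>_def o_def)
  \<comment> \<open>Constancy of \<open>V\<close> keeps both trajectories away from the origin, so
    \<open>E\<close> is continuous at their limits.\<close>
  have lower: "l / (2 * exp L) \<le> norm (y t)" if "t \<ge> 0" for t
    using V_le[of "y t"] const[OF that] by (simp add: l_def pos_divide_le_eq mult.commute)
  have "l / (2 * exp L) \<le> norm \<eta>"
    by (rule tendsto_lowerbound[OF tendsto_norm[OF lim_y]]) (use lower in auto)
  moreover have "l / (2 * exp L) \<le> norm \<zeta>"
    by (rule tendsto_lowerbound[OF tendsto_norm[OF lim_z]]) (use lower T in \<open>auto simp: z_def\<close>)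
  ultimately have nz: "\<eta> \<noteq> 0" "\<zeta> \<noteq> 0" using l by (auto simp: divide_le_0_iff)
  have cont: "isCont V w" "isCont E w" if "w \<noteq> 0" for w
    using continuous_on_V continuous_on_E that by (simp_all add: continuous_on_eq_continuous_at open_Compl)
  have "(\<lambda>n. E (y (real (r n))) * cis (2 * pi * (c * T))) \<longlonglongrightarrow> E \<eta> * cis (2 * pi * (c * T))"
    by (intro tendsto_mult tendsto_const isCont_tendsto_compose[OF cont(2) lim_y] nz)
  then have "(\<lambda>n. E (z (real (r n)))) \<longlonglongrightarrow> E \<eta> * cis (2 * pi * (c * T))"
    by (simp add: E_z)
  moreover have "(\<lambda>n. E (z (real (r n)))) \<longlonglongrightarrow> E \<zeta>"
    by (intro isCont_tendsto_compose[OF cont(2) lim_z] nz)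
  ultimately have E_eq: "E \<zeta> = E \<eta> * cis (2 * pi * (c * T))"
    using LIMSEQ_unique by blast
  have "(\<lambda>n. Im (cnj (y (real (r n))) * z (real (r n)))) \<longlonglongrightarrow> Im (cnj \<eta> * \<zeta>)"
    by (intro tendsto_intros lim_y lim_z)
  moreover have "(\<lambda>n. Im (cnj (y (real (r n))) * z (real (r n)))) \<longlonglongrightarrow> 0"
  proof -
    have "((\<lambda>t. Im (cnj (y 0) * z 0) * exp (- 2 * c * L * t)) \<longlongrightarrow> Im (cnj (y 0) * z 0) * 0) at_top"
      using c L_pos
      by (intro tendsto_mult tendsto_const filterlim_compose[OF exp_at_bot]
          filterlim_tendsto_neg_mult_at_bot[OF tendsto_const] filterlim_ident) auto
    moreover have "filterlim (\<lambda>n. real (r n)) at_top sequentially"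
      by (rule filterlim_compose[OF filterlim_real_sequentially filterlim_subseq[OF r(1)]])
    ultimately have "(\<lambda>n. Im (cnj (y 0) * z 0) * exp (- 2 * c * L * real (r n))) \<longlonglongrightarrow> Im (cnj (y 0) * z 0) * 0"
      by (rule filterlim_compose)
    then show ?thesis
      unfolding mult_zero_right by (rule Lim_transform_eventually)
        (intro always_eventually allI wronskian[OF y z, symmetric] of_nat_0_le_iff)
  qed
  ultimately have parallel: "Im (cnj \<eta> * \<zeta>) = 0" by (rule LIMSEQ_unique)
  \<comment> \<open>The determinant vanishes, so \<open>\<zeta>\<close> is a real multiple of
    \<open>\<eta>\<close> and \<open>\<rho>\<close> is the coefficient; \<open>E\<close> is
    invariant under multiples of either sign.\<close>
  define \<rho> where "\<rho> = Re (cnj \<eta> * \<zeta>) / (norm \<eta>)\<^sup>2"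
  have "\<zeta> = \<rho> *\<^sub>R \<eta>"
  proof -
    have "cnj \<eta> * \<zeta> = of_real (Re (cnj \<eta> * \<zeta>))"
      using parallel by (simp only: complex_eq_iff Re_complex_of_real Im_complex_of_real)
    also have "\<dots> = of_real (\<rho> * (norm \<eta>)\<^sup>2)" using nz by (simp add: \<rho>_def)
    also have "\<dots> = \<rho> *\<^sub>R (cnj \<eta> * \<eta>)"
    proof -
      have "complex_of_real ((norm \<eta>)\<^sup>2) = cnj \<eta> * \<eta>"
        using complex_norm_square[of \<eta>] by (simp only: mult.commute of_real_power)
      then show ?thesis by (simp only: of_real_mult scaleR_conv_of_real)
    qed
    finally have "cnj \<eta> * \<zeta> = cnj \<eta> * (\<rho> *\<^sub>R \<eta>)" by simp
    then show ?thesis using nz mult_left_cancel[of "cnj \<eta>"] by blast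
  qed
  moreover from this have "\<rho> \<noteq> 0" using nz by auto
  ultimately have "E \<zeta> = E \<eta>" by (simp add: E_scale)
  then have "cis (2 * pi * (c * T)) = 1"
    using E_eq norm_E[of \<eta>] mult_cancel_left1[of "E \<eta>"] by fastforce
  then have "Re (cis (2 * pi * (c * T))) = Re 1" by (rule arg_cong)
  then have "cos (2 * pi * (c * T)) = 1" by simp
  then obtain n :: int where "2 * pi * (c * T) = of_int n * 2 * pi" using cos_one_2pi_int by blast
  then have "2 * pi * (c * T) = 2 * pi * of_int n" by (simp only: mult_ac)
  then have "c * T = of_int n" using pi_gt_zero by (simp only: mult_cancel_left) simp
  then show ?thesis using Ints_of_int by metis
qed

text \<open>An invariance argument in the manner of LaSalle: if \<open>V\<close> had a positive
  limit \<open>l\<close>, an accumulation point of the states at the multiples of \<open>T\<close>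
  would start a trajectory of the same law on which \<open>V\<close> is constantly \<open>l\<close>.
  Such a trajectory is excluded by \<open>extremal_period\<close>.\<close>

lemma solution_tendsto_zero:
  assumes y: "solution c u y" and c: "c > 0" and u: "law u" "u \<in> borel_measurable (lebesgue_on {0..})"
    and T: "T > 0" and per: "\<And>t. t \<ge> 0 \<Longrightarrow> u (t + T) = u t" and irr: "c * T \<notin> \<int>"
  shows "(\<lambda>n. V (y (real n * T))) \<longlonglongrightarrow> 0"
proof -
  obtain e1 where e1: "solution c u e1" "e1 0 = 1" using solution_exists[OF u c] by blast
  obtain e2 where e2: "solution c u e2" "e2 0 = \<i>" using solution_exists[OF u c] by blast
  \<comment> \<open>The flow is written through a basis of solutions, so its continuity in the
    initial value \<open>w\<close> is evident.\<close>
  define \<Phi> where "\<Phi> w t = Re w *\<^sub>R e1 t + Im w *\<^sub>R e2 t" for w t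
  have \<Phi>: "solution c u (\<Phi> w)" "\<Phi> w 0 = w" for w
    using solution_combination[OF e1(1) e2(1)] e1(2) e2(2)
    by (simp_all add: \<Phi>_def[abs_def] complex_eq_iff)
  have flow: "y (t + real n * T) = \<Phi> (y (real n * T)) t" if "t \<ge> 0" for t n
  proof (rule solution_unique[OF u(1) c _ \<Phi>(1) _ that])
    show "solution c u (\<lambda>t. y (t + real n * T))"
      by (intro solution_shift[OF y] periodic_multiple[of T u]) (use T per in auto)
    show "y (0 + real n * T) = \<Phi> (y (real n * T)) 0" by (simp add: \<Phi>)
  qed
  define v where "v n = V (y (real n * T))" for n
  have dec: "decseq v"
    unfolding decseq_def v_def using T
    by (auto intro!: V_nonincreasing[OF y c u(1)] mult_right_mono)
  then obtain l where l: "v \<longlonglongrightarrow> l" "\<And>n. l \<le> v n"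
    using decseq_convergent[of v 0] V_nonneg unfolding v_def by blast
  have l0: "l \<ge> 0" by (rule LIMSEQ_le_const[OF l(1)]) (auto simp: v_def V_nonneg)
  show ?thesis
  proof (cases "l = 0")
    case True then show ?thesis using l(1) unfolding v_def by simp
  next
    case False
    then have "l > 0" using l0 by simp
    have "bounded (range (\<lambda>n. y (real n * T)))"
    proof (rule boundedI)
      fix x assume "x \<in> range (\<lambda>n. y (real n * T))"
      then obtain n where x: "x = y (real n * T)" by blast
      have "s * norm x \<le> V (y 0)"
        using V_ge[of x] V_nonincreasing[OF y c u(1), of 0 "real n * T"] T unfolding x by simp
      then show "norm x \<le> V (y 0) / s" using s_pos by (simp add: pos_le_divide_eq mult.commute)
    qed
    then obtain \<eta> r where r: "strict_mono r" "((\<lambda>n. y (real n * T)) \<circ> r) \<longlonglongrightarrow> \<eta>"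
      using bounded_imp_convergent_subsequence[of "\<lambda>n. y (real n * T)"] by blast
    then have lim: "(\<lambda>n. y (real (r n) * T)) \<longlonglongrightarrow> \<eta>" by (simp add: o_def)
    have "l / (2 * exp L) \<le> norm \<eta>"
    proof (rule tendsto_lowerbound[OF tendsto_norm[OF lim]])
      show "\<forall>\<^sub>F n in sequentially. l / (2 * exp L) \<le> norm (y (real (r n) * T))"
        using order_trans[OF l(2) V_le[of "y (real _ * T)", folded v_def]]
        by (simp add: pos_divide_le_eq mult.commute)
    qed simp
    then have "\<eta> \<noteq> 0" using \<open>l > 0\<close> by (auto simp: divide_le_0_iff)
    have V_flow: "V (\<Phi> \<eta> t) = l" if "t \<ge> 0" for t
    proof -
      have "\<Phi> \<eta> t \<noteq> 0"
        using solution_norm_le(2)[OF u(1) c \<Phi>(1), of 0 t \<eta>] that \<open>\<eta> \<noteq> 0\<close> by (auto simp: \<Phi>)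
      then have "isCont V (\<Phi> \<eta> t)"
        using continuous_on_V by (simp add: continuous_on_eq_continuous_at open_Compl)
      moreover have "(\<lambda>n. \<Phi> (y (real (r n) * T)) t) \<longlonglongrightarrow> \<Phi> \<eta> t"
        unfolding \<Phi>_def by (intro tendsto_intros lim)
      ultimately have "(\<lambda>n. V (\<Phi> (y (real (r n) * T)) t)) \<longlonglongrightarrow> V (\<Phi> \<eta> t)"
        by (rule isCont_tendsto_compose)
      moreover have "(\<lambda>n. V (\<Phi> (y (real (r n) * T)) t)) \<longlonglongrightarrow> l"
      proof -
        \<comment> \<open>The time \<open>r n * T + t\<close> lies between \<open>r n\<close> and
          \<open>r n + k\<close> periods, so monotonicity encloses \<open>V\<close> between two
          terms with the common limit \<open>l\<close>.\<close>
        obtain k :: nat where k: "t \<le> real k * T" using T by (metis ex_less_of_nat_mult less_imp_le)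
        show ?thesis
        proof (rule tendsto_sandwich)
        have "filterlim (\<lambda>n. r n + k) sequentially sequentially"
          by (rule filterlim_compose[OF filterlim_add_const_nat_at_top filterlim_subseq[OF r(1)]])
        then show "(\<lambda>n. v (r n + k)) \<longlonglongrightarrow> l" by (rule filterlim_compose[OF l(1)])
        show "(\<lambda>n. v (r n)) \<longlonglongrightarrow> l" by (rule filterlim_compose[OF l(1) filterlim_subseq[OF r(1)]])
        show "\<forall>\<^sub>F n in sequentially. v (r n + k) \<le> V (\<Phi> (y (real (r n) * T)) t)"
        proof (intro always_eventually allI)
          fix n show "v (r n + k) \<le> V (\<Phi> (y (real (r n) * T)) t)"
            unfolding v_def flow[OF that, symmetric]
            by (rule V_nonincreasing[OF y c u(1)]) (use T k that in \<open>auto simp: algebra_simps\<close>)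
        qed
        show "\<forall>\<^sub>F n in sequentially. V (\<Phi> (y (real (r n) * T)) t) \<le> v (r n)"
        proof (intro always_eventually allI)
          fix n show "V (\<Phi> (y (real (r n) * T)) t) \<le> v (r n)"
            unfolding v_def flow[OF that, symmetric]
            by (rule V_nonincreasing[OF y c u(1)]) (use T that in auto)
        qed
      qed
      qed
      ultimately show ?thesis by (rule LIMSEQ_unique)
    qed
    have "c * T \<in> \<int>"
      by (rule extremal_period[OF \<Phi>(1) c u(1) T per, of \<eta>])
        (use \<open>\<eta> \<noteq> 0\<close> V_flow[of 0] in \<open>simp_all add: \<Phi>(2) V_flow\<close>)
    then show ?thesis using irr by simp
  qed
qed

lemma solution_bounded:
  assumes "solution c u y" "c > 0" "law u" "t \<ge> 0"
  shows "norm (y t) \<le> V (y 0) / s"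
  using V_ge[of "y t"] V_nonincreasing[OF assms(1-3), of 0 t] assms(4) s_pos
  by (simp add: pos_le_divide_eq mult.commute)

text \<open>Linearity turns convergence into a rate: once two basis solutions are small after
  \<open>n\<close> periods, every solution has halved its \<open>V\<close> by then, and this repeats
  by periodicity.\<close>

lemma solution_exponential_decay:
  assumes y: "solution c u y" and c: "c > 0" and u: "law u" "u \<in> borel_measurable (lebesgue_on {0..})"
    and T: "T > 0" and per: "\<And>t. t \<ge> 0 \<Longrightarrow> u (t + T) = u t" and irr: "c * T \<notin> \<int>"
  shows "converges_exponentially_to_zero y"
proof -
  obtain e1 where e1: "solution c u e1" "e1 0 = 1" using solution_exists[OF u c] by blast
  obtain e2 where e2: "solution c u e2" "e2 0 = \<i>" using solution_exists[OF u c] by blast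
  have "(\<lambda>n. V (e1 (real n * T)) + V (e2 (real n * T))) \<longlonglongrightarrow> 0 + 0"
    by (intro tendsto_add solution_tendsto_zero[OF _ c u T per irr] e1 e2)
  \<comment> \<open>The threshold is what \<open>V_ge\<close> and \<open>V_le\<close> require for
    the factor \<open>1/2\<close> in \<open>half\<close> below.\<close>
  then have "\<forall>\<^sub>F n in sequentially. V (e1 (real n * T)) + V (e2 (real n * T)) < s * s / (4 * exp L)"
    using s_pos by (intro order_tendstoD(2)) auto
  then obtain n where n: "n > 0" "V (e1 (real n * T)) + V (e2 (real n * T)) < s * s / (4 * exp L)"
    using eventually_happens'[OF sequentially_bot eventually_conj[OF _ eventually_gt_at_top[of 0]]]
    by (metis (no_types, lifting))
  define P where "P = real n * T"
  have P: "P > 0" using n T by (simp add: P_def)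
  have half: "V (w P) \<le> V (w 0) / 2" if w: "solution c u w" for w
  proof -
    have "w P = Re (w 0) *\<^sub>R e1 P + Im (w 0) *\<^sub>R e2 P"
      by (rule solution_unique[OF u(1) c w solution_combination[OF e1(1) e2(1)]])
        (use P e1 e2 in \<open>auto simp: complex_eq_iff\<close>)
    then have "norm (w P) \<le> \<bar>Re (w 0)\<bar> * norm (e1 P) + \<bar>Im (w 0)\<bar> * norm (e2 P)"
      by (metis norm_scaleR norm_triangle_ineq)
    also have "\<dots> \<le> norm (w 0) * norm (e1 P) + norm (w 0) * norm (e2 P)"
      by (intro add_mono mult_right_mono abs_Re_le_cmod abs_Im_le_cmod) auto
    finally have 1: "norm (w P) \<le> norm (w 0) * (norm (e1 P) + norm (e2 P))" by (simp add: algebra_simps)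
    have "s * (norm (e1 P) + norm (e2 P)) \<le> s * (s / (4 * exp L))"
      using V_ge[of "e1 P"] V_ge[of "e2 P"] n(2) by (simp add: P_def algebra_simps)
    from mult_left_le_imp_le[OF this s_pos]
    have 2: "norm (e1 P) + norm (e2 P) \<le> s / (4 * exp L)" .
    have "V (w P) \<le> 2 * exp L * norm (w P)" by (rule V_le)
    also have "\<dots> \<le> 2 * exp L * (norm (w 0) * (s / (4 * exp L)))"
      using order_trans[OF 1 mult_left_mono[OF 2 norm_ge_zero]] by (intro mult_left_mono) auto
    also have "\<dots> = s * norm (w 0) / 2" by simp
    also have "\<dots> \<le> V (w 0) / 2" using V_ge by (intro divide_right_mono) auto
    finally show ?thesis .
  qed
  have iter: "V (y (real k * P)) \<le> V (y 0) / 2 ^ k" for k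
  proof (induction k)
    case (Suc k)
    have "solution c u (\<lambda>t. y (t + real (k * n) * T))"
      by (intro solution_shift[OF y] periodic_multiple[of T u]) (use T per in auto)
    from half[OF this] have "V (y (real (Suc k) * P)) \<le> V (y (real k * P)) / 2"
      by (simp add: P_def algebra_simps)
    also have "\<dots> \<le> V (y 0) / 2 ^ Suc k" using Suc by (simp add: field_simps)
    finally show ?case .
  qed simp
  define g where "g = ln 2 / P"
  have g: "g > 0" using P by (simp add: g_def)
  have "norm (y t) \<le> (2 * V (y 0) / s) * exp (- g * t)" if "t \<ge> 0" for t
  proof -
    \<comment> \<open>\<open>k\<close> counts the complete blocks of length \<open>P\<close> before
      \<open>t\<close>; the incomplete last block costs a factor 2.\<close>
    define k where "k = nat \<lfloor>t / P\<rfloor>"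
    have k: "real k \<le> t / P" "t / P < real k + 1"
      using that P by (auto simp: k_def)
    have "s * norm (y t) \<le> V (y t)" by (rule V_ge)
    also have "\<dots> \<le> V (y (real k * P))"
      using k P by (intro V_nonincreasing[OF y c u(1)]) (auto simp: pos_le_divide_eq)
    also have "\<dots> \<le> V (y 0) / 2 ^ k" by (rule iter)
    also have "\<dots> = V (y 0) * exp (- ln 2 * real k)"
    proof -
      have "exp (real k * ln 2) = 2 ^ k" by (subst exp_of_nat_mult) simp
      then show ?thesis by (simp add: exp_minus divide_inverse mult.commute)
    qed
    also have "\<dots> \<le> V (y 0) * exp (ln 2 - g * t)"
    proof (intro mult_left_mono V_nonneg)
      have "ln 2 * (t / P) \<le> ln 2 * (real k + 1)" using k by (intro mult_left_mono) auto
      then show "exp (- ln 2 * real k) \<le> exp (ln 2 - g * t)" by (simp add: g_def algebra_simps)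
    qed
    also have "\<dots> = 2 * V (y 0) * exp (- g * t)" by (simp add: exp_diff exp_minus divide_inverse)
    finally show ?thesis using s_pos by (simp add: field_simps)
  qed
  then show ?thesis unfolding converges_exponentially_to_zero_def using g by blast
qed

end

section \<open>The tensor product\<close>

lemma vector_4 [simp]:
  "(vector [a, b, c, d] :: 'a::zero ^ 4) $ 1 = a"
  "(vector [a, b, c, d] :: 'a ^ 4) $ 2 = b"
  "(vector [a, b, c, d] :: 'a ^ 4) $ 3 = c"
  "(vector [a, b, c, d] :: 'a ^ 4) $ 4 = d"
  by (simp_all add: vector_def)

lemma AE_lebesgue_on_iff_negligible:
  assumes "S \<in> sets lebesgue"
  shows "(AE x in lebesgue_on S. P x) \<longleftrightarrow> negligible {x \<in> S. \<not> P x}"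
  using assms
  by (simp add: AE_restrict_space_iff completion.AE_iff_null_sets negligible_iff_null_sets Collect_conj_eq)

text \<open>The one-sided and two-sided derivatives coincide at \<open>t > 0\<close>, and the
  remaining time \<open>0\<close> is negligible.\<close>

lemma caratheodory_solution_iff_ode_solution:
  "caratheodory_solution A x \<longleftrightarrow> ode_solution (\<lambda>t v. A t *v v) x"
proof
  assume c: "caratheodory_solution A x"
  let ?D = "\<lambda>t. (x has_vector_derivative A t *v x t) (at t within {0..})"
  have "negligible {t \<in> {0..}. \<not> ?D t}"
    using c by (simp add: caratheodory_solution_def AE_lebesgue_on_iff_negligible)
  moreover have "(x has_vector_derivative A t *v x t) (at t)"
    if "t > 0" "t \<notin> {t \<in> {0..}. \<not> ?D t}" for t
    using that by (simp add: at_within_interior[of t "{0..}"])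
  ultimately show "ode_solution (\<lambda>t v. A t *v v) x"
    using c unfolding ode_solution_def caratheodory_solution_def by blast
next
  assume y: "ode_solution (\<lambda>t v. A t *v v) x"
  then obtain N where N: "negligible N"
    "\<And>t. t > 0 \<Longrightarrow> t \<notin> N \<Longrightarrow> (x has_vector_derivative A t *v x t) (at t)"
    using ode_solutionE[OF y] by blast
  have "negligible {t \<in> {0..}. \<not> (x has_vector_derivative A t *v x t) (at t within {0..})}"
  proof (rule negligible_subset[of "N \<union> {0}"])
    show "{t \<in> {0..}. \<not> (x has_vector_derivative A t *v x t) (at t within {0..})} \<subseteq> N \<union> {0}"
    proof
      fix t assume t: "t \<in> {t \<in> {0..}. \<not> (x has_vector_derivative A t *v x t) (at t within {0..})}"
      then have "\<not> (x has_vector_derivative A t *v x t) (at t)"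
        using has_vector_derivative_at_within by blast
      then show "t \<in> N \<union> {0}" using N(2)[of t] t by (cases "t = 0") auto
    qed
  qed (use N in auto)
  then show "caratheodory_solution A x"
    unfolding caratheodory_solution_def
    using ode_solution_abs_continuous[OF y] by (simp add: AE_lebesgue_on_iff_negligible)
qed

lemma converges_exponentially_add:
  assumes "converges_exponentially_to_zero f" "converges_exponentially_to_zero g"
  shows "converges_exponentially_to_zero (\<lambda>t. f t + g t)"
proof -
  obtain C c where f: "c > 0" "\<And>t. t \<ge> 0 \<Longrightarrow> norm (f t) \<le> C * exp (- c * t)"
    using assms(1) unfolding converges_exponentially_to_zero_def by blast
  obtain D d where g: "d > 0" "\<And>t. t \<ge> 0 \<Longrightarrow> norm (g t) \<le> D * exp (- d * t)"
    using assms(2) unfolding converges_exponentially_to_zero_def by blast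
  have "norm (f 0) \<le> C" "norm (g 0) \<le> D"
    using f(2)[of 0] g(2)[of 0] by auto
  then have CD: "0 \<le> C" "0 \<le> D"
    by (meson norm_ge_zero order_trans)+
  show ?thesis
    unfolding converges_exponentially_to_zero_def
  proof (rule exI[of _ "C + D"], rule exI[of _ "min c d"], intro conjI allI impI)
    fix t :: real assume t: "t \<ge> 0"
    have "C * exp (- c * t) \<le> C * exp (- min c d * t)" "D * exp (- d * t) \<le> D * exp (- min c d * t)"
      using CD t by (auto intro!: mult_left_mono mult_right_mono)
    then show "norm (f t + g t) \<le> (C + D) * exp (- min c d * t)"
      using norm_triangle_ineq[of "f t" "g t"] f(2)[OF t] g(2)[OF t] by (simp add: distrib_right)
  qed (use f g in auto)
qed

lemma converges_exponentially_dominated: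
  assumes "converges_exponentially_to_zero f"
    and le: "\<And>t. t \<ge> 0 \<Longrightarrow> norm (g t) \<le> B * norm (f t)"
  shows "converges_exponentially_to_zero g"
proof -
  obtain C c where f: "c > 0" "\<And>t. t \<ge> 0 \<Longrightarrow> norm (f t) \<le> C * exp (- c * t)"
    using assms(1) unfolding converges_exponentially_to_zero_def by blast
  have "norm (g t) \<le> (\<bar>B\<bar> * C) * exp (- c * t)" if t: "t \<ge> 0" for t
  proof -
    have "norm (g t) \<le> B * norm (f t)" by (rule le[OF t])
    also have "\<dots> \<le> \<bar>B\<bar> * norm (f t)" by (intro mult_right_mono) auto
    also have "\<dots> \<le> \<bar>B\<bar> * (C * exp (- c * t))" using f(2)[OF t] by (intro mult_left_mono) auto
    finally show ?thesis by (simp add: mult.assoc)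
  qed
  then show ?thesis unfolding converges_exponentially_to_zero_def using f(1) by blast
qed

text \<open>The real tensor product of two copies of the plane, in coordinates for the basis of
  products of \<open>1\<close> and \<open>\<i>\<close> in lexicographic order.\<close>

definition tensor :: "complex \<Rightarrow> complex \<Rightarrow> real^4" where
  "tensor y z = vector [Re y * Re z, Re y * Im z, Im y * Re z, Im y * Im z]"

lemma bounded_bilinear_tensor: "bounded_bilinear tensor"
  unfolding bilinear_conv_bounded_bilinear[symmetric] bilinear_def
  by (auto intro!: linearI simp: tensor_def vec_eq_iff forall_4 algebra_simps)

lemma norm_tensor: "norm (tensor y z) = norm y * norm z"
proof -
  have "(norm (tensor y z))\<^sup>2 = tensor y z \<bullet> tensor y z" by (rule power2_norm_eq_inner)
  also have "\<dots> = (norm y)\<^sup>2 * (norm z)\<^sup>2"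
    unfolding inner_vec_def sum_4 tensor_def cmod_power2
    by (simp add: power2_eq_square algebra_simps)
  finally have "(norm (tensor y z))\<^sup>2 = (norm y * norm z)\<^sup>2" by (simp add: power_mult_distrib)
  then show ?thesis by (simp add: power2_eq_iff_nonneg)
qed

locale tensor_pair = extremal_spiral +
  fixes c :: real
  assumes c_pos: "c > 0" and c_irrational: "c \<notin> \<rat>"
begin

text \<open>\<open>M u w\<close> is the matrix of \<open>field u\<close> acting on the first tensor factor plus
  \<open>c\<close> times \<open>field w\<close> acting on the second one.\<close>

definition M0 :: "real^4^4" where
  "M0 = vector [
     vector [(1 + c) * (1 - L), - c / s, - 1 / s, 0],
     vector [c * s, (1 - L) - c * (1 + L), 0, - 1 / s],
     vector [s, 0, c * (1 - L) - (1 + L), - c / s],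
     vector [0, s, c * s, - (1 + c) * (1 + L)]]"

definition M1 :: "real^4^4" where
  "M1 = vector [
     vector [- 2, 0, 1 / s - s, 0], vector [0, - 2, 0, 1 / s - s],
     vector [1 / s - s, 0, 2, 0], vector [0, 1 / s - s, 0, 2]]"

definition M2 :: "real^4^4" where
  "M2 = vector [
     vector [- 2 * c, c * (1 / s - s), 0, 0], vector [c * (1 / s - s), 2 * c, 0, 0],
     vector [0, 0, - 2 * c, c * (1 / s - s)], vector [0, 0, c * (1 / s - s), 2 * c]]"

definition M :: "real \<Rightarrow> real \<Rightarrow> real^4^4" where
  "M u w = M0 + u *\<^sub>R M1 + w *\<^sub>R M2"

lemma M_tensor: "M u w *v tensor y z = tensor (field u y) z + tensor y (c *\<^sub>R field w z)"
  by (simp add: vec_eq_iff forall_4 M_def M0_def M1_def M2_def matrix_vector_mult_def sum_4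
      tensor_def Re_field Im_field)
    (simp add: divide_inverse algebra_simps)

lemma slope_pos: "1 / s - s > 0"
proof -
  have "s * s < 1 * 1" using s_pos s_less_1 by (intro mult_strict_mono) auto
  then show ?thesis using s_pos by (simp add: pos_less_divide_eq)
qed

text \<open>Each of these two entries depends on one weight only, with nonzero slope. They recover
  both planar laws from the matrix, which separates the four vertices and later yields measurability
  of the laws.\<close>

lemma M_entries: "M u w $ 3 $ 1 = s + u * (1 / s - s)" "M u w $ 2 $ 1 = c * (s + w * (1 / s - s))"
  by (simp_all add: M_def M0_def M1_def M2_def algebra_simps)

definition vertices :: "(real^4^4) set" where
  "vertices = {M 0 0, M 0 1, M 1 0, M 1 1}"

lemma M_inj: "M u w = M u' w' \<longleftrightarrow> u = u' \<and> w = w'"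
proof
  assume "M u w = M u' w'"
  then have "M u w $ 3 $ 1 = M u' w' $ 3 $ 1" "M u w $ 2 $ 1 = M u' w' $ 2 $ 1" by simp_all
  then have "s + u * (1 / s - s) = s + u' * (1 / s - s)" "c * (s + w * (1 / s - s)) = c * (s + w' * (1 / s - s))"
    by (simp_all only: M_entries)
  then show "u = u' \<and> w = w'" using slope_pos c_pos by simp
qed simp

lemma card_vertices: "card vertices = 4"
  by (simp add: vertices_def M_inj)

text \<open>\<open>M\<close> is affine in the pair of weights, so the image of the unit square is
  convex, and it contains the vertices.\<close>

lemma convex_hull_vertices: "convex hull vertices \<subseteq> {M u w | u w. 0 \<le> u \<and> u \<le> 1 \<and> 0 \<le> w \<and> w \<le> 1}"
proof (rule hull_minimal)
  show "vertices \<subseteq> {M u w | u w. 0 \<le> u \<and> u \<le> 1 \<and> 0 \<le> w \<and> w \<le> 1}"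
    by (force simp: vertices_def)
  show "convex {M u w | u w. 0 \<le> u \<and> u \<le> 1 \<and> 0 \<le> w \<and> w \<le> 1}"
  proof (rule convexI)
    fix A B and a b :: real
    assume "A \<in> {M u w | u w. 0 \<le> u \<and> u \<le> 1 \<and> 0 \<le> w \<and> w \<le> 1}"
      and "B \<in> {M u w | u w. 0 \<le> u \<and> u \<le> 1 \<and> 0 \<le> w \<and> w \<le> 1}" and ab: "0 \<le> a" "0 \<le> b" "a + b = 1"
    then obtain u w u' w' where A: "A = M u w" "0 \<le> u" "u \<le> 1" "0 \<le> w" "w \<le> 1"
      and B: "B = M u' w'" "0 \<le> u'" "u' \<le> 1" "0 \<le> w'" "w' \<le> 1" by blast
    have "a *\<^sub>R A + b *\<^sub>R B = (a + b) *\<^sub>R M0 + (a * u + b * u') *\<^sub>R M1 + (a * w + b * w') *\<^sub>R M2"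
      by (simp add: A B M_def scaleR_add_right scaleR_add_left)
    then have "a *\<^sub>R A + b *\<^sub>R B = M (a * u + b * u') (a * w + b * w')"
      by (simp add: ab M_def)
    moreover have "0 \<le> a * u + b * u'" "a * u + b * u' \<le> 1" "0 \<le> a * w + b * w'" "a * w + b * w' \<le> 1"
      using A B ab by (auto intro: convex_bound_le)
    ultimately show "a *\<^sub>R A + b *\<^sub>R B \<in> {M u w | u w. 0 \<le> u \<and> u \<le> 1 \<and> 0 \<le> w \<and> w \<le> 1}"
      by blast
  qed
qed

lemma tensor_solution:
  assumes y: "solution 1 u y" and z: "solution c w z"
  shows "ode_solution (\<lambda>t v. M (u t) (w t) *v v) (\<lambda>t. tensor (y t) (z t))"
proof -
  obtain N1 where N1: "negligible N1"
    "\<And>t. t > 0 \<Longrightarrow> t \<notin> N1 \<Longrightarrow> (y has_vector_derivative 1 *\<^sub>R field (u t) (y t)) (at t)"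
    using ode_solutionE y unfolding solution_def by blast
  obtain N2 where N2: "negligible N2"
    "\<And>t. t > 0 \<Longrightarrow> t \<notin> N2 \<Longrightarrow> (z has_vector_derivative c *\<^sub>R field (w t) (z t)) (at t)"
    using ode_solutionE z unfolding solution_def by blast
  show ?thesis
    unfolding ode_solution_def
  proof (intro conjI allI exI[of _ "N1 \<union> N2"] impI)
    show "abs_continuous_on {0..b} (\<lambda>t. tensor (y t) (z t))" for b
      using y z ode_solution_abs_continuous unfolding solution_def
      by (intro abs_continuous_on_bounded_bilinear[OF bounded_bilinear_tensor]) auto
    fix t :: real assume t: "0 < t" "t \<notin> N1 \<union> N2"
    have "((\<lambda>t. tensor (y t) (z t)) has_vector_derivative
        tensor (y t) (c *\<^sub>R field (w t) (z t)) + tensor (1 *\<^sub>R field (u t) (y t)) (z t)) (at t)"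
      by (rule bounded_bilinear.has_vector_derivative[OF bounded_bilinear_tensor])
        (use N1(2)[of t] N2(2)[of t] t in auto)
    then show "((\<lambda>t. tensor (y t) (z t)) has_vector_derivative M (u t) (w t) *v tensor (y t) (z t)) (at t)"
      by (simp add: M_tensor add.commute)
  qed (use N1 N2 in auto)
qed

lemma not_both_integers:
  assumes "T > 0" shows "1 * T \<notin> \<int> \<or> c * T \<notin> \<int>"
proof (rule ccontr)
  assume "\<not> ?thesis"
  then have "T \<in> \<int>" "c * T \<in> \<int>" by auto
  then have "c * T / T \<in> \<rat>" using Ints_subset_Rats by (intro Rats_divide) auto
  then show False using c_irrational assms by simp
qed

end

lemma exists_extremal_spiral: "\<exists>L s. extremal_spiral L s"
proof -
  \<comment> \<open>A zero of \<open>h\<close> satisfies \<open>balance\<close>. Here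
    \<open>h 1 = - 2 * exp (- 2)\<close>, and \<open>h 2 = 1 - 3 * exp (- 4)\<close> is nonnegative
    as soon as \<open>exp 2\<close> is at least 3.\<close>
  define h where "h x = x * (1 - (exp (- x))\<^sup>2) - (1 + (exp (- x))\<^sup>2)" for x :: real
  have "exp (- 2 :: real) \<le> 1 / 3"
    using exp_ge_add_one_self[of "2::real"] by (simp add: exp_minus field_simps)
  then have "(exp (- 2 :: real))\<^sup>2 \<le> (1 / 3)\<^sup>2" by (intro power_mono) auto
  then have "h 2 \<ge> 0" by (simp add: h_def power2_eq_square)
  moreover have "h 1 \<le> 0" by (simp add: h_def)
  moreover have "continuous_on {1..2} h" unfolding h_def by (intro continuous_intros)
  ultimately obtain x where "1 \<le> x" "x \<le> 2" "h x = 0" using IVT'[of h 1 0 2] by auto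
  then have "extremal_spiral x (exp (- x))" by unfold_locales (auto simp: h_def)
  then show ?thesis by blast
qed

section \<open>The extremal trajectory\<close>

context extremal_spiral
begin

text \<open>This is the exponential of \<open>f * (- L + N)\<close> applied to \<open>1\<close>; the
  nilpotent part contributes only the factor \<open>1 + f * N\<close>.\<close>

definition spiral_arc :: "real \<Rightarrow> complex" where
  "spiral_arc f = (exp (- L * f) * (1 - f)) *\<^sub>R 1 + (exp (- L * f) * (f / s)) *\<^sub>R \<i>"

lemma spiral_arc_derivative: "(spiral_arc has_vector_derivative field 1 (spiral_arc f)) (at f)"
proof -
  let ?a = "- L * exp (- L * f) * (1 - f) - exp (- L * f)"
  let ?b = "- L * exp (- L * f) * (f / s) + exp (- L * f) / s"
  have "((\<lambda>f. exp (- L * f) * (1 - f)) has_real_derivative ?a) (at f)"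
    "((\<lambda>f. exp (- L * f) * (f / s)) has_real_derivative ?b) (at f)"
    using s_pos by (auto intro!: derivative_eq_intros simp: field_simps)
  then have "((\<lambda>f. (exp (- L * f) * (1 - f)) *\<^sub>R 1 + (exp (- L * f) * (f / s)) *\<^sub>R \<i>)
      has_vector_derivative ?a *\<^sub>R 1 + ?b *\<^sub>R \<i>) (at f)"
    using has_vector_derivative_add[OF has_vector_derivative_scaleR[OF _ has_vector_derivative_const]
        has_vector_derivative_scaleR[OF _ has_vector_derivative_const], of _ ?a f UNIV _ ?b 1 \<i>] by simp
  moreover have "?a *\<^sub>R 1 + ?b *\<^sub>R \<i> = field 1 (spiral_arc f)"
    using s_pos by (simp add: complex_eq_iff Re_field Im_field spiral_arc_def field_simps)
  ultimately show ?thesis unfolding spiral_arc_def[abs_def] by simp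
qed

lemma spiral_arc_ends: "spiral_arc 0 = 1" "spiral_arc 1 = \<i>"
  using s_pos by (simp_all add: spiral_arc_def complex_eq_iff s_eq[symmetric])

text \<open>The form \<open>Re + s * Im\<close> annihilates the range of \<open>N\<close>, so it
  equals \<open>exp (- L * f)\<close> along the arc; it is at most twice the norm.\<close>

lemma norm_spiral_arc_ge:
  assumes "0 \<le> f" "f \<le> 1" shows "s / 2 \<le> norm (spiral_arc f)"
proof -
  have "s \<le> exp (- L * f)" using assms L_pos by (simp add: s_eq mult_left_le)
  also have "\<dots> = Re (spiral_arc f) + s * Im (spiral_arc f)" using s_pos by (simp add: spiral_arc_def algebra_simps)
  also have "\<dots> \<le> norm (spiral_arc f) + norm (spiral_arc f)"
  proof (rule add_mono[OF complex_Re_le_cmod])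
    have "s * Im (spiral_arc f) \<le> s * norm (spiral_arc f)"
      using s_pos abs_Im_le_cmod[of "spiral_arc f"] by (intro mult_left_mono) auto
    also have "\<dots> \<le> norm (spiral_arc f)" using s_pos s_less_1 by (intro mult_left_le_one_le) auto
    finally show "s * Im (spiral_arc f) \<le> norm (spiral_arc f)" .
  qed
  finally show ?thesis by simp
qed

text \<open>Each unit of time repeats the arc after one further quarter turn. For
  \<open>t \<ge> 0\<close> the curve is closed, with period 4.\<close>

definition curve :: "real \<Rightarrow> complex" where
  "curve t = \<i> ^ nat \<lfloor>t\<rfloor> * spiral_arc (frac t)"

definition bang :: "real \<Rightarrow> real" where
  "bang t = (if even (nat \<lfloor>t\<rfloor>) then 1 else 0)"

lemma field_rotate_power: "field (if even n then 1 else 0) (\<i> ^ n * z) = \<i> ^ n * field 1 z"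
proof (induction n)
  case (Suc n)
  have "\<i> * field (if even n then 1 else 0) (\<i> ^ n * z) =
      field (1 - (if even n then 1 else 0)) (\<i> * (\<i> ^ n * z))"
    by (rule field_rotate[symmetric])
  then show ?case using Suc by (simp add: mult.assoc split: if_splits)
qed simp

text \<open>The right end belongs to the next cell, but both formulas give the same point there
  because the arc ends at \<open>\<i>\<close>. Closed cells allow estimates up to the switching
  times.\<close>

lemma curve_cell:
  assumes "real n \<le> t" "t \<le> real n + 1" shows "curve t = \<i> ^ n * spiral_arc (t - real n)"
proof (cases "t = real n + 1")
  case True
  then have "\<lfloor>t\<rfloor> = int n + 1" by simp
  then have nt: "nat \<lfloor>t\<rfloor> = Suc n" and ft: "frac t = 0" using True by (simp_all add: frac_def)
  show ?thesis unfolding curve_def nt ft using True by (simp add: spiral_arc_ends)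
next
  case False
  then have "\<lfloor>t\<rfloor> = int n" using assms by (simp add: floor_eq_iff)
  then show ?thesis by (simp add: curve_def frac_def)
qed

lemma curve_derivative:
  assumes "t > 0" "t \<notin> \<int>"
  shows "(curve has_vector_derivative field (bang t) (curve t)) (at t)"
proof -
  define n where "n = nat \<lfloor>t\<rfloor>"
  have "real n \<le> t" "t < real n + 1" using assms(1) by (auto simp: n_def)
  moreover have "real n \<noteq> t" using assms(2) by (metis Ints_of_nat)
  ultimately have n: "real n < t" "t < real n + 1" by auto
  have "((\<lambda>t. spiral_arc (t - real n)) has_vector_derivative field 1 (spiral_arc (t - real n))) (at t)"
  proof -
    have "(spiral_arc \<circ> (\<lambda>t. t - real n) has_vector_derivative 1 *\<^sub>R field 1 (spiral_arc (t - real n))) (at t)"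
      by (intro vector_diff_chain_at spiral_arc_derivative) (auto intro!: derivative_eq_intros)
    then show ?thesis by (simp add: o_def)
  qed
  then have "((\<lambda>t. \<i> ^ n * spiral_arc (t - real n)) has_vector_derivative \<i> ^ n * field 1 (spiral_arc (t - real n))) (at t)"
    by (rule has_vector_derivative_mult_right)
  moreover have "\<i> ^ n * field 1 (spiral_arc (t - real n)) = field (bang t) (curve t)"
    using n by (simp add: bang_def n_def[symmetric] curve_cell[of n] field_rotate_power del: of_nat_power)
  ultimately have "((\<lambda>t. \<i> ^ n * spiral_arc (t - real n)) has_vector_derivative field (bang t) (curve t)) (at t)"
    by simp
  then show ?thesis
    by (rule has_vector_derivative_transform_within_open[of _ _ _ "{real n<..<real n + 1}"])
      (use n curve_cell[of n] in \<open>simp_all add: less_imp_le\<close>)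
qed

text \<open>Rotations are isometries, so the constant of a single arc is valid in every cell;
  bisection then joins the cells.\<close>

lemma curve_lipschitz:
  obtains C where "\<And>p q. 0 \<le> p \<Longrightarrow> p \<le> q \<Longrightarrow> norm (curve q - curve p) \<le> C * (q - p)"
proof -
  have "continuous_on {0..1} (\<lambda>f. field 1 (spiral_arc f))"
    unfolding field_def spiral_arc_def Complex_eq by (intro continuous_intros) (use s_pos in auto)
  then obtain C where C: "\<And>u v. 0 \<le> u \<Longrightarrow> u \<le> v \<Longrightarrow> v \<le> 1 \<Longrightarrow> norm (spiral_arc v - spiral_arc u) \<le> C * (v - u)"
    using C1_imp_lipschitz[OF spiral_arc_derivative, of 0 1] by blast
  have cell: "norm (curve q - curve p) \<le> C * (q - p)"
    if "real n \<le> p" "p \<le> q" "q \<le> real n + 1" for n p q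
  proof -
    have "curve q - curve p = \<i> ^ n * (spiral_arc (q - real n) - spiral_arc (p - real n))"
      using curve_cell[of n p] curve_cell[of n q] that by (simp add: right_diff_distrib)
    then have "norm (curve q - curve p) = norm (spiral_arc (q - real n) - spiral_arc (p - real n))"
      by (simp add: norm_mult norm_power)
    also have "\<dots> \<le> C * (q - p)" using C[of "p - real n" "q - real n"] that by simp
    finally show ?thesis .
  qed
  have join: "norm (curve r - curve p) \<le> C * (r - p)"
    if "norm (curve q - curve p) \<le> C * (q - p)" "norm (curve r - curve q) \<le> C * (r - q)" for p q r
  proof -
    have "norm (curve r - curve p) \<le> norm (curve r - curve q) + norm (curve q - curve p)"
      by (metis diff_add_cancel add_diff_eq norm_triangle_ineq)
    also have "\<dots> \<le> C * (r - p)" using that by (simp add: algebra_simps)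
    finally show ?thesis .
  qed
  show thesis
  proof (rule that)
    fix a b :: real assume ab: "0 \<le> a" "a \<le> b"
    define P where "P p q \<longleftrightarrow> a \<le> p \<and> p \<le> q \<longrightarrow> norm (curve q - curve p) \<le> C * (q - p)" for p q
    have "P a b"
      using ab(2)
    proof (induction rule: Bolzano)
      case (trans p q r)
      then show ?case unfolding P_def using join[of q p r] by linarith
    next
      case (local x)
      define n where "n = nat \<lfloor>x\<rfloor>"
      have n: "real n \<le> x" "x < real n + 1" using local ab by (auto simp: n_def)
      show ?case
      proof (cases "x = real n")
        case True
        show ?thesis
        proof (intro exI[of _ 1] conjI allI impI)
          fix p q assume pq: "p \<le> x \<and> x \<le> q \<and> q - p < 1"
          have "norm (curve x - curve p) \<le> C * (x - p)" if "a \<le> p"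
          proof (cases "p = x")
            case False
            \<comment> \<open>A point \<open>p\<close> to the left of \<open>real n\<close> falls
              into the preceding cell, which exists because \<open>0 \<le> a\<close> and
              \<open>a \<le> p\<close>.\<close>
            then have "n \<ge> 1" using that True pq ab by (cases n) auto
            then show ?thesis using cell[of "n - 1" p x] pq True by (simp add: of_nat_diff)
          qed simp
          moreover have "norm (curve q - curve x) \<le> C * (q - x)"
            using cell[of n x q] pq True by simp
          ultimately show "P p q" unfolding P_def using join[of x p q] by blast
        qed simp
      next
        case False
        show ?thesis
        proof (intro exI[of _ "min (x - real n) (real n + 1 - x)"] conjI allI impI)
          fix p q assume "p \<le> x \<and> x \<le> q \<and> q - p < min (x - real n) (real n + 1 - x)"
          then show "P p q" unfolding P_def using cell[of n p q] by auto
        qed (use n False in auto)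
      qed
    qed
    then show "norm (curve b - curve a) \<le> C * (b - a)" using ab by (simp add: P_def)
  qed
qed

lemma curve_solution:
  assumes r: "r > 0"
  shows "solution r (\<lambda>t. bang (r * t)) (\<lambda>t. curve (r * t))"
  unfolding solution_def ode_solution_def
\<comment> \<open>The exceptional times are those at which \<open>r * t\<close> is an integer, where
  the law switches.\<close>
proof (intro conjI allI exI[of _ "(\<lambda>n. of_int n / r) ` UNIV"] impI)
  obtain C where C: "\<And>p q. 0 \<le> p \<Longrightarrow> p \<le> q \<Longrightarrow> norm (curve q - curve p) \<le> C * (q - p)"
    using curve_lipschitz by blast
  show "abs_continuous_on {0..b} (\<lambda>t. curve (r * t))" for b
  proof (rule abs_continuous_on_lipschitz[where C = "C * r"])
    fix u v assume "u \<in> {0..b}" "v \<in> {0..b}" "u \<le> v"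
    then show "norm (curve (r * v) - curve (r * u)) \<le> C * r * (v - u)"
      using C[of "r * u" "r * v"] r by (simp add: algebra_simps)
  qed
  show "negligible (range (\<lambda>n. of_int n / r))"
    unfolding negligible_iff_null_sets
    by (intro null_sets_completionI countable_imp_null_set_lborel countable_image) auto
  fix t :: real assume t: "0 < t" "t \<notin> range (\<lambda>n. of_int n / r)"
  have "r * t \<notin> \<int>"
  proof
    assume "r * t \<in> \<int>"
    then obtain n where "r * t = of_int n" by (rule Ints_cases)
    then have "t = of_int n / r" using r by (simp add: field_simps)
    then show False using t(2) by blast
  qed
  then have "(curve has_vector_derivative field (bang (r * t)) (curve (r * t))) (at (r * t))"
    using t r by (intro curve_derivative) auto
  then have "(curve \<circ> (\<lambda>t. r * t) has_vector_derivative r *\<^sub>R field (bang (r * t)) (curve (r * t))) (at t)"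
    by (intro vector_diff_chain_at)
      (auto intro!: derivative_eq_intros simp: has_real_derivative_iff_has_vector_derivative[symmetric])
  then show "((\<lambda>t. curve (r * t)) has_vector_derivative r *\<^sub>R field (bang (r * t)) (curve (r * t))) (at t)"
    by (simp add: o_def)
qed

lemma norm_curve_ge: "s / 2 \<le> norm (curve t)"
  using norm_spiral_arc_ge[of "frac t"] frac_lt_1[of t] by (simp add: curve_def norm_mult norm_power)

lemma bang_measurable [measurable]: "bang \<in> borel_measurable borel"
  unfolding bang_def[abs_def] by measurable

end

section \<open>The two properties of the four matrices\<close>

context tensor_pair
begin

text \<open>This supplies the Lipschitz constant, common to all values of the law, for uniqueness of
  solutions in four dimensions.\<close>

lemma vertices_bound:
  obtains K where "\<And>B v. B \<in> convex hull vertices \<Longrightarrow> norm (B *v v) \<le> K * norm v"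
proof -
  have "bounded (convex hull vertices)"
    by (intro bounded_convex_hull finite_imp_bounded) (simp add: vertices_def)
  then obtain b where b: "\<And>B. B \<in> convex hull vertices \<Longrightarrow> norm B \<le> b"
    unfolding bounded_iff by blast
  show thesis
  proof (rule that)
    fix B and v :: "real^4" assume B: "B \<in> convex hull vertices"
    have "\<bar>B $ i $ j\<bar> \<le> b" for i j
      
      using component_le_norm_cart[of "B $ i" j] Finite_Cartesian_Product.norm_nth_le[of B i] b[OF B] by linarith
    then have "onorm ((*v) B) \<le> real CARD(4) * real CARD(4) * b"
      by (rule onorm_le_matrix_component)
    then have "onorm ((*v) B) * norm v \<le> (16 * b) * norm v"
      by (intro mult_right_mono) auto
    then show "norm (B *v v) \<le> 16 * b * norm v"
      using onorm[OF matrix_vector_mul_bounded_linear[of B], of v] by simp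
  qed
qed

lemma periodic_law_exponentially_stable:
  assumes A: "switching_law (convex hull vertices) A" and per: "periodic_law A"
    and x: "caratheodory_solution A x"
  shows "converges_exponentially_to_zero x"
proof -
  obtain T where T: "T > 0" "\<And>t. t \<ge> 0 \<Longrightarrow> A (t + T) = A t"
    using per unfolding periodic_law_def by blast
  \<comment> \<open>Inverting \<open>M_entries\<close>: both weights are affine functions of single
    entries of \<open>A t\<close>, so they inherit measurability and the period \<open>T\<close>
    from \<open>A\<close>.\<close>
  define u where "u t = (A t $ 3 $ 1 - s) / (1 / s - s)" for t
  define w where "w t = (A t $ 2 $ 1 / c - s) / (1 / s - s)" for t
  have A_M: "A t = M (u t) (w t)" and bounds: "0 \<le> u t \<and> u t \<le> 1" "0 \<le> w t \<and> w t \<le> 1" if "t \<ge> 0" for t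
  proof -
    have "A t \<in> {M u w | u w. 0 \<le> u \<and> u \<le> 1 \<and> 0 \<le> w \<and> w \<le> 1}"
      using A convex_hull_vertices that unfolding switching_law_def by blast
    then obtain u0 w0 where *: "A t = M u0 w0" "0 \<le> u0" "u0 \<le> 1" "0 \<le> w0" "w0 \<le> 1" by blast
    have "u t = u0" "w t = w0"
      unfolding u_def w_def *(1) M_entries using slope_pos c_pos by simp_all
    then show "A t = M (u t) (w t)" "0 \<le> u t \<and> u t \<le> 1" "0 \<le> w t \<and> w t \<le> 1"
      using * by simp_all
  qed
  have Am: "A \<in> borel_measurable (lebesgue_on {0..})"
    using A unfolding switching_law_def by blast
  have entry: "(\<lambda>t. A t $ i $ j) \<in> borel_measurable (lebesgue_on {0..})" for i j
    by (rule borel_measurable_continuous_on[OF _ Am, of "\<lambda>B. B $ i $ j"]) (intro continuous_intros)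
  have u: "law u" "u \<in> borel_measurable (lebesgue_on {0..})"
    using bounds by (simp add: law_def, unfold u_def)
      (intro borel_measurable_divide borel_measurable_diff entry borel_measurable_const)
  have w: "law w" "w \<in> borel_measurable (lebesgue_on {0..})"
    using bounds by (simp add: law_def, unfold w_def)
      (intro borel_measurable_divide borel_measurable_diff entry borel_measurable_const)
  have u_per: "u (t + T) = u t" and w_per: "w (t + T) = w t" if "t \<ge> 0" for t
    using T(2)[OF that] by (simp_all add: u_def w_def)
  obtain y1 where y1: "solution 1 u y1" "y1 0 = 1" using solution_exists[OF u zero_less_one] by blast
  obtain y2 where y2: "solution 1 u y2" "y2 0 = \<i>" using solution_exists[OF u zero_less_one] by blast
  obtain z1 where z1: "solution c w z1" "z1 0 = 1" using solution_exists[OF w c_pos] by blast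
  obtain z2 where z2: "solution c w z2" "z2 0 = \<i>" using solution_exists[OF w c_pos] by blast
  have sol: "ode_solution (\<lambda>t v. A t *v v) (\<lambda>t. tensor (y t) (z t))"
    if "solution 1 u y" "solution c w z" for y z
    using ode_solution_linear_image[OF tensor_solution[OF that] bounded_linear_ident,
        of "\<lambda>t v. A t *v v"] A_M by simp
  \<comment> \<open>The four products start at the standard basis vectors, so \<open>X\<close> has
    the initial value \<open>x 0\<close>. The factors \<open>1\<close> give the sum the shape
    expected by \<open>ode_solution_add_scaled\<close>.\<close>
  define X where "X t = 1 *\<^sub>R ((x 0 $ 1) *\<^sub>R tensor (y1 t) (z1 t) + (x 0 $ 2) *\<^sub>R tensor (y1 t) (z2 t))
      + 1 *\<^sub>R ((x 0 $ 3) *\<^sub>R tensor (y2 t) (z1 t) + (x 0 $ 4) *\<^sub>R tensor (y2 t) (z2 t))" for t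
  have X: "ode_solution (\<lambda>t v. A t *v v) X"
    unfolding X_def
    by (intro ode_solution_add_scaled[where F = "\<lambda>t v. A t *v v" and G = "\<lambda>t v. A t *v v"] sol y1 y2 z1 z2)
      (simp_all add: matrix_vector_right_distrib matrix_vector_mult_scaleR)
  obtain K where K: "\<And>B v. B \<in> convex hull vertices \<Longrightarrow> norm (B *v v) \<le> K * norm v"
    using vertices_bound by blast
  have "X 0 = x 0"
    by (simp add: X_def y1 y2 z1 z2 tensor_def vec_eq_iff forall_4)
  have x_X: "x t = X t" if "t \<ge> 0" for t
  proof (rule ode_solution_unique[OF x[unfolded caratheodory_solution_iff_ode_solution] X _ _ that])
    show "norm (A t *v v - A t *v v') \<le> K * norm (v - v')" if "t > 0" for t v v'
      using K[of "A t" "v - v'"] A that by (simp add: switching_law_def matrix_vector_mult_diff_distrib)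
  qed (simp add: \<open>X 0 = x 0\<close>)
  have decay: "converges_exponentially_to_zero (\<lambda>t. tensor (y t) (z t))"
    if y: "solution 1 u y" and z: "solution c w z" for y z
  proof (cases "1 * T \<in> \<int>")
    case False
    have "converges_exponentially_to_zero y"
      by (rule solution_exponential_decay[OF y zero_less_one u T(1) u_per False])
    then show ?thesis
    proof (rule converges_exponentially_dominated)
      show "norm (tensor (y t) (z t)) \<le> (V (z 0) / s) * norm (y t)" if "t \<ge> 0" for t
        using mult_right_mono[OF solution_bounded[OF z c_pos w(1) that] norm_ge_zero[of "y t"]]
        by (simp add: norm_tensor mult.commute)
    qed
  next
    case True
    then have irr: "c * T \<notin> \<int>" using not_both_integers[OF T(1)] by blast
    have "converges_exponentially_to_zero z"
      by (rule solution_exponential_decay[OF z c_pos w T(1) w_per irr])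
    then show ?thesis
    proof (rule converges_exponentially_dominated)
      show "norm (tensor (y t) (z t)) \<le> (V (y 0) / s) * norm (z t)" if "t \<ge> 0" for t
        using mult_right_mono[OF solution_bounded[OF y zero_less_one u(1) that] norm_ge_zero[of "z t"]]
        by (simp add: norm_tensor)
    qed
  qed
  have scaled: "converges_exponentially_to_zero (\<lambda>t. a *\<^sub>R f t)"
    if "converges_exponentially_to_zero f" for a and f :: "real \<Rightarrow> real^4"
    by (rule converges_exponentially_dominated[OF that, of _ "\<bar>a\<bar>"]) simp
  have "converges_exponentially_to_zero X"
    unfolding X_def by (intro converges_exponentially_add scaled decay y1 y2 z1 z2)
  then show ?thesis
    by (rule converges_exponentially_dominated[of _ _ 1]) (simp add: x_X)
qed

lemma not_GUAS: "\<not> GUAS vertices"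
proof
  assume "GUAS vertices"
  then obtain \<beta> where \<beta>: "class_KL \<beta>" and bound: "\<And>A x t. switching_law vertices A \<Longrightarrow>
      caratheodory_solution A x \<Longrightarrow> t \<ge> 0 \<Longrightarrow> norm (x t) \<le> \<beta> (norm (x 0)) t"
    unfolding GUAS_def by blast
  \<comment> \<open>Both bang-bang laws take only the values 0 and 1, so \<open>A\<close> stays in
    the four vertices themselves and not merely in their convex hull, as \<open>GUAS\<close>
    requires.\<close>
  define A where "A t = M (bang t) (bang (c * t))" for t
  define x where "x t = tensor (curve t) (curve (c * t))" for t
  have "A \<in> borel_measurable borel"
    unfolding A_def M_def by measurable
  then have "A \<in> borel_measurable (lebesgue_on {0..})"
    by (intro measurable_restrict_space1 measurable_completion) simp
  then have A: "switching_law vertices A"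
    unfolding switching_law_def by (auto simp: A_def vertices_def bang_def)
  have "ode_solution (\<lambda>t v. A t *v v) x"
    using tensor_solution[OF _ curve_solution[OF c_pos]] curve_solution[of 1]
    unfolding A_def x_def by simp
  then have x: "caratheodory_solution A x" by (simp add: caratheodory_solution_iff_ode_solution)
  have lower: "(s / 2) * (s / 2) \<le> norm (x t)" for t
    unfolding x_def norm_tensor using s_pos by (intro mult_mono norm_curve_ge) auto
  have "((\<lambda>t. \<beta> (norm (x 0)) t) \<longlongrightarrow> 0) at_top"
    using \<beta> unfolding class_KL_def by auto
  then have "(s / 2) * (s / 2) \<le> 0"
  proof (rule tendsto_lowerbound)
    show "\<forall>\<^sub>F t in at_top. (s / 2) * (s / 2) \<le> \<beta> (norm (x 0)) t"
      using eventually_ge_at_top[of 0] by eventually_elim (use lower bound[OF A x] order_trans in blast)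
  qed simp
  then show False using s_pos by (simp add: mult_le_0_iff)
qed

end

theorem theorem1:
  shows "\<exists>S :: (real^4^4) set. card S = 4 \<and>
    (\<forall>A. switching_law (convex hull S) A \<longrightarrow> periodic_law A \<longrightarrow>
       (\<forall>x. caratheodory_solution A x \<longrightarrow> converges_exponentially_to_zero x)) \<and>
    \<not> GUAS S"
proof -
  obtain L s where "extremal_spiral L s" using exists_extremal_spiral by blast
  then interpret extremal_spiral L s .
  have "uncountable ({0<..<1} :: real set)" by (simp add: uncountable_open_interval)
  then obtain c :: real where c: "0 < c" "c \<notin> \<rat>"
    by (metis countable_rat countable_subset greaterThanLessThan_iff subsetI)
  interpret tensor_pair L s c by unfold_locales (use c in auto)
  show ?thesis
    using card_vertices periodic_law_exponentially_stable not_GUAS by blast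
qed

end
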